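(* Let $\mathbb{K}^*$ be the projective Fraïssé limit of the category $\mathcal{K}^*$, let $K$ be the universal Knaster continuum, and let $\mathrm{Homeo}^1(K)\le\mathrm{Homeo}(K)$ be the subgroup of all homeomorphisms of degree $1$. (i) The group $\mathrm{Aut}(\mathbb{K}^* )$ is extremely amenable. (ii) The group $\mathrm{Homeo}^1(K)$ is extremely amenable.
   Context: A topological group is extremely amenable if every continuous action of it on a (nonempty) compact Hausdorff space has a fixed point. Category $\mathcal{K}$. For an integer $n\ge 2$, $\langle n\rangle$ denotes the pointed finite linear graph with vertex set $\{0,\dots,n-1\}$, edge relation $(i,j)\in R \iff |i-j|\le 1$, and zero-vertex $0$; every pointed finite linear graph (finite path with loops at all vertices and a designated end vertex, the zero-vertex) is isomorphic to some $\langle n\rangle$. An epimorphism takes edges to edges, is surjective on vertices and edges, and preserves the zero-vertex. $\mathcal{K}$ is the category of pointed finite linear graphs whose morphisms are all epimorphisms $f:\langle n\rangle\to\langle m\rangle$ for which there exist $0=i_0<\cdots<i_k=n-1$ such that $f$ restricted to each $[i_j,i_{j+1}]$ is monotone, $f(i_j)=m-1$ for $j$ odd and $f(i_j)=0$ for $j$ even; the number $k$ is the degree $\deg(f)$. Category $\mathcal{K}^*$. Let $\mathbb{Q}^\times$ be the multiplicative group of positive rationals. Objects of $\mathcal{K}^*$ are pairs $(A,n)$ with $A$ a pointed finite linear graph and $n\in\mathbb{Q}^\times$; a morphism $f:(B,m)\to(A,n)$ is a morphism $f:B\to A$ of $\mathcal{K}$ with $\deg(f)=m/n$. It is a projective Fraïssé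 family. A generic sequence in $\mathcal{K}^*$ is a sequence of objects $A_n$ and morphisms $f_n^{n+1}:A_{n+1}\to A_n$ such that every object $A$ receives a morphism from some $A_n$, and for all morphisms $e:A_n\to A$, $g:B\to A$ there are $N>n$ and $h:A_N\to B$ with $g\circ h=e\circ f_n^N$, where $f_n^N=f_n^{n+1}\circ\cdots\circ f_{N-1}^N$. The projective Fraïssé limit $\mathbb{K}^*$ is the inverse limit of any generic sequence in $\mathcal{K}^*$. An automorphism of $\mathbb{K}^*=\varprojlim(A_n,f_n^{n+1})$ is an invertible map $g$ such that both $g$ and $g^{-1}$ are morphisms, where $g$ is a morphism if there are $i_1<i_2<\cdots$ and morphisms $g_n:A_{i_n}\to A_n$ of $\mathcal{K}^*$ with $\pi_n\circ g=g_n\circ\pi_{i_n}$ for all $n$ ($\pi_n$ the coordinate projections). $\mathrm{Aut}(\mathbb{K}^* )$ is topologized as a subgroup of the homeomorphism group (with uniform convergence topology) of the compact zero-dimensional space underlying $\mathbb{K}^*$. Knaster continua and degree. Let $I=[0,1]$. A Knaster continuum is a space $\varprojlim(I,T_n^{n+1})$ with each $T_n^{n+1}:I\to I$ a continuous open surjection fixing $0$. The universal Knaster continuum $K$ is the (unique up to homeomorphism) Knaster continuum admitting continuous open surjections onto all Knaster continua. $\mathrm{Homeo}(K)$ has the topology of uniform convergence, and its subgroup $\mathrm{Homeo}^1(K)$ the subspace topology. For a continuous open $f:I\to I$ with $f(0)=0$ there are $0=x_0<\cdots<x_n=1$ such that $f$ maps each $[x_i,x_{i+1}]$ homeomorphically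 onto $[0,1]$; the number $n$ is $\deg(f)$. Write $K=\varprojlim(I_n,t_n^{n+1})_{n\ge1}$ with $I_n=I$ and each $t_n^{n+1}$ a standard tent map (the piecewise linear map of some degree $d$ with constant slope $\pm d$, fixing $0$), let $\pi_i^K$ be the coordinate projections and $t_1^i:I_i\to I_1$ the composite bonding map. For $f\in\mathrm{Homeo}(K)$ there are continuous open maps $f_i:I_i\to I$ fixing $0$ with $f_i\circ\pi_i^K\to\pi_1^K\circ f$ uniformly, and $\deg(f):=\lim_i \deg(f_i)/\deg(t_1^i)$; by results of Dębski the ratio is eventually constant, independent of the chosen $f_i$, and $\deg:\mathrm{Homeo}(K)\to\mathbb{Q}^\times$ is a continuous homomorphism ($\mathbb{Q}^\times$ discrete). $\mathrm{Homeo}^1(K)$ is its kernel. *)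

theory Defs
  imports "HOL-Analysis.Analysis" "HOL-Algebra.Group_Action"
begin

section \<open>Topological groups and extreme amenability\<close>

definition topological_group :: "('g, 'r) monoid_scheme \<Rightarrow> 'g topology \<Rightarrow> bool" where
  "topological_group G T \<longleftrightarrow>
     group G \<and> topspace T = carrier G \<and>
     continuous_map (prod_topology T T) T (\<lambda>(g, h). g \<otimes>\<^bsub>G\<^esub> h) \<and>
     continuous_map T T (\<lambda>g. inv\<^bsub>G\<^esub> g)"

text \<open>HOL cannot quantify over types inside a definition, so the type of the points of the spaces
  acted upon is a parameter; a theorem that leaves it as a type variable covers all spaces.\<close>

definition extremely_amenable ::
  "'x itself \<Rightarrow> ('g, 'r) monoid_scheme \<Rightarrow> 'g topology \<Rightarrow> bool" where
  "extremely_amenable _ G T \<longleftrightarrow>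
     topological_group G T \<and>
     (\<forall>(X :: 'x topology) \<phi>.
        compact_space X \<and> Hausdorff_space X \<and> topspace X \<noteq> {} \<and>
        group_action G (topspace X) \<phi> \<and>
        continuous_map (prod_topology T X) X (\<lambda>(g, x). \<phi> g x) \<longrightarrow>
        (\<exists>x\<in>topspace X. \<forall>g\<in>carrier G. \<phi> g x = x))"

section \<open>Groups of self-maps with the topology of uniform convergence\<close>

text \<open>Self-maps of a space are represented by extensional functions, as in \<^const>\<open>BijGroup\<close>.\<close>

definition homeos :: "'a topology \<Rightarrow> ('a \<Rightarrow> 'a) set" where
  "homeos X = {f \<in> Bij (topspace X). homeomorphic_map X X f}"

definition perm_group :: "'a set \<Rightarrow> ('a \<Rightarrow> 'a) set \<Rightarrow> ('a \<Rightarrow> 'a) monoid" where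
  "perm_group S H = (BijGroup S)\<lparr>carrier := H\<rparr>"

text \<open>\<^const>\<open>cfunspace\<close> is the space of bounded continuous maps with the supremum metric.\<close>

definition uniform_topology :: "'a metric \<Rightarrow> ('a \<Rightarrow> 'a) set \<Rightarrow> ('a \<Rightarrow> 'a) topology" where
  "uniform_topology m H = subtopology (mtopology_of (cfunspace (mtopology_of m) m)) H"

section \<open>Inverse sequences\<close>

text \<open>The bonding map \<open>F n\<close> goes from the space with index \<open>n + 1\<close> to the one with index \<open>n\<close>;
  for \<open>n \<le> N\<close>, \<open>bond F n N\<close> is \<open>F n \<circ> \<dots> \<circ> F (N - 1)\<close>.\<close>

definition bond :: "(nat \<Rightarrow> 'a \<Rightarrow> 'a) \<Rightarrow> nat \<Rightarrow> nat \<Rightarrow> 'a \<Rightarrow> 'a" where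
  "bond F n N = fold (\<lambda>k g. g \<circ> F k) [n..<N] id"

definition inverse_limit :: "(nat \<Rightarrow> 'a topology) \<Rightarrow> (nat \<Rightarrow> 'a \<Rightarrow> 'a) \<Rightarrow> (nat \<Rightarrow> 'a) topology" where
  "inverse_limit X F =
     subtopology (product_topology X UNIV) {x. \<forall>n. x n = F n (x (Suc n))}"

section \<open>The category of pointed finite linear graphs\<close>

text \<open>The pointed linear graph on \<open>{0,\<dots>,n-1}\<close> (\<open>n \<ge> 2\<close>) is represented by the number \<open>n\<close>.\<close>

definition path_edges :: "nat \<Rightarrow> (nat \<times> nat) set" where
  "path_edges n = {(i, j). i < n \<and> j < n \<and> \<bar>int i - int j\<bar> \<le> 1}"

definition pointed_epi :: "nat \<Rightarrow> nat \<Rightarrow> (nat \<Rightarrow> nat) \<Rightarrow> bool" where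
  "pointed_epi n m f \<longleftrightarrow>
     f ` {..<n} = {..<m} \<and> map_prod f f ` path_edges n = path_edges m \<and> f 0 = 0"

definition K_subdivision :: "nat \<Rightarrow> nat \<Rightarrow> (nat \<Rightarrow> nat) \<Rightarrow> nat \<Rightarrow> (nat \<Rightarrow> nat) \<Rightarrow> bool" where
  "K_subdivision n m f k i \<longleftrightarrow>
     i 0 = 0 \<and> i k = n - 1 \<and> (\<forall>j<k. i j < i (Suc j)) \<and>
     (\<forall>j<k. mono_on {i j..i (Suc j)} f \<or> antimono_on {i j..i (Suc j)} f) \<and>
     (\<forall>j\<le>k. f (i j) = (if odd j then m - 1 else 0))"

definition K_morphism :: "nat \<Rightarrow> nat \<Rightarrow> (nat \<Rightarrow> nat) \<Rightarrow> bool" where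
  "K_morphism n m f \<longleftrightarrow>
     n \<ge> 2 \<and> m \<ge> 2 \<and> pointed_epi n m f \<and> (\<exists>k i. K_subdivision n m f k i)"

definition K_degree :: "nat \<Rightarrow> nat \<Rightarrow> (nat \<Rightarrow> nat) \<Rightarrow> nat" where
  "K_degree n m f = (THE k. \<exists>i. K_subdivision n m f k i)"

section \<open>The category of graphs weighted by positive rationals\<close>

definition Kstar_object :: "nat \<times> rat \<Rightarrow> bool" where
  "Kstar_object A \<longleftrightarrow> fst A \<ge> 2 \<and> snd A > 0"

definition Kstar_morphism :: "nat \<times> rat \<Rightarrow> nat \<times> rat \<Rightarrow> (nat \<Rightarrow> nat) \<Rightarrow> bool" where
  "Kstar_morphism B A f \<longleftrightarrow>
     Kstar_object B \<and> Kstar_object A \<and> K_morphism (fst B) (fst A) f \<and>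
     of_nat (K_degree (fst B) (fst A) f) = snd B / snd A"

text \<open>Morphisms are functions on \<^typ>\<open>nat\<close> that matter only on the vertices of their domain, so
  equality of morphisms is equality there.\<close>

definition generic_sequence :: "(nat \<Rightarrow> nat \<times> rat) \<Rightarrow> (nat \<Rightarrow> nat \<Rightarrow> nat) \<Rightarrow> bool" where
  "generic_sequence A F \<longleftrightarrow>
     (\<forall>n. Kstar_object (A n)) \<and>
     (\<forall>n. Kstar_morphism (A (Suc n)) (A n) (F n)) \<and>
     (\<forall>C. Kstar_object C \<longrightarrow> (\<exists>n f. Kstar_morphism (A n) C f)) \<and>
     (\<forall>n B C e g. Kstar_morphism (A n) C e \<and> Kstar_morphism B C g \<longrightarrow>
        (\<exists>N>n. \<exists>h. Kstar_morphism (A N) B h \<and>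
           (\<forall>v<fst (A N). g (h v) = e (bond F n N v))))"

definition Kstar_limit ::
  "(nat \<Rightarrow> nat \<times> rat) \<Rightarrow> (nat \<Rightarrow> nat \<Rightarrow> nat) \<Rightarrow> (nat \<Rightarrow> nat) topology" where
  "Kstar_limit A F = inverse_limit (\<lambda>n. discrete_topology {..<fst (A n)}) F"

definition limit_morphism ::
  "(nat \<Rightarrow> nat \<times> rat) \<Rightarrow> (nat \<Rightarrow> nat \<Rightarrow> nat) \<Rightarrow> ((nat \<Rightarrow> nat) \<Rightarrow> (nat \<Rightarrow> nat)) \<Rightarrow> bool" where
  "limit_morphism A F g \<longleftrightarrow>
     (\<exists>i gs. strict_mono i \<and>
        (\<forall>n. Kstar_morphism (A (i n)) (A n) (gs n) \<and>
           (\<forall>x\<in>topspace (Kstar_limit A F). g x n = gs n (x (i n)))))"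

definition Kstar_Aut ::
  "(nat \<Rightarrow> nat \<times> rat) \<Rightarrow> (nat \<Rightarrow> nat \<Rightarrow> nat) \<Rightarrow> ((nat \<Rightarrow> nat) \<Rightarrow> (nat \<Rightarrow> nat)) set" where
  "Kstar_Aut A F =
     {g \<in> Bij (topspace (Kstar_limit A F)).
        limit_morphism A F g \<and> limit_morphism A F (inv_into (topspace (Kstar_limit A F)) g)}"

section \<open>Knaster continua\<close>

abbreviation unit_interval :: "real topology" where
  "unit_interval \<equiv> top_of_set {0..1}"

definition pointed_open_map :: "(real \<Rightarrow> real) \<Rightarrow> bool" where
  "pointed_open_map f \<longleftrightarrow>
     continuous_map unit_interval unit_interval f \<and>
     open_map unit_interval unit_interval f \<and> f 0 = 0"

definition knaster_continuum :: "'a topology \<Rightarrow> bool" where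
  "knaster_continuum X \<longleftrightarrow>
     (\<exists>T. (\<forall>n. pointed_open_map (T n) \<and> T n ` {0..1} = {0..1}) \<and>
        X homeomorphic_space inverse_limit (\<lambda>n. unit_interval) T)"

text \<open>Every Knaster continuum is homeomorphic to one whose points are real sequences, so
  quantifying over topologies on that type loses nothing.\<close>

definition universal_knaster_continuum :: "'a topology \<Rightarrow> bool" where
  "universal_knaster_continuum X \<longleftrightarrow>
     knaster_continuum X \<and>
     (\<forall>Y :: (nat \<Rightarrow> real) topology. knaster_continuum Y \<longrightarrow>
        (\<exists>q. continuous_map X Y q \<and> open_map X Y q \<and> q ` topspace X = topspace Y))"

definition interval_degree :: "(real \<Rightarrow> real) \<Rightarrow> nat" where
  "interval_degree f =
     (THE n. \<exists>x :: nat \<Rightarrow> real. x 0 = 0 \<and> x n = 1 \<and>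
        (\<forall>i<n. x i < x (Suc i) \<and>
           homeomorphic_map (top_of_set {x i..x (Suc i)}) unit_interval f))"

definition tent_map :: "nat \<Rightarrow> real \<Rightarrow> real" where
  "tent_map d x = (if even \<lfloor>real d * x\<rfloor> then frac (real d * x) else 1 - frac (real d * x))"

text \<open>\<open>X\<close> is written as an inverse limit of tent maps of degrees \<open>d n\<close>; \<open>\<pi> x n\<close> is the \<open>n\<close>-th
  coordinate of the point \<open>x\<close>.\<close>

definition tent_presentation ::
  "'a topology \<Rightarrow> (nat \<Rightarrow> nat) \<Rightarrow> ('a \<Rightarrow> nat \<Rightarrow> real) \<Rightarrow> bool" where
  "tent_presentation X d \<pi> \<longleftrightarrow>
     (\<forall>n. d n \<ge> 1) \<and>
     homeomorphic_map X (inverse_limit (\<lambda>n. unit_interval) (\<lambda>n. tent_map (d n))) \<pi>"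

definition knaster_degree ::
  "'a topology \<Rightarrow> (nat \<Rightarrow> nat) \<Rightarrow> ('a \<Rightarrow> nat \<Rightarrow> real) \<Rightarrow> ('a \<Rightarrow> 'a) \<Rightarrow> real" where
  "knaster_degree X d \<pi> f =
     (THE r. \<exists>fs. (\<forall>i. pointed_open_map (fs i)) \<and>
        uniform_limit (topspace X) (\<lambda>i x. fs i (\<pi> x i)) (\<lambda>x. \<pi> (f x) 0) sequentially \<and>
        (\<lambda>i. real (interval_degree (fs i)) /
             real (interval_degree (bond (\<lambda>n. tent_map (d n)) 0 i))) \<longlonglongrightarrow> r)"

definition homeos_degree_1 ::
  "'a topology \<Rightarrow> (nat \<Rightarrow> nat) \<Rightarrow> ('a \<Rightarrow> nat \<Rightarrow> real) \<Rightarrow> ('a \<Rightarrow> 'a) set" where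
  "homeos_degree_1 X d \<pi> = {f \<in> homeos X. knaster_degree X d \<pi> f = 1}"

end

theory Submission
  imports Defs "HOL-Library.Ramsey"
begin

text \<open>Both groups act on a compact metric space by homeomorphisms, and both proofs verify the same
  combinatorial criterion, \<open>oscillation_stable\<close>: for every colouring of the group with finitely
  many colours, every finite subset \<open>F\<close> has a translate \<open>F k\<close> all of whose elements are uniformly
  close to elements of one colour. The criterion implies extreme amenability by a covering
  argument (\<open>extremely_amenable_if_oscillation_stable\<close>), and it passes from a group to its uniform
  closure (\<open>oscillation_stable_closure\<close>).

  For the automorphism group, a morphism of the category is a zigzag map of paths. Unrolled, it
  becomes a walk that at each step stays or moves up by one (\<open>K_morphism_iff_walk\<close>), and a walk
  amounts to the set of its jumps. The weights make the number of jumps depend only on source and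
  target, and the jumps of a composite are among those of the map applied first. So the Ramsey
  property of the category is Ramsey's theorem for finite sets. A back-and-forth argument
  (\<open>ultrahomogeneous\<close>) realises every morphism between members of the generic sequence by an
  automorphism of the limit, which transfers the Ramsey property to the group
  (\<open>Aut_oscillation_stable\<close>).

  For the homeomorphism group, write the continuum as a limit of tent maps of degrees \<open>d n\<close> and
  rescale the coordinate \<open>n\<close> by \<open>D n = d 0 * \<dots> * d (n - 1)\<close>. All bonding maps then fold the
  line by reflections, and an increasing homeomorphism of \<open>[0, D i]\<close>, extended equivariantly to
  the line, induces a homeomorphism of the continuum (\<open>lifts_exists\<close>). The homeomorphisms obtained
  in this way, for all \<open>i\<close>, form a group. It is oscillation stable because an increasing
  homeomorphism of an interval is given, up to \<open>\<epsilon>\<close>, by the finite set that it maps to a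
  fine grid, so that Ramsey's theorem applies again (\<open>lift_ramsey\<close>).

  The main work is to show that the homeomorphisms of degree \<open>1\<close> are exactly the uniform limits of
  these (\<open>homeos_degree_1_eq_closure\<close>). A coordinate of a homeomorphism is an open map onto
  \<open>[0,1]\<close> and therefore has no local extremal values besides \<open>0\<close> and \<open>1\<close>. As a nearly well defined
  function of a coordinate of high index it runs back and forth between \<open>0\<close> and \<open>1\<close> without
  essential detours, so it is close to a folded increasing homeomorphism
  (\<open>open_map_approximation\<close>). The number of laps of this approximation, divided by \<open>D n\<close>, is the
  degree, because open maps of the interval at distance less than \<open>1/2\<close> have equally many laps
  (\<open>close_subdivisions_le\<close>). Thus degree \<open>1\<close> says that the approximation is a homeomorphism of
  \<open>[0, D n]\<close> onto itself. The argument needs homeomorphisms to fix the endpoint of the continuum,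
  which holds once infinitely many \<open>d n\<close> are even; in a universal continuum this follows by
  comparison with the dyadic one (\<open>universal_imp_infinitely_many_even\<close>).\<close>

section \<open>Groups of homeomorphisms of a compact metric space\<close>

lemma perm_group_simps [simp]:
  "carrier (perm_group S H) = H"
  "one (perm_group S H) = (\<lambda>x\<in>S. x)"
  "g \<in> Bij S \<Longrightarrow> h \<in> Bij S \<Longrightarrow> mult (perm_group S H) g h = compose S g h"
  by (auto simp: perm_group_def BijGroup_def)

text \<open>The closure conditions are stated with \<open>compose\<close> and \<open>restrict\<close> because elements of \<open>Bij S\<close>
  are extensional functions, that is, \<open>undefined\<close> outside \<open>S\<close>.\<close>

definition permutation_group :: "'a set \<Rightarrow> ('a \<Rightarrow> 'a) set \<Rightarrow> bool" where
  "permutation_group S H \<longleftrightarrow> H \<subseteq> Bij S \<and> (\<lambda>x\<in>S. x) \<in> H \<and>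
     (\<forall>g\<in>H. \<forall>h\<in>H. compose S g h \<in> H) \<and> (\<forall>g\<in>H. restrict (inv_into S g) S \<in> H)"

lemma permutation_group_subgroup:
  assumes "permutation_group S H"
  shows "subgroup H (BijGroup S)"
proof -
  interpret B: group "BijGroup S" by (rule group_BijGroup)
  have b: "\<And>g. g \<in> H \<Longrightarrow> g \<in> Bij S"
    using assms by (auto simp: permutation_group_def)
  have i: "inv\<^bsub>BijGroup S\<^esub> g = restrict (inv_into S g) S" if "g \<in> H" for g
    using inv_BijGroup[OF b[OF that]] by simp
  show ?thesis
  proof (rule B.subgroupI)
    show "H \<subseteq> carrier (BijGroup S)" using b by (auto simp: BijGroup_def)
    show "H \<noteq> {}" using assms by (auto simp: permutation_group_def)
    show "inv\<^bsub>BijGroup S\<^esub> g \<in> H" if "g \<in> H" for g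
      using i[OF that] assms that by (auto simp: permutation_group_def)
    show "g \<otimes>\<^bsub>BijGroup S\<^esub> h \<in> H" if "g \<in> H" "h \<in> H" for g h
      using assms that b by (auto simp: permutation_group_def BijGroup_def)
  qed
qed

lemma group_perm_group:
  assumes "permutation_group S H"
  shows "group (perm_group S H)"
  unfolding perm_group_def
  using subgroup.subgroup_is_group[OF permutation_group_subgroup[OF assms] group_BijGroup] .

lemma inv_perm_group:
  assumes "permutation_group S H" "g \<in> H"
  shows "inv\<^bsub>perm_group S H\<^esub> g = restrict (inv_into S g) S"
proof -
  have "g \<in> Bij S" using assms by (auto simp: permutation_group_def)
  then have "inv\<^bsub>BijGroup S\<^esub> g = restrict (inv_into S g) S"
    using inv_BijGroup by fastforce
  moreover have "inv\<^bsub>perm_group S H\<^esub> g = inv\<^bsub>BijGroup S\<^esub> g"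
    unfolding perm_group_def
    using group.m_inv_consistent[OF group_BijGroup permutation_group_subgroup[OF assms(1)] assms(2)] .
  ultimately show ?thesis by simp
qed

lemma homeos_continuous: "f \<in> homeos X \<Longrightarrow> continuous_map X X f"
  by (simp add: homeos_def homeomorphic_imp_continuous_map)

lemma homeos_iff:
  "f \<in> homeos X \<longleftrightarrow>
     f \<in> Bij (topspace X) \<and> continuous_map X X f \<and> continuous_map X X (inv_into (topspace X) f)"
proof
  assume f: "f \<in> homeos X"
  then have "homeomorphic_map X X f" and b: "f \<in> Bij (topspace X)" by (auto simp: homeos_def)
  then obtain g where g: "homeomorphic_maps X X f g" by (meson homeomorphic_map_maps)
  have "inv_into (topspace X) f x = g x" if "x \<in> topspace X" for x
    using g b that by (intro inv_into_f_eq)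
      (auto simp: homeomorphic_maps_def Bij_def bij_betw_def dest: continuous_map_funspace)
  then have "continuous_map X X (inv_into (topspace X) f)"
    using g continuous_map_eq[of X X g "inv_into (topspace X) f"] by (auto simp: homeomorphic_maps_def)
  then show "f \<in> Bij (topspace X) \<and> continuous_map X X f \<and> continuous_map X X (inv_into (topspace X) f)"
    using b homeos_continuous[OF f] by auto
next
  assume r: "f \<in> Bij (topspace X) \<and> continuous_map X X f \<and> continuous_map X X (inv_into (topspace X) f)"
  then have "bij_betw f (topspace X) (topspace X)" by (simp add: Bij_def)
  then have "homeomorphic_maps X X f (inv_into (topspace X) f)"
    using r by (auto simp: homeomorphic_maps_def bij_betw_inv_into_left bij_betw_inv_into_right)
  then show "f \<in> homeos X" using r by (auto simp: homeos_def homeomorphic_map_maps)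
qed

lemma permutation_group_homeos: "permutation_group (topspace X) (homeos X)"
  unfolding permutation_group_def
proof (intro conjI ballI)
  let ?S = "topspace X"
  show "homeos X \<subseteq> Bij ?S" by (auto simp: homeos_def)
  have "homeomorphic_map X X (\<lambda>x\<in>?S. x)"
    by (rule homeomorphic_map_eq[of _ _ id]) auto
  then show "(\<lambda>x\<in>?S. x) \<in> homeos X" by (simp add: homeos_def id_Bij)
  show "compose ?S g h \<in> homeos X" if "g \<in> homeos X" "h \<in> homeos X" for g h
  proof -
    have "homeomorphic_map X X (g \<circ> h)"
      using that homeomorphic_map_compose by (auto simp: homeos_def)
    then have "homeomorphic_map X X (compose ?S g h)"
      by (rule homeomorphic_map_eq) (auto simp: compose_def)
    then show ?thesis using that compose_Bij by (auto simp: homeos_def)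
  qed
  show "restrict (inv_into ?S g) ?S \<in> homeos X" if "g \<in> homeos X" for g
  proof -
    have g: "g \<in> Bij ?S" "continuous_map X X g" "continuous_map X X (inv_into ?S g)"
      using that by (auto simp: homeos_iff)
    then have bij: "bij_betw g ?S ?S" by (simp add: Bij_def)
    have "homeomorphic_maps X X (restrict (inv_into ?S g) ?S) g"
      using g bij by (auto simp: homeomorphic_maps_def bij_betw_inv_into_left bij_betw_inv_into_right
         bij_betwE intro: continuous_map_eq)
    then show ?thesis
      using restrict_inv_into_Bij[OF g(1)] by (auto simp: homeos_def homeomorphic_map_maps)
  qed
qed

locale compact_metric_homeos =
  fixes m :: "'a metric" and H :: "('a \<Rightarrow> 'a) set"
  assumes compact: "compact_space (mtopology_of m)"
    and homeos: "H \<subseteq> homeos (mtopology_of m)"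
    and group: "permutation_group (mspace m) H"
begin

lemma Bij: "g \<in> H \<Longrightarrow> g \<in> Bij (mspace m)"
  using group by (auto simp: permutation_group_def)

lemma into: "g \<in> H \<Longrightarrow> x \<in> mspace m \<Longrightarrow> g x \<in> mspace m"
  using Bij[of g] by (auto simp: Bij_def bij_betw_def)

lemma continuous: "g \<in> H \<Longrightarrow> continuous_map (mtopology_of m) (mtopology_of m) g"
  using homeos homeos_continuous by blast

lemma subset_cfunspace: "H \<subseteq> mspace (cfunspace (mtopology_of m) m)"
proof -
  have "compactin (mtopology_of m) (topspace (mtopology_of m))"
    using compact by (simp add: compact_space_def)
  from compactin_mspace_cfunspace[OF this, of m] show ?thesis
    using continuous Bij into unfolding Bij_def by (simp add: subset_iff)
qed

lemma uniform_topspace [simp]: "topspace (uniform_topology m H) = H"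
  using subset_cfunspace by (auto simp: uniform_topology_def)

text \<open>The next three lemmas replace the metric of the function space by pointwise estimates with
  \<open>\<le> \<epsilon>\<close>, so that the supremum in its definition need not be mentioned again.\<close>

lemma continuous_map_into_uniform:
  assumes "\<And>z. z \<in> topspace Z \<Longrightarrow> f z \<in> H"
    and "\<And>z \<epsilon>. z \<in> topspace Z \<Longrightarrow> \<epsilon> > 0 \<Longrightarrow>
      \<exists>U. openin Z U \<and> z \<in> U \<and> (\<forall>y\<in>U. \<forall>x\<in>mspace m. mdist m (f z x) (f y x) \<le> \<epsilon>)"
  shows "continuous_map Z (uniform_topology m H) f"
proof -
  define C where "C = cfunspace (mtopology_of m) m"
  have subset_C: "H \<subseteq> mspace C" using subset_cfunspace by (simp add: C_def)
  interpret C: Metric_space "mspace C" "mdist C" by (rule Metric_space_mspace_mdist)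
  have top_C: "mtopology_of C = C.mtopology" by (simp add: mtopology_of_def)
  have "continuous_map Z C.mtopology f"
    unfolding C.continuous_map_to_metric
  proof (intro ballI allI impI)
    fix z and \<epsilon> :: real assume z: "z \<in> topspace Z" and e: "\<epsilon> > 0"
    then obtain U where U: "openin Z U" "z \<in> U"
      "\<forall>y\<in>U. \<forall>x\<in>mspace m. mdist m (f z x) (f y x) \<le> \<epsilon>/2"
      using assms(2)[of z "\<epsilon>/2"] by auto
    have "f y \<in> C.mball (f z) \<epsilon>" if "y \<in> U" for y
    proof -
      have "y \<in> topspace Z" using U(1) that openin_subset by blast
      then have "f y \<in> mspace C" "f z \<in> mspace C"
        using assms(1) z subset_C by auto
      moreover have "mdist C (f z) (f y) \<le> \<epsilon>/2"
        unfolding C_def using U that e by (intro mdist_cfunspace_le) auto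
      ultimately show ?thesis using e by (auto simp: C.in_mball)
    qed
    then show "\<exists>U. openin Z U \<and> z \<in> U \<and> (\<forall>y\<in>U. f y \<in> C.mball (f z) \<epsilon>)"
      using U by blast
  qed
  then show ?thesis
    using assms(1) by (auto simp: uniform_topology_def C_def[symmetric] top_C continuous_map_in_subtopology)
qed

lemma uniform_ball:
  assumes "g \<in> H" "\<epsilon> > 0"
  shows "\<exists>U. openin (uniform_topology m H) U \<and> g \<in> U \<and>
    (\<forall>h\<in>U. h \<in> H \<and> (\<forall>x\<in>mspace m. mdist m (g x) (h x) \<le> \<epsilon>))"
proof -
  define C where "C = cfunspace (mtopology_of m) m"
  have subset_C: "H \<subseteq> mspace C" using subset_cfunspace by (simp add: C_def)
  interpret C: Metric_space "mspace C" "mdist C" by (rule Metric_space_mspace_mdist)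
  have top_C: "mtopology_of C = C.mtopology" by (simp add: mtopology_of_def)
  have g: "g \<in> mspace C" using assms subset_C by auto
  have "openin (uniform_topology m H) (C.mball g \<epsilon> \<inter> H)"
    by (simp add: uniform_topology_def C_def[symmetric] openin_subtopology_Int top_C)
  moreover have "mdist m (g x) (h x) \<le> \<epsilon>" if "h \<in> C.mball g \<epsilon>" "x \<in> mspace m" for h x
    using that mdist_cfunspace_imp_mdist_le[of g "mtopology_of m" m h \<epsilon> x]
    unfolding C.in_mball unfolding C_def[symmetric] by simp
  ultimately show ?thesis using g assms by (intro exI[of _ "C.mball g \<epsilon> \<inter> H"]) auto
qed

lemma openin_uniform_contains:
  assumes "openin (uniform_topology m H) V" "g \<in> V"
  shows "\<exists>\<epsilon>>0. \<forall>h\<in>H. (\<forall>x\<in>mspace m. mdist m (g x) (h x) \<le> \<epsilon>) \<longrightarrow> h \<in> V"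
proof -
  define C where "C = cfunspace (mtopology_of m) m"
  have subset_C: "H \<subseteq> mspace C" using subset_cfunspace by (simp add: C_def)
  interpret C: Metric_space "mspace C" "mdist C" by (rule Metric_space_mspace_mdist)
  have top_C: "mtopology_of C = C.mtopology" by (simp add: mtopology_of_def)
  obtain W where W: "openin C.mtopology W" "V = W \<inter> H"
    using assms(1) by (auto simp: uniform_topology_def C_def[symmetric] top_C openin_subtopology)
  then obtain e where e: "e > 0" "C.mball g e \<subseteq> W"
    using assms(2) by (auto simp: C.openin_mtopology)
  have "h \<in> V" if "h \<in> H" "\<forall>x\<in>mspace m. mdist m (g x) (h x) \<le> e/2" for h
  proof -
    have "mdist C g h \<le> e/2" unfolding C_def using e that by (intro mdist_cfunspace_le) auto
    then have "h \<in> C.mball g e"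
      using e that assms(2) W subset_C by (auto simp: C.in_mball)
    then show ?thesis using e W that by auto
  qed
  then show ?thesis using e by (intro exI[of _ "e/2"]) auto
qed

lemma uniformly_continuous:
  assumes "g \<in> H" "\<epsilon> > 0"
  shows "\<exists>\<delta>>0. \<forall>x\<in>mspace m. \<forall>y\<in>mspace m. mdist m x y \<le> \<delta> \<longrightarrow> mdist m (g x) (g y) \<le> \<epsilon>"
proof -
  have "continuous_map (mtopology_of m) (mtopology_of m) g"
    using homeos assms homeos_continuous by auto
  then have "uniformly_continuous_map m m g"
    using continuous_imp_uniformly_continuous_map compact by blast
  then obtain \<delta> where "\<delta> > 0" "\<forall>x\<in>mspace m. \<forall>y\<in>mspace m. mdist m y x < \<delta> \<longrightarrow> mdist m (g y) (g x) < \<epsilon>"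
    using assms(2) unfolding uniformly_continuous_map_def by meson
  then show ?thesis by (intro exI[of _ "\<delta>/2"]) (auto intro!: less_imp_le)
qed

lemma inverse:
  assumes "g \<in> H"
  shows "restrict (inv_into (mspace m) g) (mspace m) \<in> H"
    and "x \<in> mspace m \<Longrightarrow> inv_into (mspace m) g (g x) = x"
    and "x \<in> mspace m \<Longrightarrow> g (inv_into (mspace m) g x) = x"
    and "x \<in> mspace m \<Longrightarrow> inv_into (mspace m) g x \<in> mspace m"
  using group assms Bij[OF assms] unfolding permutation_group_def Bij_def
  by (auto simp: bij_betw_inv_into_left bij_betw_inv_into_right bij_betw_imp_surj_on inv_into_into)

theorem topological_group: "topological_group (perm_group (mspace m) H) (uniform_topology m H)"
  unfolding topological_group_def
proof (intro conjI)
  let ?S = "mspace m" and ?d = "mdist m" and ?T = "uniform_topology m H"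
  let ?G = "perm_group (mspace m) H"
  show "Group.group ?G" using group by (rule group_perm_group)
  show "topspace ?T = carrier ?G" by simp
  have comp: "compose ?S g h \<in> H" if "g \<in> H" "h \<in> H" for g h
    using group that by (auto simp: permutation_group_def)
  have "continuous_map (prod_topology ?T ?T) ?T (\<lambda>z. compose ?S (fst z) (snd z))"
  proof (rule continuous_map_into_uniform)
    fix z assume "z \<in> topspace (prod_topology ?T ?T)"
    then show "compose ?S (fst z) (snd z) \<in> H" using comp by auto
  next
    fix z and \<epsilon> :: real assume "z \<in> topspace (prod_topology ?T ?T)" and e: "\<epsilon> > 0"
    then obtain g h where z: "z = (g, h)" "g \<in> H" "h \<in> H" by auto
    obtain \<delta> where d: "\<delta> > 0" "\<And>x y. x \<in> ?S \<Longrightarrow> y \<in> ?S \<Longrightarrow> ?d x y \<le> \<delta> \<Longrightarrow> ?d (g x) (g y) \<le> \<epsilon>/2"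
      using uniformly_continuous[OF z(2), of "\<epsilon>/2"] e by auto
    obtain U where U: "openin ?T U" "g \<in> U"
      "\<And>g'. g' \<in> U \<Longrightarrow> g' \<in> H \<and> (\<forall>x\<in>?S. ?d (g x) (g' x) \<le> \<epsilon>/2)"
      using uniform_ball[OF z(2), of "\<epsilon>/2"] e by auto
    obtain W where W: "openin ?T W" "h \<in> W"
      "\<And>h'. h' \<in> W \<Longrightarrow> h' \<in> H \<and> (\<forall>x\<in>?S. ?d (h x) (h' x) \<le> \<delta>)"
      using uniform_ball[OF z(3) d(1)] by auto
    have "?d (compose ?S g h x) (compose ?S g' h' x) \<le> \<epsilon>"
      if "g' \<in> U" "h' \<in> W" "x \<in> ?S" for g' h' x
    proof -
      have hx: "h x \<in> ?S" "h' x \<in> ?S" using into z W that by auto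
      have "?d (g (h x)) (g' (h' x)) \<le> ?d (g (h x)) (g (h' x)) + ?d (g (h' x)) (g' (h' x))"
        by (rule mdist_triangle) (use into z U W that hx in auto)
      also have "\<dots> \<le> \<epsilon>/2 + \<epsilon>/2"
        using d(2)[OF hx] W(3)[OF that(2)] U(3)[OF that(1)] hx that by (intro add_mono) auto
      finally show ?thesis using that by (simp add: compose_def)
    qed
    then show "\<exists>U. openin (prod_topology ?T ?T) U \<and> z \<in> U \<and> (\<forall>y\<in>U. \<forall>x\<in>?S.
        ?d (compose ?S (fst z) (snd z) x) (compose ?S (fst y) (snd y) x) \<le> \<epsilon>)"
      using U W z by (intro exI[of _ "U \<times> W"]) (auto simp: openin_prod_Times_iff)
  qed
  then show "continuous_map (prod_topology ?T ?T) ?T (\<lambda>(g, h). g \<otimes>\<^bsub>?G\<^esub> h)"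
    by (rule continuous_map_eq) (auto simp: Bij)
  have "continuous_map ?T ?T (\<lambda>g. restrict (inv_into ?S g) ?S)"
  proof (rule continuous_map_into_uniform)
    show "restrict (inv_into ?S g) ?S \<in> H" if "g \<in> topspace ?T" for g
      using that inverse by auto
  next
    fix g and \<epsilon> :: real assume "g \<in> topspace ?T" and e: "\<epsilon> > 0"
    then have g: "g \<in> H" by auto
    let ?i = "restrict (inv_into ?S g) ?S"
    obtain \<delta> where d: "\<delta> > 0" "\<And>x y. x \<in> ?S \<Longrightarrow> y \<in> ?S \<Longrightarrow> ?d x y \<le> \<delta> \<Longrightarrow> ?d (?i x) (?i y) \<le> \<epsilon>"
      using uniformly_continuous[OF inverse(1)[OF g], of "\<epsilon>"] e by metis
    obtain U where U: "openin ?T U" "g \<in> U"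
      "\<And>g'. g' \<in> U \<Longrightarrow> g' \<in> H \<and> (\<forall>x\<in>?S. ?d (g x) (g' x) \<le> \<delta>)"
      using uniform_ball[OF g d(1)] by auto
    have "?d (?i y) (restrict (inv_into ?S g') ?S y) \<le> \<epsilon>" if "g' \<in> U" "y \<in> ?S" for g' y
    proof -
      define x where "x = inv_into ?S g' y"
      have g': "g' \<in> H" using U that by auto
      have x: "x \<in> ?S" "g' x = y" using inverse[OF g'] that by (auto simp: x_def)
      have "?d (g' x) (g x) \<le> \<delta>" using U(3)[OF that(1)] x(1) by (simp add: mdist_commute)
      then have "?d (?i (g' x)) (?i (g x)) \<le> \<epsilon>" using d(2) into g g' x by auto
      then show ?thesis using x inverse(2)[OF g] into[OF g] that(2) by (simp add: x_def[symmetric])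
    qed
    then show "\<exists>U. openin ?T U \<and> g \<in> U \<and> (\<forall>y\<in>U. \<forall>x\<in>?S.
        ?d (?i x) (restrict (inv_into ?S y) ?S x) \<le> \<epsilon>)"
      using U by (intro exI[of _ U]) auto
  qed
  then show "continuous_map ?T ?T (\<lambda>g. inv\<^bsub>?G\<^esub> g)"
    by (rule continuous_map_eq) (auto simp: inv_perm_group[OF group])
qed

end

section \<open>Oscillation stability\<close>

text \<open>A colouring of \<open>H\<close> with finitely many colours is almost constant on some translate \<open>F k\<close> of
  any given finite set: each element of \<open>F k\<close> is uniformly close to an element of one fixed
  colour. This is the form in which Ramsey theorems enter.\<close>

definition oscillation_stable :: "'a metric \<Rightarrow> ('a \<Rightarrow> 'a) set \<Rightarrow> bool" where
  "oscillation_stable m H \<longleftrightarrow>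
     (\<forall>\<epsilon>>0. \<forall>F (c :: ('a \<Rightarrow> 'a) \<Rightarrow> nat). finite F \<and> F \<subseteq> H \<and> finite (c ` H) \<longrightarrow>
        (\<exists>k\<in>H. \<exists>i. \<forall>g\<in>F. \<exists>h\<in>H. c h = i \<and> (\<forall>x\<in>mspace m. mdist m (g (k x)) (h x) \<le> \<epsilon>)))"

lemma oscillation_stableD:
  fixes c :: "('a \<Rightarrow> 'a) \<Rightarrow> nat"
  assumes "oscillation_stable m H" "\<epsilon> > 0" "finite F" "F \<subseteq> H" "finite (c ` H)"
  obtains k i where "k \<in> H"
    "\<And>g. g \<in> F \<Longrightarrow> \<exists>h\<in>H. c h = i \<and> (\<forall>x\<in>mspace m. mdist m (g (k x)) (h x) \<le> \<epsilon>)"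
proof -
  have "\<exists>k\<in>H. \<exists>i. \<forall>g\<in>F. \<exists>h\<in>H. c h = i \<and> (\<forall>x\<in>mspace m. mdist m (g (k x)) (h x) \<le> \<epsilon>)"
    using assms(2-) by (intro assms(1)[unfolded oscillation_stable_def, THEN spec, THEN mp, THEN spec, THEN spec, THEN mp] conjI)
  then obtain k i where "k \<in> H" and "\<forall>g\<in>F. \<exists>h\<in>H. c h = i \<and> (\<forall>x\<in>mspace m. mdist m (g (k x)) (h x) \<le> \<epsilon>)"
    by (elim bexE exE)
  then show ?thesis by (intro that[of k i]) (simp_all only: Ball_def)
qed

context compact_metric_homeos
begin

text \<open>If no point is fixed, every point \<open>x\<close> has a neighbourhood \<open>Ob x\<close> that some \<open>\<gamma> x\<close>
  moves off itself, even after perturbation by a neighbourhood \<open>V x\<close> of the identity. Finitely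
  many of these neighbourhoods cover the compact space. Colour \<open>h\<close> by a member of this cover that
  contains \<open>h x0\<close>, and apply oscillation stability to the identity and the finitely many
  \<open>\<gamma> x\<close>: it yields a \<open>k\<close> such that \<open>k x0\<close> and \<open>\<gamma> x (k x0)\<close> both lie, up to \<open>V x\<close>, in
  the same \<open>Ob x\<close>. But \<open>\<gamma> x\<close> moves \<open>Ob x\<close> off itself.\<close>

theorem extremely_amenable_if_oscillation_stable:
  assumes stable: "oscillation_stable m H"
  shows "extremely_amenable TYPE('x) (perm_group (mspace m) H) (uniform_topology m H)"
  unfolding extremely_amenable_def
proof (intro conjI allI impI topological_group, elim conjE)
  let ?S = "mspace m" and ?d = "mdist m" and ?T = "uniform_topology m H"
  let ?G = "perm_group (mspace m) H" and ?one = "\<lambda>x\<in>mspace m. x"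
  fix X :: "'x topology" and \<phi>
  assume X: "compact_space X" "Hausdorff_space X" "topspace X \<noteq> {}"
    and act: "group_action ?G (topspace X) \<phi>"
    and cont: "continuous_map (prod_topology ?T X) X (\<lambda>(g, x). \<phi> g x)"
  interpret group_action ?G "topspace X" \<phi> by (rule act)
  have \<phi>_mult: "\<phi> (compose ?S g h) x = \<phi> g (\<phi> h x)"
    if "g \<in> H" "h \<in> H" "x \<in> topspace X" for g h x
    using composition_rule[of x g h] that Bij by auto
  have \<phi>_one: "\<phi> ?one x = x" if "x \<in> topspace X" for x
    using id_eq_one[THEN fun_cong, of x] that by auto
  have \<phi>_in: "\<phi> g x \<in> topspace X" if "g \<in> H" "x \<in> topspace X" for g x
    using element_image[of g x] that by auto
  have one: "?one \<in> H" using group by (simp add: permutation_group_def)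
  show "\<exists>x\<in>topspace X. \<forall>g\<in>carrier ?G. \<phi> g x = x"
  proof (rule ccontr)
    assume "\<not> ?thesis"
    then have nofix: "\<exists>g\<in>H. \<phi> g x \<noteq> x" if "x \<in> topspace X" for x using that by auto
    \<comment> \<open>\<open>V\<close> comes from continuity of the action at \<open>(1, x)\<close>, disjointness from the Hausdorff property\<close>
    define moves where "moves x g V Ob \<longleftrightarrow> g \<in> H \<and> openin ?T V \<and> ?one \<in> V \<and> openin X Ob \<and> x \<in> Ob \<and>
        (\<forall>v\<in>V. \<forall>w\<in>V. \<forall>y\<in>Ob. \<forall>z\<in>Ob. \<phi> v y \<noteq> \<phi> g (\<phi> w z))" for x g V Ob
    have "\<exists>g V Ob. moves x g V Ob" if x: "x \<in> topspace X" for x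
    proof -
      obtain g where g: "g \<in> H" "\<phi> g x \<noteq> x" using nofix x by auto
      obtain P Q where PQ: "openin X P" "openin X Q" "x \<in> P" "\<phi> g x \<in> Q" "disjnt P Q"
        using X(2) g x \<phi>_in[OF g(1) x] unfolding Hausdorff_space_def by metis
      have "continuous_map X X ((\<lambda>(g, x). \<phi> g x) \<circ> (\<lambda>x. (g, x)))"
        by (rule continuous_map_compose[OF _ cont]) (use g in \<open>auto simp: continuous_map_pairwise o_def\<close>)
      then have cg: "continuous_map X X (\<phi> g)" by (simp add: o_def)
      define W where "W = P \<inter> {y \<in> topspace X. \<phi> g y \<in> Q}"
      have W: "openin X W" "x \<in> W"
        using PQ x openin_continuous_map_preimage[OF cg PQ(2)] by (auto simp: W_def)
      have "openin (prod_topology ?T X) {z \<in> topspace (prod_topology ?T X). (\<lambda>(g, x). \<phi> g x) z \<in> W}"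
        by (rule openin_continuous_map_preimage[OF cont W(1)])
      moreover have "(?one, x) \<in> {z \<in> topspace (prod_topology ?T X). (\<lambda>(g, x). \<phi> g x) z \<in> W}"
        using one x W \<phi>_one by auto
      ultimately have "\<exists>V Ob. openin ?T V \<and> openin X Ob \<and> ?one \<in> V \<and> x \<in> Ob \<and>
          V \<times> Ob \<subseteq> {z \<in> topspace (prod_topology ?T X). (\<lambda>(g, x). \<phi> g x) z \<in> W}"
        unfolding openin_prod_topology_alt by blast
      then obtain V Ob where V: "openin ?T V" "openin X Ob" "?one \<in> V" "x \<in> Ob"
        "V \<times> Ob \<subseteq> {z \<in> topspace (prod_topology ?T X). (\<lambda>(g, x). \<phi> g x) z \<in> W}"
        by (elim exE conjE)
      have "\<phi> v y \<noteq> \<phi> g (\<phi> w z)" if "v \<in> V" "w \<in> V" "y \<in> Ob" "z \<in> Ob" for v w y z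
      proof -
        have "(v, y) \<in> V \<times> Ob" "(w, z) \<in> V \<times> Ob" using that by auto
        then have "\<phi> v y \<in> W" "\<phi> w z \<in> W" using V(5) by auto
        then have "\<phi> v y \<in> P" "\<phi> g (\<phi> w z) \<in> Q" by (simp_all only: W_def Int_iff mem_Collect_eq)
        then show ?thesis using PQ(5) by (metis disjnt_iff)
      qed
      then show ?thesis
        unfolding moves_def
        by (intro exI[of _ g] exI[of _ V] exI[of _ Ob] conjI ballI) (use g V in auto)
    qed
    then obtain \<gamma> V Ob where moves: "\<And>x. x \<in> topspace X \<Longrightarrow> moves x (\<gamma> x) (V x) (Ob x)"
      by metis
    have loc: "\<And>x. x \<in> topspace X \<Longrightarrow> \<gamma> x \<in> H"
      "\<And>x. x \<in> topspace X \<Longrightarrow> openin ?T (V x)" "\<And>x. x \<in> topspace X \<Longrightarrow> ?one \<in> V x"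
      "\<And>x. x \<in> topspace X \<Longrightarrow> openin X (Ob x)" "\<And>x. x \<in> topspace X \<Longrightarrow> x \<in> Ob x"
      "\<And>x v w y z. x \<in> topspace X \<Longrightarrow> v \<in> V x \<Longrightarrow> w \<in> V x \<Longrightarrow> y \<in> Ob x \<Longrightarrow> z \<in> Ob x \<Longrightarrow>
         \<phi> v y \<noteq> \<phi> (\<gamma> x) (\<phi> w z)"
      using moves unfolding moves_def by simp_all
    have "topspace X \<subseteq> \<Union>(Ob ` topspace X)" using loc by blast
    then have "\<exists>\<F>. finite \<F> \<and> \<F> \<subseteq> Ob ` topspace X \<and> topspace X \<subseteq> \<Union>\<F>"
      by (intro X(1)[unfolded compact_space_alt, rule_format]) (use loc(4) in auto)
    then obtain I where I: "finite I" "I \<subseteq> topspace X" "topspace X \<subseteq> \<Union>(Ob ` I)"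
      by (metis finite_subset_image)
    then have "I \<noteq> {}" using X(3) by auto
    have "\<forall>x\<in>I. \<exists>\<epsilon>>0. \<forall>h\<in>H. (\<forall>y\<in>?S. ?d y (h y) \<le> \<epsilon>) \<longrightarrow> h \<in> V x"
    proof
      fix x assume "x \<in> I"
      then have "x \<in> topspace X" using I by auto
      from openin_uniform_contains[OF loc(2,3)[OF this]]
      show "\<exists>\<epsilon>>0. \<forall>h\<in>H. (\<forall>y\<in>?S. ?d y (h y) \<le> \<epsilon>) \<longrightarrow> h \<in> V x" by simp
    qed
    then obtain e where e: "\<And>x. x \<in> I \<Longrightarrow> e x > 0"
      "\<And>x h. x \<in> I \<Longrightarrow> h \<in> H \<Longrightarrow> (\<forall>y\<in>?S. ?d y (h y) \<le> e x) \<Longrightarrow> h \<in> V x"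
      by metis
    define \<epsilon> where "\<epsilon> = Min (e ` I)"
    have \<epsilon>: "\<epsilon> > 0" "\<And>x. x \<in> I \<Longrightarrow> \<epsilon> \<le> e x"
      using e I \<open>I \<noteq> {}\<close> by (auto simp: \<epsilon>_def)
    obtain x0 where x0: "x0 \<in> topspace X" using X(3) by blast
    \<comment> \<open>the colour of \<open>h\<close>, as a point of the finite set \<open>I\<close>; \<open>e'\<close> below turns it into a number\<close>
    define p where "p h = (SOME x. x \<in> I \<and> \<phi> h x0 \<in> Ob x)" for h
    have p: "p h \<in> I" "\<phi> h x0 \<in> Ob (p h)" if "h \<in> H" for h
    proof -
      have "\<exists>x. x \<in> I \<and> \<phi> h x0 \<in> Ob x" using \<phi>_in[OF that x0] I(3) by auto
      from someI_ex[OF this] show "p h \<in> I" "\<phi> h x0 \<in> Ob (p h)" by (auto simp: p_def)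
    qed
    obtain e' :: "'x \<Rightarrow> nat" where inj: "inj_on e' I"
      using I(1) finite_imp_inj_to_nat_seg by metis
    have fin: "finite ((\<lambda>h. e' (p h)) ` H)"
      by (rule finite_subset[of _ "e' ` I"]) (use p I in auto)
    have F: "finite (insert ?one (\<gamma> ` I))" "insert ?one (\<gamma> ` I) \<subseteq> H"
      using I loc(1) one by auto
    from oscillation_stableD[OF stable \<epsilon>(1) F fin] obtain k i where k: "k \<in> H"
      and osc: "\<And>g. g \<in> insert ?one (\<gamma> ` I) \<Longrightarrow>
        \<exists>h\<in>H. e' (p h) = i \<and> (\<forall>x\<in>?S. ?d (g (k x)) (h x) \<le> \<epsilon>)"
      by blast
    \<comment> \<open>closeness of \<open>g k\<close> to \<open>h\<close> puts the point \<open>g k x0\<close> in the neighbourhood of \<open>h x0\<close>\<close>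
    have near: "\<exists>v\<in>V x. \<phi> g (\<phi> k x0) = \<phi> v (\<phi> h x0)"
      if "g \<in> H" "h \<in> H" "x \<in> I" and close: "\<And>y. y \<in> ?S \<Longrightarrow> ?d (g (k y)) (h y) \<le> \<epsilon>" for g h x
    proof -
      define v where "v = compose ?S (compose ?S g k) (restrict (inv_into ?S h) ?S)"
      have gk: "compose ?S g k \<in> H" and v: "v \<in> H" using group that k inverse(1)[OF that(2)]
        unfolding v_def permutation_group_def by auto
      have "?d y (v y) \<le> e x" if y: "y \<in> ?S" for y
      proof -
        define z where "z = inv_into ?S h y"
        have z: "z \<in> ?S" "h z = y" using inverse[OF \<open>h \<in> H\<close>] y by (auto simp: z_def)
        have "v y = g (k z)" using y z(1) by (simp add: v_def compose_def flip: z_def)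
        then have "?d y (v y) = ?d (g (k z)) (h z)" using z(2) mdist_commute[of m y] by simp
        also have "\<dots> \<le> e x" using close[OF z(1)] \<epsilon>(2)[OF \<open>x \<in> I\<close>] by (rule order_trans)
        finally show ?thesis .
      qed
      then have "v \<in> V x" by (intro e(2)[OF \<open>x \<in> I\<close> v] ballI)
      moreover have "compose ?S v h = compose ?S g k"
      proof
        fix y show "compose ?S v h y = compose ?S g k y"
          using inverse(2)[OF \<open>h \<in> H\<close>, of y] into[OF \<open>h \<in> H\<close>, of y]
          by (simp add: v_def compose_def)
      qed
      then have "\<phi> v (\<phi> h x0) = \<phi> g (\<phi> k x0)"
        using \<phi>_mult[OF v that(2) x0] \<phi>_mult[OF that(1) k x0] by simp
      ultimately show ?thesis by (intro bexI[of _ v]) auto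
    qed
    obtain h where h: "h \<in> H" "e' (p h) = i" "\<And>x. x \<in> ?S \<Longrightarrow> ?d (?one (k x)) (h x) \<le> \<epsilon>"
      using osc[of ?one] by auto
    define x where "x = p h"
    have x: "x \<in> I" "x \<in> topspace X" using p h I by (auto simp: x_def)
    obtain h' where h': "h' \<in> H" "e' (p h') = i" "\<And>y. y \<in> ?S \<Longrightarrow> ?d (\<gamma> x (k y)) (h' y) \<le> \<epsilon>"
      using osc[of "\<gamma> x"] x by auto
    have "p h' = x" using inj h h' p unfolding x_def by (metis inj_on_contraD)
    obtain v where v: "v \<in> V x" "\<phi> ?one (\<phi> k x0) = \<phi> v (\<phi> h x0)"
      using near[OF one h(1) x(1) h(3)] by blast
    obtain v' where v': "v' \<in> V x" "\<phi> (\<gamma> x) (\<phi> k x0) = \<phi> v' (\<phi> h' x0)"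
      using near[OF loc(1)[OF x(2)] h'(1) x(1) h'(3)] by blast
    have "\<phi> k x0 = \<phi> v (\<phi> h x0)" using v \<phi>_one[OF \<phi>_in[OF k x0]] by simp
    then have "\<phi> v' (\<phi> h' x0) = \<phi> (\<gamma> x) (\<phi> v (\<phi> h x0))" using v' by simp
    then show False
      using loc(6)[OF x(2) v'(1) v(1), of "\<phi> h' x0" "\<phi> h x0"] p(2)[OF h(1)] p(2)[OF h'(1)] \<open>p h' = x\<close>
      by (auto simp: x_def)
  qed
qed

definition uniform_closure :: "('a \<Rightarrow> 'a) set" where
  "uniform_closure =
     {f \<in> homeos (mtopology_of m). \<forall>\<epsilon>>0. \<exists>h\<in>H. \<forall>x\<in>mspace m. mdist m (f x) (h x) \<le> \<epsilon>}"

lemma uniform_closureD: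
  assumes "f \<in> uniform_closure" "\<epsilon> > 0"
  obtains h where "h \<in> H" "\<And>x. x \<in> mspace m \<Longrightarrow> mdist m (f x) (h x) \<le> \<epsilon>"
  using assms by (auto simp: uniform_closure_def)

lemma subset_uniform_closure: "H \<subseteq> uniform_closure"
proof
  fix h assume h: "h \<in> H"
  then have "\<exists>h'\<in>H. \<forall>x\<in>mspace m. mdist m (h x) (h' x) \<le> \<epsilon>" if "\<epsilon> > 0" for \<epsilon>
  proof (intro bexI[of _ h] ballI h)
    fix x assume "x \<in> mspace m"
    then have "mdist m (h x) (h x) = 0" using into[OF h] by (simp add: Metric_space.mdist_zero)
    then show "mdist m (h x) (h x) \<le> \<epsilon>" using that by simp
  qed
  then show "h \<in> uniform_closure" using h homeos by (auto simp: uniform_closure_def)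
qed

lemma compact_metric_homeos_closure: "compact_metric_homeos m uniform_closure"
proof
  let ?S = "mspace m" and ?d = "mdist m" and ?Ho = "homeos (mtopology_of m)"
  interpret Ho: compact_metric_homeos m ?Ho
    using compact permutation_group_homeos[of "mtopology_of m"]
    by unfold_locales auto
  show "compact_space (mtopology_of m)" by (rule compact)
  show "uniform_closure \<subseteq> ?Ho" by (auto simp: uniform_closure_def)
  then have Ho: "\<And>f. f \<in> uniform_closure \<Longrightarrow> f \<in> ?Ho" by auto
  have one: "(\<lambda>x\<in>?S. x) \<in> uniform_closure"
    using subset_uniform_closure group by (auto simp: permutation_group_def)
  have comp: "compose ?S f g \<in> uniform_closure" if f: "f \<in> uniform_closure" and g: "g \<in> uniform_closure" for f g
    unfolding uniform_closure_def
  proof (intro CollectI conjI allI impI)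
    show "compose ?S f g \<in> ?Ho" using f g Ho Ho.group by (auto simp: permutation_group_def)
    fix \<epsilon> :: real assume e: "\<epsilon> > 0"
    obtain f' where f': "f' \<in> H" "\<And>x. x \<in> ?S \<Longrightarrow> ?d (f x) (f' x) \<le> \<epsilon>/2"
      using uniform_closureD[OF f, of "\<epsilon>/2"] e by auto
    obtain \<delta> where d: "\<delta> > 0" "\<And>x y. x \<in> ?S \<Longrightarrow> y \<in> ?S \<Longrightarrow> ?d x y \<le> \<delta> \<Longrightarrow> ?d (f' x) (f' y) \<le> \<epsilon>/2"
      using uniformly_continuous[OF f'(1), of "\<epsilon>/2"] e by auto
    obtain g' where g': "g' \<in> H" "\<And>x. x \<in> ?S \<Longrightarrow> ?d (g x) (g' x) \<le> \<delta>"
      using uniform_closureD[OF g d(1)] by auto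
    have "?d (f (g x)) (f' (g' x)) \<le> \<epsilon>" if "x \<in> ?S" for x
    proof -
      have gx: "g x \<in> ?S" "g' x \<in> ?S" using Ho.into[OF Ho[OF g]] into[OF g'(1)] that by auto
      have "?d (f (g x)) (f' (g' x)) \<le> ?d (f (g x)) (f' (g x)) + ?d (f' (g x)) (f' (g' x))"
        by (rule mdist_triangle) (use gx Ho.into[OF Ho[OF f]] into[OF f'(1)] in auto)
      also have "\<dots> \<le> \<epsilon>/2 + \<epsilon>/2" using f'(2) d(2) g'(2) gx that by (intro add_mono) auto
      finally show ?thesis by simp
    qed
    then show "\<exists>h\<in>H. \<forall>x\<in>?S. ?d (compose ?S f g x) (h x) \<le> \<epsilon>"
      using group f' g' by (intro bexI[of _ "compose ?S f' g'"]) (auto simp: compose_def permutation_group_def)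
  qed
  have inv: "restrict (inv_into ?S f) ?S \<in> uniform_closure" if f: "f \<in> uniform_closure" for f
    unfolding uniform_closure_def
  proof (intro CollectI conjI allI impI)
    let ?i = "restrict (inv_into ?S f) ?S"
    show "?i \<in> ?Ho" using Ho.inverse(1)[OF Ho[OF f]] .
    fix \<epsilon> :: real assume e: "\<epsilon> > 0"
    obtain \<delta> where d: "\<delta> > 0" "\<And>x y. x \<in> ?S \<Longrightarrow> y \<in> ?S \<Longrightarrow> ?d x y \<le> \<delta> \<Longrightarrow> ?d (?i x) (?i y) \<le> \<epsilon>"
      using Ho.uniformly_continuous[OF \<open>?i \<in> ?Ho\<close> e] by metis
    obtain h where h: "h \<in> H" "\<And>x. x \<in> ?S \<Longrightarrow> ?d (f x) (h x) \<le> \<delta>"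
      using uniform_closureD[OF f d(1)] by auto
    have "?d (?i y) (restrict (inv_into ?S h) ?S y) \<le> \<epsilon>" if y: "y \<in> ?S" for y
    proof -
      define x where "x = inv_into ?S h y"
      have x: "x \<in> ?S" "h x = y" using inverse[OF h(1)] y by (auto simp: x_def)
      have "?d (h x) (f x) \<le> \<delta>" using h(2)[OF x(1)] by (simp add: mdist_commute)
      then have "?d (?i (h x)) (?i (f x)) \<le> \<epsilon>"
        using d(2) into[OF h(1) x(1)] Ho.into[OF Ho[OF f] x(1)] by blast
      then show ?thesis using x Ho.inverse(2)[OF Ho[OF f]] Ho.into[OF Ho[OF f]] y
        by (simp add: x_def[symmetric])
    qed
    then show "\<exists>h\<in>H. \<forall>x\<in>?S. ?d (?i x) (h x) \<le> \<epsilon>"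
      using inverse(1)[OF h(1)] by blast
  qed
  show "permutation_group ?S uniform_closure"
    using one comp inv Ho Ho.Bij by (auto simp: permutation_group_def)
qed

text \<open>Oscillation stability only speaks about elements up to uniform error, so it can be tested on
  a dense subgroup, with half of the error spent on replacing \<open>F\<close> by elements of that subgroup.\<close>

lemma oscillation_stable_closure:
  assumes "oscillation_stable m H"
  shows "oscillation_stable m uniform_closure"
  unfolding oscillation_stable_def
proof (intro allI impI, elim conjE)
  let ?S = "mspace m" and ?d = "mdist m"
  fix \<epsilon> :: real and F and c :: "('a \<Rightarrow> 'a) \<Rightarrow> nat"
  assume e: "\<epsilon> > 0" and F: "finite F" "F \<subseteq> uniform_closure" and c: "finite (c ` uniform_closure)"
  interpret C: compact_metric_homeos m uniform_closure by (rule compact_metric_homeos_closure)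
  have "\<forall>f\<in>F. \<exists>h. h \<in> H \<and> (\<forall>x\<in>?S. ?d (f x) (h x) \<le> \<epsilon>/2)"
    using F e uniform_closureD[of _ "\<epsilon>/2"] by (metis half_gt_zero subsetD)
  then obtain a where a: "\<And>f. f \<in> F \<Longrightarrow> a f \<in> H"
    "\<And>f x. f \<in> F \<Longrightarrow> x \<in> ?S \<Longrightarrow> ?d (f x) (a f x) \<le> \<epsilon>/2" by metis
  have "finite (a ` F)" "a ` F \<subseteq> H" "\<epsilon>/2 > 0" using F a e by auto
  moreover have "finite (c ` H)" using c subset_uniform_closure by (meson finite_subset image_mono)
  ultimately obtain k i where k: "k \<in> H" "\<And>g. g \<in> a ` F \<Longrightarrow>
      \<exists>h\<in>H. c h = i \<and> (\<forall>x\<in>?S. ?d (g (k x)) (h x) \<le> \<epsilon>/2)"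
    using oscillation_stableD[OF assms, of "\<epsilon>/2" "a ` F" c] by metis
  have "\<exists>h\<in>uniform_closure. c h = i \<and> (\<forall>x\<in>?S. ?d (f (k x)) (h x) \<le> \<epsilon>)" if f: "f \<in> F" for f
  proof -
    obtain h where h: "h \<in> H" "c h = i" "\<And>x. x \<in> ?S \<Longrightarrow> ?d (a f (k x)) (h x) \<le> \<epsilon>/2"
      using k(2)[of "a f"] f by auto
    have "?d (f (k x)) (h x) \<le> \<epsilon>" if x: "x \<in> ?S" for x
    proof -
      have kx: "k x \<in> ?S" using into[OF k(1) x] .
      have "?d (f (k x)) (h x) \<le> ?d (f (k x)) (a f (k x)) + ?d (a f (k x)) (h x)"
        by (rule mdist_triangle) (use kx x f F a C.into into h in auto)
      also have "\<dots> \<le> \<epsilon>/2 + \<epsilon>/2" using a(2)[OF f kx] h(3)[OF x] by simp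
      finally show ?thesis by simp
    qed
    then show ?thesis using h subset_uniform_closure by auto
  qed
  then show "\<exists>k\<in>uniform_closure. \<exists>i. \<forall>g\<in>F. \<exists>h\<in>uniform_closure.
      c h = i \<and> (\<forall>x\<in>?S. ?d (g (k x)) (h x) \<le> \<epsilon>)"
    using k subset_uniform_closure by blast
qed

end

text \<open>A compactness principle for inverse limits: to show that two points with close \<open>n\<close>-th
  coordinates are close, take for \<open>R n\<close> the pairs with close coordinates and for \<open>Q\<close> the pairs of
  distant points.\<close>

lemma closed_relations_meet:
  fixes R :: "nat \<Rightarrow> ('a \<times> 'a) set"
  assumes X: "compact_space X" and R: "\<And>n. closedin (prod_topology X X) (R n)" "decseq R"
    and Q: "closedin (prod_topology X X) Q" and empty: "(\<Inter>n. R n) \<inter> Q = {}"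
  shows "\<exists>n. R n \<inter> Q = {}"
proof (rule ccontr)
  assume "\<not> ?thesis"
  then have "\<And>n. R n \<inter> Q \<noteq> {}" by auto
  moreover have "decseq (\<lambda>n. R n \<inter> Q)" using R(2) unfolding decseq_def by blast
  moreover have "compact_space (prod_topology X X)" using X by (simp add: compact_space_prod_topology)
  ultimately have "(\<Inter>n. R n \<inter> Q) \<noteq> {}"
    using R Q by (intro compact_space_imp_nest[of "prod_topology X X"]) auto
  then show False using empty by auto
qed

section \<open>Triangle waves and equivariant maps of the line\<close>

text \<open>The triangle wave: it is the quotient map of the line by the reflections in the integers,
  which are generated by \<open>y \<mapsto> - y\<close> and \<open>y \<mapsto> y + 2\<close>, with \<open>[0,1]\<close> as fundamental
  domain. All tent maps are \<open>zig\<close> after a dilation.\<close>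

definition zig :: "real \<Rightarrow> real" where
  "zig y = tent_map 1 y"

lemma tent_map_zig: "tent_map d x = zig (real d * x)"
  by (simp add: zig_def tent_map_def)

lemma zig_unique:
  fixes y u :: real and z :: int
  assumes "0 \<le> u" "u \<le> 1" and "y = u + 2 * of_int z \<or> y = - u + 2 * of_int z"
  shows "zig y = u"
  using assms(3)
proof
  assume y: "y = u + 2 * of_int z"
  show ?thesis
  proof (cases "u = 1")
    case True
    then have "\<lfloor>y\<rfloor> = 2 * z + 1" using y by (simp add: floor_eq_iff)
    then show ?thesis using y True by (simp add: zig_def tent_map_def frac_def)
  next
    case False
    then have "\<lfloor>y\<rfloor> = 2 * z" using y assms unfolding floor_eq_iff by simp
    then show ?thesis using y unfolding zig_def tent_map_def frac_def by (simp del: floor_diff_of_int floor_add_int)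
  qed
next
  assume y: "y = - u + 2 * of_int z"
  show ?thesis
  proof (cases "u = 0")
    case True
    then have "\<lfloor>y\<rfloor> = 2 * z" using y by (simp add: floor_eq_iff)
    then show ?thesis using y True by (simp add: zig_def tent_map_def frac_def)
  next
    case False
    then have "\<lfloor>y\<rfloor> = 2 * z - 1" using y assms unfolding floor_eq_iff by simp
    then show ?thesis using y unfolding zig_def tent_map_def frac_def by (simp del: floor_diff_of_int floor_add_int)
  qed
qed

lemma zig_range: "0 \<le> zig y" "zig y \<le> 1"
  by (simp_all add: zig_def tent_map_def frac_lt_1 less_imp_le)

lemma zig_repr: "\<exists>z::int. y = zig y + 2 * of_int z \<or> y = - zig y + 2 * of_int z"
proof (cases "even \<lfloor>y\<rfloor>")
  case True
  then obtain z where "\<lfloor>y\<rfloor> = 2 * z" by (elim evenE)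
  then have "y = zig y + 2 * of_int z" using True by (simp add: zig_def tent_map_def frac_def)
  then show ?thesis by blast
next
  case False
  then obtain z where "\<lfloor>y\<rfloor> = 2 * z + 1" by (elim oddE)
  then have "y = - zig y + 2 * of_int (z + 1)" using False by (simp add: zig_def tent_map_def frac_def)
  then show ?thesis by blast
qed

lemma zig_id [simp]: "0 \<le> y \<Longrightarrow> y \<le> 1 \<Longrightarrow> zig y = y"
  by (rule zig_unique[where z = 0]) auto

lemma zig_congruent:
  fixes x y :: real and z :: int
  assumes "y = x + 2 * of_int z \<or> y = - x + 2 * of_int z"
  shows "zig y = zig x"
proof -
  obtain w :: int where w: "x = zig x + 2 * of_int w \<or> x = - zig x + 2 * of_int w" using zig_repr by blast
  have "\<exists>t::int. y = zig x + 2 * of_int t \<or> y = - zig x + 2 * of_int t"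
  proof (cases "y = x + 2 * of_int z")
    case True
    then have "y = zig x + 2 * of_int (w + z) \<or> y = - zig x + 2 * of_int (w + z)" using w by auto
    then show ?thesis by blast
  next
    case False
    then have "y = zig x + 2 * of_int (z - w) \<or> y = - zig x + 2 * of_int (z - w)" using w assms by auto
    then show ?thesis by blast
  qed
  then show ?thesis using zig_range by (metis zig_unique)
qed

lemma zig_minus [simp]: "zig (- y) = zig y"
  by (rule zig_congruent[where z = 0]) auto

lemma zig_le: "zig y \<le> \<bar>y - 2 * of_int z\<bar>"
proof -
  obtain w :: int where w: "y = zig y + 2 * of_int w \<or> y = - zig y + 2 * of_int w" using zig_repr by blast
  show ?thesis
  proof (cases "w = z")
    case False
    then have "\<bar>w - z\<bar> \<ge> 1" by simp
    then have "\<bar>real_of_int w - of_int z\<bar> \<ge> 1" by (metis of_int_1_le_iff of_int_abs of_int_diff)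
    then show ?thesis using w zig_range[of y] by linarith
  qed (use w in auto)
qed

lemma zig_lipschitz: "\<bar>zig x - zig y\<bar> \<le> \<bar>x - y\<bar>"
proof -
  have "zig x \<le> \<bar>x - y\<bar> + zig y" for x y
  proof -
    obtain z :: int where "y = zig y + 2 * of_int z \<or> y = - zig y + 2 * of_int z" using zig_repr by blast
    then have "\<bar>y - 2 * of_int z\<bar> = zig y" using zig_range[of y] by auto
    then show ?thesis using zig_le[of x z] by linarith
  qed
  from this[of x y] this[of y x] show ?thesis by linarith
qed

lemma continuous_on_zig [continuous_intros]:
  "continuous_on S f \<Longrightarrow> continuous_on S (\<lambda>x. zig (f x))"
proof -
  have "continuous_on UNIV zig"
    unfolding continuous_on_iff dist_real_def using zig_lipschitz by (metis order_le_less_trans)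
  then show "continuous_on S f \<Longrightarrow> continuous_on S (\<lambda>x. zig (f x))"
    by (rule continuous_on_compose2) auto
qed

lemma zig_of_int: "zig (of_int j) = (if even j then 0 else 1)"
proof (cases "even j")
  case True
  then obtain z where "j = 2 * z" by (elim evenE)
  then show ?thesis by (auto intro: zig_unique[where z = z])
next
  case False
  then obtain z where "j = 2 * z + 1" by (elim oddE)
  then show ?thesis by (auto intro: zig_unique[where z = z])
qed

lemma zig_lap:
  assumes "0 \<le> u" "u \<le> 1"
  shows "zig (of_int j + u) = (if even j then u else 1 - u)"
proof (cases "even j")
  case True
  then obtain z where "j = 2 * z" by (elim evenE)
  then show ?thesis using assms by (auto intro: zig_unique[where z = z])
next
  case False
  then obtain z where "j = 2 * z + 1" by (elim oddE)
  then show ?thesis using assms by (auto intro: zig_unique[where z = "z + 1"])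
qed

text \<open>The maps of the line that descend to the folded line. With \<open>zig\<close> applied after division by
  \<open>a\<close> on the source and by \<open>b\<close> on the target, such an \<open>H\<close> induces a self-map of \<open>[0,1]\<close>. Scaling
  by \<open>a\<close> and \<open>b\<close> is kept so that one and the same \<open>H\<close> can serve all levels of an inverse limit.\<close>

definition equivariant :: "real \<Rightarrow> real \<Rightarrow> (real \<Rightarrow> real) \<Rightarrow> bool" where
  "equivariant a b H \<longleftrightarrow> (\<forall>x. H (- x) = - H x) \<and> (\<forall>x. H (x + 2 * a) = H x + 2 * b)"

lemma equivariant_minus: "equivariant a b H \<Longrightarrow> H (- x) = - H x"
  by (simp add: equivariant_def)

lemma equivariant_nat:
  "equivariant a b H \<Longrightarrow> H (x + 2 * a * real n) = H x + 2 * b * real n"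
proof (induction n)
  case (Suc n)
  have "H (x + 2 * a * real (Suc n)) = H ((x + 2 * a * real n) + 2 * a)" by (simp add: algebra_simps)
  also have "\<dots> = H (x + 2 * a * real n) + 2 * b" using Suc.prems by (simp add: equivariant_def)
  finally show ?case using Suc by (simp add: algebra_simps)
qed simp

lemma equivariant_int:
  fixes z :: int
  assumes "equivariant a b H"
  shows "H (x + 2 * a * of_int z) = H x + 2 * b * of_int z"
proof (cases "z \<ge> 0")
  case True
  then show ?thesis using equivariant_nat[OF assms, of x "nat z"] by simp
next
  case False
  then show ?thesis using equivariant_nat[OF assms, of "x + 2 * a * of_int z" "nat (- z)"]
    by (simp add: algebra_simps)
qed

lemma equivariant_0: "equivariant a b H \<Longrightarrow> H 0 = 0"
  using equivariant_minus[of a b H 0] by simp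

lemma equivariant_end: "equivariant a b H \<Longrightarrow> H a = b"
proof -
  assume H: "equivariant a b H"
  then have "H (- a + 2 * a) = H (- a) + 2 * b" unfolding equivariant_def by blast
  then show ?thesis using equivariant_minus[OF H, of a] by simp
qed

lemma equivariant_compose:
  "equivariant b c G \<Longrightarrow> equivariant a b H \<Longrightarrow> equivariant a c (\<lambda>x. G (H x))"
  by (simp add: equivariant_def)

lemma equivariant_scale: "equivariant a (c * a) (\<lambda>x. c * x)"
  by (simp add: equivariant_def algebra_simps)

lemma equivariant_multiple:
  "equivariant a b H \<Longrightarrow> equivariant (real n * a) (real n * b) H"
  using equivariant_nat[of a b H _ n] by (simp add: equivariant_def algebra_simps)

text \<open>An equivariant map is determined by its values on one lap \<open>[0,a]\<close>, since the other laps are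
  translates and reflections of this one.\<close>

lemma equivariant_extension:
  assumes "a > 0" "\<beta> 0 = 0" "\<beta> a = b"
  obtains H where "equivariant a b H"
    "\<And>(j::int) x. of_int j * a \<le> x \<Longrightarrow> x \<le> of_int (j + 1) * a \<Longrightarrow>
       H x = (if even j then of_int j * b + \<beta> (x - of_int j * a) else of_int (j + 1) * b - \<beta> (of_int (j + 1) * a - x))"
proof -
  define lap where "lap j x = (if even j then of_int j * b + \<beta> (x - of_int j * a) else of_int (j + 1) * b - \<beta> (of_int (j + 1) * a - x))"
    for j :: int and x
  define H where "H x = lap \<lfloor>x / a\<rfloor> x" for x
  have lap: "H x = lap j x" if "of_int j * a \<le> x" "x \<le> of_int (j + 1) * a" for j :: int and x
  proof (cases "x = of_int (j + 1) * a")
    case True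
    then have "\<lfloor>x / a\<rfloor> = j + 1" using assms by simp
    then show ?thesis using True assms by (auto simp: H_def lap_def algebra_simps)
  next
    case False
    then have "\<lfloor>x / a\<rfloor> = j" using that assms by (simp add: floor_eq_iff field_simps)
    then show ?thesis by (simp add: H_def)
  qed
  have ex: "\<exists>j::int. of_int j * a \<le> x \<and> x \<le> of_int (j + 1) * a" for x
    by (rule exI[of _ "\<lfloor>x / a\<rfloor>"])
      (use assms floor_divide_lower[of a x] floor_divide_upper[of a x] in auto)
  have "H (- x) = - H x" for x
  proof -
    obtain j :: int where j: "of_int j * a \<le> x" "x \<le> of_int (j + 1) * a" using ex by blast
    have "H (- x) = lap (- j - 1) (- x)" by (rule lap) (use j in \<open>auto simp: algebra_simps\<close>)
    also have "\<dots> = - lap j x" by (auto simp: lap_def algebra_simps)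
    finally show ?thesis using lap[OF j] by simp
  qed
  moreover have "H (x + 2 * a) = H x + 2 * b" for x
  proof -
    obtain j :: int where j: "of_int j * a \<le> x" "x \<le> of_int (j + 1) * a" using ex by blast
    have "H (x + 2 * a) = lap (j + 2) (x + 2 * a)" by (rule lap) (use j in \<open>auto simp: algebra_simps\<close>)
    also have "\<dots> = lap j x + 2 * b" by (auto simp: lap_def algebra_simps)
    finally show ?thesis using lap[OF j] by simp
  qed
  ultimately have "equivariant a b H" by (simp add: equivariant_def)
  then show ?thesis using that lap unfolding lap_def by blast
qed

text \<open>The equivariant increasing homeomorphisms of the line. For \<open>a = b\<close> they restrict to the
  increasing homeomorphisms of \<open>[0,a]\<close>; for \<open>b = k * a\<close> they unfold maps of the interval with \<open>k\<close>
  laps.\<close>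

definition lift :: "real \<Rightarrow> real \<Rightarrow> (real \<Rightarrow> real) \<Rightarrow> bool" where
  "lift a b H \<longleftrightarrow> equivariant a b H \<and> strict_mono H \<and> surj H"

lemma lift_compose: "lift b c G \<Longrightarrow> lift a b H \<Longrightarrow> lift a c (\<lambda>x. G (H x))"
  unfolding lift_def using equivariant_compose[of b c G a H] comp_surj[of H G]
  by (auto simp: strict_mono_def o_def)

lemma lift_multiple: "lift a b H \<Longrightarrow> lift (real n * a) (real n * b) H"
  by (simp add: lift_def equivariant_multiple)

lemma lift_scale: "c > 0 \<Longrightarrow> lift a (c * a) (\<lambda>x. c * x)"
  unfolding lift_def using equivariant_scale
  by (auto simp: strict_mono_def intro!: surjI[of _ "\<lambda>x. x / c"])

lemma lift_id: "lift a a (\<lambda>x. x)"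
  by (simp add: lift_def equivariant_def strict_mono_def)

lemma lift_bij: "lift a b H \<Longrightarrow> bij H"
  by (simp add: lift_def bij_def strict_mono_imp_inj_on)

lemma lift_inv_simps:
  assumes "lift a b H"
  shows "H (Hilbert_Choice.inv H x) = x" "Hilbert_Choice.inv H (H x) = x"
  using lift_bij[OF assms] by (simp_all add: bij_def surj_f_inv_f)

lemma lift_less: "lift a b H \<Longrightarrow> H x < H y \<longleftrightarrow> x < y"
  by (simp add: lift_def strict_mono_less)

lemma lift_le: "lift a b H \<Longrightarrow> H x \<le> H y \<longleftrightarrow> x \<le> y"
  by (simp add: lift_def strict_mono_less_eq)

lemma lift_0: "lift a b H \<Longrightarrow> H 0 = 0"
  unfolding lift_def using equivariant_0 by blast

lemma lift_end: "lift a b H \<Longrightarrow> H a = b"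
  by (simp add: lift_def equivariant_end)

lemma lift_inv:
  assumes "lift a b H"
  shows "lift b a (Hilbert_Choice.inv H)"
proof -
  let ?I = "Hilbert_Choice.inv H"
  have H: "equivariant a b H" using assms unfolding lift_def by blast
  have "?I (- x) = - ?I x" for x
  proof -
    have "- x = H (- ?I x)" using equivariant_minus[OF H] lift_inv_simps[OF assms] by simp
    then show ?thesis by (simp only: lift_inv_simps[OF assms])
  qed
  moreover have "?I (x + 2 * b) = ?I x + 2 * a" for x
  proof -
    have "x + 2 * b = H (?I x + 2 * a)" using H lift_inv_simps[OF assms] by (simp add: equivariant_def)
    then show ?thesis by (simp only: lift_inv_simps[OF assms])
  qed
  moreover have "strict_mono ?I"
  proof (rule strict_monoI)
    fix x y :: real assume "x < y"
    then show "?I x < ?I y" using lift_less[OF assms, of "?I x" "?I y"] lift_inv_simps[OF assms] by simp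
  qed
  moreover have "surj (Hilbert_Choice.inv H)" using lift_bij[OF assms] by (simp add: bij_imp_bij_inv bij_is_surj)
  ultimately show ?thesis by (simp add: lift_def equivariant_def)
qed

lemma lift_continuous:
  assumes "lift a b H"
  shows "continuous_on S H"
proof -
  have "continuous_on UNIV H"
    using assms by (intro continuous_onI_mono) (auto simp: lift_def strict_mono_less_eq)
  then show ?thesis by (rule continuous_on_subset) simp
qed

lemma lift_extension:
  assumes a: "a > 0" and b: "b > 0" and \<beta>: "\<beta> 0 = 0" "\<beta> a = b"
    and cont: "continuous_on {0..a} \<beta>" and mono: "\<And>x y. 0 \<le> x \<Longrightarrow> x < y \<Longrightarrow> y \<le> a \<Longrightarrow> \<beta> x < \<beta> y"
  obtains H where "lift a b H" "\<And>x. 0 \<le> x \<Longrightarrow> x \<le> a \<Longrightarrow> H x = \<beta> x"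
proof -
  obtain H where H: "equivariant a b H" and lap: "\<And>(j::int) x. of_int j * a \<le> x \<Longrightarrow> x \<le> of_int (j + 1) * a \<Longrightarrow>
       H x = (if even j then of_int j * b + \<beta> (x - of_int j * a) else of_int (j + 1) * b - \<beta> (of_int (j + 1) * a - x))"
    by (rule equivariant_extension[of a \<beta> b]) (use a \<beta> in auto)
  have \<beta>_range: "0 \<le> \<beta> x" "\<beta> x \<le> b" if "0 \<le> x" "x \<le> a" for x
    using mono[of 0 x] mono[of x a] that \<beta> by (cases "x = 0"; cases "x = a"; fastforce)+
  have lap_mono: "H x < H y" if "of_int j * a \<le> x" "x < y" "y \<le> of_int (j + 1) * a" for j :: int and x y
  proof -
    have "\<beta> (x - of_int j * a) < \<beta> (y - of_int j * a)" "\<beta> (of_int (j + 1) * a - y) < \<beta> (of_int (j + 1) * a - x)"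
      using that by (auto intro!: mono simp: algebra_simps)
    then show ?thesis using lap[of j x] lap[of j y] that by auto
  qed
  have lap_ends: "H (of_int j * a) = of_int j * b" for j
    using lap[of j "of_int j * a"] a \<beta> by (auto simp: algebra_simps)
  have "strict_mono H"
  proof (rule strict_monoI)
    fix x y :: real assume xy: "x < y"
    define i j where "i = \<lfloor>x / a\<rfloor>" and "j = \<lfloor>y / a\<rfloor>"
    have i: "of_int i * a \<le> x" "x < of_int (i + 1) * a" and j: "of_int j * a \<le> y" "y < of_int (j + 1) * a"
      using floor_divide_lower[OF a] floor_divide_upper[OF a] by (auto simp: i_def j_def)
    show "H x < H y"
    proof (cases "i = j")
      case True
      then show ?thesis using lap_mono[of i x y] i j xy by simp
    next
      case False
      have "i \<le> j" unfolding i_def j_def using xy a by (intro floor_mono divide_right_mono) auto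
      then have ij: "i + 1 \<le> j" using False by simp
      have "H x < H (of_int (i + 1) * a)" using lap_mono[of i x "of_int (i + 1) * a"] i by simp
      also have "\<dots> \<le> of_int j * b" using lap_ends[of "i + 1"] ij b by (simp del: of_int_add)
      also have "\<dots> = H (of_int j * a)" using lap_ends by simp
      also have "\<dots> \<le> H y" using lap_mono[of j "of_int j * a" y] j by (cases "y = of_int j * a") auto
      finally show ?thesis .
    qed
  qed
  moreover have "\<exists>x. H x = w" for w
  proof -
    define j where "j = \<lfloor>w / b\<rfloor>"
    have j: "of_int j * b \<le> w" "w \<le> of_int (j + 1) * b"
      using floor_divide_lower[OF b, of w] floor_divide_upper[OF b, of w] by (auto simp: j_def)
    have onto: "\<exists>x. 0 \<le> x \<and> x \<le> a \<and> \<beta> x = v" if "0 \<le> v" "v \<le> b" for v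
      using IVT'[of \<beta> 0 v a] that a \<beta> cont by (simp add: less_imp_le)
    show ?thesis
    proof (cases "even j")
      case True
      obtain x where "0 \<le> x" "x \<le> a" "\<beta> x = w - of_int j * b" using onto[of "w - of_int j * b"] j by (auto simp: algebra_simps)
      then have "H (of_int j * a + x) = w"
        using lap[of j "of_int j * a + x"] True by (simp add: distrib_right)
      then show ?thesis ..
    next
      case False
      obtain x where "0 \<le> x" "x \<le> a" "\<beta> x = of_int (j + 1) * b - w" using onto[of "of_int (j + 1) * b - w"] j by (auto simp: algebra_simps)
      then have "H (of_int (j + 1) * a - x) = w"
        using lap[of j "of_int (j + 1) * a - x"] False by (simp add: distrib_right)
      then show ?thesis ..
    qed
  qed
  then have "surj H" unfolding surj_def by metis
  ultimately have "lift a b H" using H by (simp add: lift_def)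
  moreover have "H x = \<beta> x" if "0 \<le> x" "x \<le> a" for x using lap[of 0 x] that by simp
  ultimately show ?thesis using that by blast
qed

lemma piecewise_linear_lift:
  fixes u v :: "nat \<Rightarrow> real"
  assumes M: "M > 0" and u: "u 0 = 0" "u M = a" "\<And>i. i < M \<Longrightarrow> u i < u (Suc i)"
    and v: "v 0 = 0" "v M = b" "\<And>i. i < M \<Longrightarrow> v i < v (Suc i)"
  obtains H where "lift a b H" "\<And>i. i \<le> M \<Longrightarrow> H (u i) = v i"
proof -
  \<comment> \<open>the part of the \<open>i\<close>-th interval that lies to the left of \<open>x\<close>\<close>
  define c where "c i x = max 0 (min 1 ((x - u i) / (u (Suc i) - u i)))" for i x
  define \<beta> where "\<beta> x = (\<Sum>i<M. (v (Suc i) - v i) * c i x)" for x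
  have uless: "u i < u j" if "i < j" "j \<le> M" for i j
    using that u(3) by (induction j) (auto simp: less_Suc_eq intro: less_trans)
  have vless: "v i < v j" if "i < j" "j \<le> M" for i j
    using that v(3) by (induction j) (auto simp: less_Suc_eq intro: less_trans)
  have ule: "u i \<le> u j" if "i \<le> j" "j \<le> M" for i j
    using uless[of i j] that by (cases "i = j") auto
  have at_node: "\<beta> (u j) = v j" if j: "j \<le> M" for j
  proof -
    have c1: "c i (u j) = 1" if "i < j" for i
    proof -
      have "u (Suc i) \<le> u j" "u i < u (Suc i)" using ule[of "Suc i" j] u(3)[of i] that j by auto
      then have "(u j - u i) / (u (Suc i) - u i) \<ge> 1" by (simp add: field_simps)
      then show ?thesis by (simp add: c_def)
    qed
    have c0: "c i (u j) = 0" if "j \<le> i" "i < M" for i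
    proof -
      have "u j \<le> u i" "u i < u (Suc i)" using ule[of j i] u(3)[of i] that by auto
      then have "(u j - u i) / (u (Suc i) - u i) \<le> 0" by (simp add: divide_le_0_iff)
      then show ?thesis by (simp add: c_def)
    qed
    have "\<beta> (u j) = (\<Sum>i<j. (v (Suc i) - v i) * c i (u j))"
      unfolding \<beta>_def by (rule sum.mono_neutral_right) (use c0 j in auto)
    also have "\<dots> = (\<Sum>i<j. v (Suc i) - v i)" by (rule sum.cong) (auto simp: c1)
    also have "\<dots> = v j" using v(1) by (simp add: sum_lessThan_telescope)
    finally show ?thesis .
  qed
  have c_mono: "c i x \<le> c i y" if "x \<le> y" "i < M" for i x y
  proof -
    have "(x - u i) / (u (Suc i) - u i) \<le> (y - u i) / (u (Suc i) - u i)"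
      using that u(3)[of i] by (intro divide_right_mono) auto
    then show ?thesis by (auto simp: c_def)
  qed
  have strict: "\<beta> x < \<beta> y" if xy: "0 \<le> x" "x < y" "y \<le> a" for x y
  proof -
    define i where "i = Max {i. i \<le> M \<and> u i \<le> x}"
    have "0 \<in> {i. i \<le> M \<and> u i \<le> x}" using u xy by auto
    then have "i \<in> {i. i \<le> M \<and> u i \<le> x}" unfolding i_def by (intro Max_in) auto
    then have i: "i \<le> M" "u i \<le> x" by auto
    have "i < M" using i u xy by (cases "i = M") auto
    moreover have "x < u (Suc i)"
    proof (rule ccontr)
      assume "\<not> x < u (Suc i)"
      then have "Suc i \<in> {i. i \<le> M \<and> u i \<le> x}" using \<open>i < M\<close> by auto
      then have "Suc i \<le> i" unfolding i_def by (intro Max_ge) auto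
      then show False by simp
    qed
    ultimately have i': "i < M" "u i \<le> x" "x < u (Suc i)" "u i < u (Suc i)" using i u(3) by auto
    have clamp: "max 0 (min 1 p) < max 0 (min 1 q)" if "p < q" "0 \<le> p" "p < 1" for p q :: real
      using that by auto
    have "c i x < c i y" unfolding c_def
      by (rule clamp) (use i' xy in \<open>auto simp: divide_strict_right_mono\<close>)
    have "(v (Suc i) - v i) * c i x < (v (Suc i) - v i) * c i y"
      using v(3)[OF i'(1)] \<open>c i x < c i y\<close> by simp
    moreover have "\<forall>j\<in>{..<M}. (v (Suc j) - v j) * c j x \<le> (v (Suc j) - v j) * c j y"
    proof
      fix j assume j: "j \<in> {..<M}"
      then show "(v (Suc j) - v j) * c j x \<le> (v (Suc j) - v j) * c j y"
        using v(3)[of j] c_mono[of x y j] xy by (intro mult_left_mono) auto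
    qed
    ultimately show ?thesis unfolding \<beta>_def
      using i'(1) by (intro sum_strict_mono_ex1[OF finite_lessThan] bexI[of _ i]) (simp_all only: lessThan_iff)
  qed
  have cont: "continuous_on {0..a} \<beta>" unfolding \<beta>_def c_def
  proof (intro continuous_intros ballI)
    show "u (Suc i) - u i \<noteq> 0" if "i \<in> {..<M}" for i using u(3)[of i] that by simp
  qed
  have pos: "a > 0" "b > 0" using uless[of 0 M] vless[of 0 M] M u(1,2) v(1,2) by auto
  have ends: "\<beta> 0 = 0" "\<beta> a = b" using at_node[of 0] at_node[of M] u(1,2) v(1,2) by auto
  obtain H where H: "lift a b H" "\<And>x. 0 \<le> x \<Longrightarrow> x \<le> a \<Longrightarrow> H x = \<beta> x"
    using lift_extension[OF pos ends cont strict] by blast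
  have "H (u i) = v i" if "i \<le> M" for i
    using H(2)[of "u i"] at_node[OF that] ule[of 0 i] ule[of i M] that u(1,2) by auto
  with H show ?thesis using that by blast
qed

section \<open>Zigzag maps as folded walks\<close>

text \<open>The triangle wave on natural numbers: the position after \<open>t\<close> steps of a point that runs back
  and forth on \<open>{0..p}\<close>.\<close>

definition fold_path :: "nat \<Rightarrow> nat \<Rightarrow> nat" where
  "fold_path p t = (if even (t div p) then t mod p else p - t mod p)"

lemma fold_path_lap:
  assumes "p > 0" "x \<le> p"
  shows "fold_path p (j * p + x) = (if even j then x else p - x)"
proof (cases "x = p")
  case True
  then have "j * p + x = Suc j * p" by simp
  then have "(j * p + x) div p = Suc j" "(j * p + x) mod p = 0"
    using assms by (simp_all only: nonzero_mult_div_cancel_right mod_mult_self2_is_0 neq0_conv)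
  then show ?thesis using True by (simp add: fold_path_def)
next
  case False
  then have "(j * p + x) div p = j" "(j * p + x) mod p = x" using assms by auto
  then show ?thesis by (simp add: fold_path_def)
qed

lemma lap_split:
  fixes t p :: nat
  assumes "p > 0"
  obtains j x where "t = j * p + x" "x < p"
  using assms that[of "t div p" "t mod p"] by simp

lemma fold_path_shift:
  assumes "p > 0"
  shows "fold_path p (2 * z * p + t) = fold_path p t"
proof -
  obtain j x where t: "t = j * p + x" "x < p" using lap_split[OF assms] by blast
  then have "2 * z * p + t = (2 * z + j) * p + x" by (simp add: algebra_simps)
  then have "fold_path p (2 * z * p + t) = fold_path p ((2 * z + j) * p + x)" by (rule arg_cong)
  also have "\<dots> = (if even j then x else p - x)"
    using fold_path_lap[OF assms, of x "2 * z + j"] t(2) by (simp only: even_add) simp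
  also have "\<dots> = fold_path p t"
    unfolding t(1) using fold_path_lap[OF assms less_imp_le[OF t(2)], of j] by (rule sym)
  finally show ?thesis .
qed

lemma fold_path_reflect:
  assumes "p > 0" "t \<le> 2 * z * p"
  shows "fold_path p (2 * z * p - t) = fold_path p t"
proof -
  obtain j x where t: "t = j * p + x" "x < p" using lap_split[OF assms(1)] by blast
  show ?thesis
  proof (cases "x = 0")
    case True
    then have "j \<le> 2 * z" using t assms by simp
    then have "2 * z * p - t = (2 * z - j) * p" using True t(1) by (simp add: diff_mult_distrib)
    then have "fold_path p (2 * z * p - t) = fold_path p ((2 * z - j) * p)" by (rule arg_cong)
    also have "\<dots> = (if even j then 0 else p)"
      using fold_path_lap[OF assms(1), of 0 "2 * z - j"] \<open>j \<le> 2 * z\<close> by simp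
    also have "\<dots> = fold_path p t"
      unfolding t(1) True using fold_path_lap[OF assms(1), of 0 j] by simp
    finally show ?thesis .
  next
    case False
    have "j * p < 2 * z * p" using t assms False by linarith
    then have "j < 2 * z" using mult_less_cancel2 by blast
    then obtain e where e: "2 * z = Suc (j + e)" using less_iff_Suc_add by auto
    have "2 * z * p - t = e * p + (p - x)" unfolding e t(1) using t(2) by (simp add: algebra_simps)
    then have "fold_path p (2 * z * p - t) = fold_path p (e * p + (p - x))" by (rule arg_cong)
    also have "\<dots> = (if even e then p - x else p - (p - x))"
      by (rule fold_path_lap[OF assms(1)]) simp
    also have "\<dots> = (if even j then x else p - x)"
    proof -
      have "even (Suc (j + e))" unfolding e[symmetric] by simp
      then have "even e \<longleftrightarrow> odd j" by simp
      then show ?thesis using t(2) by simp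
    qed
    also have "\<dots> = fold_path p t"
      unfolding t(1) using fold_path_lap[OF assms(1) less_imp_le[OF t(2)], of j] by (rule sym)
    finally show ?thesis .
  qed
qed

lemma fold_path_le: "p > 0 \<Longrightarrow> fold_path p t \<le> p"
  by (simp add: fold_path_def less_imp_le)

lemma fold_path_id: "p > 0 \<Longrightarrow> t \<le> p \<Longrightarrow> fold_path p t = t"
  using fold_path_lap[of p t 0] by simp

lemma fold_path_mult: "p > 0 \<Longrightarrow> fold_path p (j * p) = (if even j then 0 else p)"
  using fold_path_lap[of p 0 j] by simp

lemma fold_path_step:
  assumes "p > 0"
  shows "fold_path p (Suc t) = Suc (fold_path p t) \<or> fold_path p t = Suc (fold_path p (Suc t))"
proof -
  obtain j x where t: "t = j * p + x" "x < p" using lap_split[OF assms] by blast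
  then have "Suc t = j * p + Suc x" by simp
  then show ?thesis
    using fold_path_lap[OF assms, of x j] fold_path_lap[OF assms, of "Suc x" j] t by auto
qed

definition walk :: "nat \<Rightarrow> nat \<Rightarrow> (nat \<Rightarrow> nat) \<Rightarrow> bool" where
  "walk n l s \<longleftrightarrow> s 0 = 0 \<and> s (n - 1) = l \<and>
     (\<forall>v. Suc v < n \<longrightarrow> s (Suc v) = s v \<or> s (Suc v) = Suc (s v))"

lemma walk_mono:
  assumes "walk n l s" "u \<le> v" "v < n"
  shows "s u \<le> s v"
  using assms(2,3)
proof (induction v)
  case (Suc v)
  then have "s (Suc v) = s v \<or> s (Suc v) = Suc (s v)" using assms(1) by (simp add: walk_def)
  then show ?case using Suc by (cases "u = Suc v") auto
qed simp

lemma walk_le: "walk n l s \<Longrightarrow> v < n \<Longrightarrow> s v \<le> l"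
  using walk_mono[of n l s v "n - 1"] by (simp add: walk_def)

lemma walk_less:
  assumes "walk n l s" "s u < s v" "u < n" "v < n"
  shows "u < v"
  using walk_mono[OF assms(1), of v u] assms by linarith

lemma walk_first:
  assumes s: "walk n l s" and n: "n \<ge> 1" and t: "t \<le> l"
  obtains v where "v < n" "s v = t" "\<And>u. u < v \<Longrightarrow> s u < t"
proof -
  define v where "v = (LEAST v. t \<le> s v)"
  have ex: "t \<le> s (n - 1)" using s t by (simp add: walk_def)
  have v: "t \<le> s v" unfolding v_def by (rule LeastI[of "\<lambda>v. t \<le> s v", OF ex])
  have "v \<le> n - 1" unfolding v_def by (rule Least_le[of "\<lambda>v. t \<le> s v", OF ex])
  then have "v < n" using n by simp
  have less: "s u < t" if "u < v" for u using not_less_Least[of u "\<lambda>v. t \<le> s v"] that by (simp add: v_def)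
  have "s v \<le> t"
  proof (cases v)
    case 0
    then show ?thesis using s by (simp add: walk_def)
  next
    case (Suc w)
    then have "s v = s w \<or> s v = Suc (s w)" using s \<open>v < n\<close> by (simp add: walk_def)
    then show ?thesis using less[of w] Suc by auto
  qed
  then show ?thesis using that[of v] v less \<open>v < n\<close> by simp
qed

text \<open>Running through a zigzag map without ever turning round unrolls it to a walk of length \<open>k\<close>
  times the length of the target path; folding that walk gives the map back.\<close>

definition K_walk :: "nat \<Rightarrow> nat \<Rightarrow> nat \<Rightarrow> (nat \<Rightarrow> nat) \<Rightarrow> (nat \<Rightarrow> nat) \<Rightarrow> bool" where
  "K_walk n m k f s \<longleftrightarrow> n \<ge> 2 \<and> m \<ge> 2 \<and> k \<ge> 1 \<and> walk n (k * (m - 1)) s \<and>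
     (\<forall>v<n. f v = fold_path (m - 1) (s v))"

text \<open>Consecutive vertices of a path are distinct, so the fold of a walk shows whether the walk
  moved; hence \<open>f\<close> determines its walk.\<close>

lemma K_walk_unique:
  assumes "K_walk n m k f s" "K_walk n m k' f s'"
  shows "k = k'"
proof -
  let ?p = "m - 1"
  have p: "?p > 0" using assms by (auto simp: K_walk_def)
  have eq: "s v = s' v" if "v < n" for v
    using that
  proof (induction v)
    case 0
    then show ?case using assms by (simp add: K_walk_def walk_def)
  next
    case (Suc v)
    then have IH: "s v = s' v" by simp
    have f: "f (Suc v) = fold_path ?p (s (Suc v))" "f (Suc v) = fold_path ?p (s' (Suc v))"
      "f v = fold_path ?p (s v)"
      using Suc.prems assms by (simp_all add: K_walk_def)
    have "s (Suc v) = s v \<or> s (Suc v) = Suc (s v)" "s' (Suc v) = s' v \<or> s' (Suc v) = Suc (s' v)"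
      using Suc.prems assms by (simp_all add: K_walk_def walk_def)
    then show ?case using IH f fold_path_step[OF p, of "s v"] by auto
  qed
  have "s (n - 1) = k * ?p" "s' (n - 1) = k' * ?p" "n - 1 < n"
    using assms by (auto simp: K_walk_def walk_def)
  then show ?thesis using eq[of "n - 1"] p by simp
qed

lemma subdivision_imp_K_walk:
  assumes n: "n \<ge> 2" and m: "m \<ge> 2" and f: "pointed_epi n m f" and sub: "K_subdivision n m f k i"
  shows "\<exists>s. K_walk n m k f s"
proof -
  define p where "p = m - 1"
  have p: "p > 0" using m by (simp add: p_def)
  have i0: "i 0 = 0" and ik: "i k = n - 1" and iless: "\<And>j. j < k \<Longrightarrow> i j < i (Suc j)"
    and imono: "\<And>j. j < k \<Longrightarrow> mono_on {i j..i (Suc j)} f \<or> antimono_on {i j..i (Suc j)} f"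
    and ival: "\<And>j. j \<le> k \<Longrightarrow> f (i j) = (if odd j then p else 0)"
    using sub by (simp_all add: K_subdivision_def p_def)
  have k: "k \<ge> 1" using i0 ik n by (cases k) auto
  have ile: "i j \<le> i j'" if "j \<le> j'" "j' \<le> k" for j j'
    using that
  proof (induction j')
    case (Suc j')
    then show ?case using iless[of j'] by (cases "j = Suc j'") auto
  qed simp
  have fp: "f v \<le> p" if "v < n" for v
  proof -
    have "f v \<in> f ` {..<n}" using that by simp
    also have "\<dots> = {..<m}" using f unfolding pointed_epi_def by blast
    finally show ?thesis using m by (simp add: p_def)
  qed
  have fstep: "f v \<le> Suc (f (Suc v)) \<and> f (Suc v) \<le> Suc (f v)" if "Suc v < n" for v
  proof -
    have "(v, Suc v) \<in> path_edges n" using that by (auto simp: path_edges_def)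
    then have "map_prod f f (v, Suc v) \<in> map_prod f f ` path_edges n" by (rule imageI)
    then have "(f v, f (Suc v)) \<in> path_edges m" using f by (simp add: pointed_epi_def)
    then show ?thesis by (auto simp: path_edges_def)
  qed
  define \<phi> where "\<phi> j x = (if even j then x else p - x)" for j x :: nat
  define J where "J v = Max {j. j \<le> k \<and> i j \<le> v}" for v
  \<comment> \<open>\<open>J v\<close> is the number of completed laps, and \<open>\<phi> j\<close> turns the descents of the odd laps into ascents\<close>
  define s where "s v = J v * p + \<phi> (J v) (f v)" for v
  have J: "J v = j" if "j \<le> k" "i j \<le> v" "j < k \<Longrightarrow> v < i (Suc j)" for v j
    unfolding J_def
  proof (rule Max_eqI)
    show "y \<le> j" if "y \<in> {j. j \<le> k \<and> i j \<le> v}" for y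
    proof (rule ccontr)
      assume "\<not> y \<le> j"
      then have "i (Suc j) \<le> i y" "j < k" using ile[of "Suc j" y] that by auto
      then show False using that \<open>j < k \<Longrightarrow> v < i (Suc j)\<close> by auto
    qed
  qed (use that in auto)
  have closed: "s v = j * p + \<phi> j (f v)" if "j < k" "i j \<le> v" "v \<le> i (Suc j)" for v j
  proof (cases "v = i (Suc j)")
    case True
    have "J v = Suc j" using that True iless[of "Suc j"] by (intro J) auto
    moreover have "f v = (if odd (Suc j) then p else 0)" using ival[of "Suc j"] True that by simp
    ultimately show ?thesis by (simp add: s_def \<phi>_def)
  next
    case False
    then show ?thesis using J[of j v] that by (simp add: s_def)
  qed
  have lap: "\<exists>j<k. i j \<le> v \<and> v < i (Suc j)" if "Suc v < n" for v
  proof -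
    have "0 \<in> {j. j \<le> k \<and> i j \<le> v}" using i0 by simp
    then have "J v \<in> {j. j \<le> k \<and> i j \<le> v}" unfolding J_def by (intro Max_in) auto
    then have j: "J v \<le> k" "i (J v) \<le> v" by auto
    then have "J v < k" using ik that by (cases "J v = k") auto
    moreover have "v < i (Suc (J v))"
    proof (rule ccontr)
      assume "\<not> v < i (Suc (J v))"
      then have "Suc (J v) \<le> J v" unfolding J_def[of v]
        using \<open>J v < k\<close> by (intro Max_ge) (auto simp: J_def)
      then show False by simp
    qed
    ultimately show ?thesis using j by blast
  qed
  have step: "s (Suc v) = s v \<or> s (Suc v) = Suc (s v)" if v: "Suc v < n" for v
  proof -
    obtain j where j: "j < k" "i j \<le> v" "v < i (Suc j)" using lap[OF v] by blast
    have s: "s v = j * p + \<phi> j (f v)" "s (Suc v) = j * p + \<phi> j (f (Suc v))"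
      using closed[of j v] closed[of j "Suc v"] j by auto
    have lap_in: "i j \<in> {i j..i (Suc j)}" "i (Suc j) \<in> {i j..i (Suc j)}" "v \<in> {i j..i (Suc j)}"
      "Suc v \<in> {i j..i (Suc j)}" using j iless[of j] by auto
    show ?thesis
    proof (cases "even j")
      case True
      have "f (i j) < f (i (Suc j))" using ival[of j] ival[of "Suc j"] j True p by simp
      then have "\<not> antimono_on {i j..i (Suc j)} f"
        using lap_in iless[of j] j unfolding monotone_on_def by (metis leD less_imp_le)
      then have "mono_on {i j..i (Suc j)} f" using imono[of j] j by blast
      then have "f v \<le> f (Suc v)" using lap_in unfolding monotone_on_def by (metis lessI less_imp_le)
      then show ?thesis using s True fstep[OF v] by (auto simp: \<phi>_def)
    next
      case False
      have "f (i (Suc j)) < f (i j)" using ival[of j] ival[of "Suc j"] j False p by simp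
      then have "\<not> mono_on {i j..i (Suc j)} f"
        using lap_in iless[of j] j unfolding monotone_on_def by (metis leD less_imp_le)
      then have "antimono_on {i j..i (Suc j)} f" using imono[of j] j by blast
      then have "f (Suc v) \<le> f v" using lap_in unfolding monotone_on_def by (metis lessI less_imp_le)
      then show ?thesis using s False fstep[OF v] fp[of v] v by (auto simp: \<phi>_def)
    qed
  qed
  have "s 0 = 0" using J[of 0 0] iless[of 0] k i0 ival[of 0] by (simp add: s_def \<phi>_def)
  moreover have "s (n - 1) = k * p"
    using closed[of "k - 1" "n - 1"] ival[of k] ik iless[of "k - 1"] k p
    by (cases k) (auto simp: \<phi>_def)
  moreover have "f v = fold_path p (s v)" if "v < n" for v
    using fold_path_lap[OF p, of "\<phi> (J v) (f v)" "J v"] fp[OF that] by (auto simp: s_def \<phi>_def)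
  ultimately have "K_walk n m k f s"
    using n m k step by (simp add: K_walk_def walk_def p_def)
  then show ?thesis by blast
qed

lemma K_walk_imp_pointed_epi:
  assumes "K_walk n m k f s"
  shows "pointed_epi n m f"
proof -
  define p where "p = m - 1"
  have n: "n \<ge> 2" and m: "m = Suc p" and k: "k \<ge> 1" and s: "walk n (k * p) s" and p: "p > 0"
    and f: "\<And>v. v < n \<Longrightarrow> f v = fold_path p (s v)"
    using assms by (auto simp: K_walk_def p_def)
  have pk: "p \<le> k * p" using k by (cases k) auto
  have fp: "f v < m" if "v < n" for v using f[OF that] fold_path_le[OF p, of "s v"] m by simp
  have hit: "\<exists>v<n. f v = a" if "a < m" for a
  proof -
    have "a \<le> p" "n \<ge> 1" using that m n by simp_all
    then have "a \<le> k * p" "n \<ge> 1" using pk by (blast intro: order_trans)+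
    then obtain v where v: "v < n" "s v = a" using walk_first[OF s] by blast
    have "f v = a" unfolding f[OF v(1)] v(2) using fold_path_id[OF p, of a] that m by simp
    then show ?thesis using v by blast
  qed
  have adj: "f v \<le> Suc (f (Suc v)) \<and> f (Suc v) \<le> Suc (f v)" if "Suc v < n" for v
  proof -
    have "s (Suc v) = s v \<or> s (Suc v) = Suc (s v)" using s that by (simp add: walk_def)
    then show ?thesis using f[of v] f[of "Suc v"] that fold_path_step[OF p, of "s v"] by auto
  qed
  have hit_edge: "\<exists>v. Suc v < n \<and> f v = a \<and> f (Suc v) = Suc a" if "Suc a < m" for a
  proof -
    have "Suc a \<le> p" "n \<ge> 1" using that m n by simp_all
    then have "Suc a \<le> k * p" "n \<ge> 1" using pk by (blast intro: order_trans)+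
    then obtain v where v: "v < n" "s v = Suc a" "\<And>u. u < v \<Longrightarrow> s u < Suc a"
      using walk_first[OF s] by blast
    have "s 0 = 0" using s unfolding walk_def by blast
    then have "v \<noteq> 0" using v(2) by (metis nat.distinct(1))
    then obtain w where w: "v = Suc w" using not0_implies_Suc by blast
    then have "s v = s w \<or> s v = Suc (s w)" using s v(1) unfolding walk_def by blast
    moreover have "s w < Suc a" using v(3)[of w] w by simp
    ultimately have sw: "s w = a" using v(2) by linarith
    have "f w = a" "f (Suc w) = Suc a"
      using f[of w] f[of v] v(1,2) w sw fold_path_id[OF p, of a] fold_path_id[OF p, of "Suc a"] that m
      by simp_all
    then show ?thesis using v(1) w by blast
  qed
  have "f ` {..<n} = {..<m}"
  proof (intro equalityI subsetI)
    show "a \<in> f ` {..<n}" if "a \<in> {..<m}" for a using hit[of a] that by auto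
  qed (use fp in auto)
  moreover have "map_prod f f ` path_edges n = path_edges m"
  proof (intro equalityI subsetI)
    fix e assume "e \<in> map_prod f f ` path_edges n"
    then obtain u v where e: "e = (f u, f v)" and uv: "(u, v) \<in> path_edges n" by auto
    then have "\<bar>int u - int v\<bar> \<le> 1" by (simp add: path_edges_def)
    then consider "u = v" | "v = Suc u" | "u = Suc v" by linarith
    then show "e \<in> path_edges m"
    proof cases
      case 1
      then show ?thesis using e uv fp by (auto simp: path_edges_def)
    next
      case 2
      then have "Suc u < n" using uv by (simp add: path_edges_def)
      then show ?thesis using e uv 2 fp[of u] fp[of v] adj[of u] by (auto simp: path_edges_def)
    next
      case 3
      then have "Suc v < n" using uv by (simp add: path_edges_def)
      then show ?thesis using e uv 3 fp[of u] fp[of v] adj[of v] by (auto simp: path_edges_def)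
    qed
  next
    fix e assume em: "e \<in> path_edges m"
    obtain a b where e: "e = (a, b)" by (cases e)
    then have "\<bar>int a - int b\<bar> \<le> 1" "a < m" "b < m" using em by (simp_all add: path_edges_def)
    then consider "a = b" "a < m" | "b = Suc a" "b < m" | "a = Suc b" "a < m" by linarith
    then show "e \<in> map_prod f f ` path_edges n"
    proof cases
      case 1
      then obtain v where "v < n" "f v = a" using hit by blast
      then show ?thesis using e 1 by (intro image_eqI[of _ _ "(v, v)"]) (auto simp: path_edges_def)
    next
      case 2
      then obtain v where "Suc v < n" "f v = a" "f (Suc v) = b" using hit_edge by blast
      then show ?thesis using e by (intro image_eqI[of _ _ "(v, Suc v)"]) (auto simp: path_edges_def)
    next
      case 3
      then obtain v where "Suc v < n" "f v = b" "f (Suc v) = a" using hit_edge by blast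
      then show ?thesis using e by (intro image_eqI[of _ _ "(Suc v, v)"]) (auto simp: path_edges_def)
    qed
  qed
  moreover have "f 0 = 0" using f[of 0] n s fold_path_id[OF p, of 0] by (simp add: walk_def)
  ultimately show ?thesis by (simp add: pointed_epi_def)
qed

lemma K_walk_imp_subdivision:
  assumes "K_walk n m k f s"
  shows "\<exists>i. K_subdivision n m f k i"
proof -
  define p where "p = m - 1"
  have n: "n \<ge> 2" and m: "m = Suc p" and k: "k \<ge> 1" and s: "walk n (k * p) s" and p: "p > 0"
    and f: "\<And>v. v < n \<Longrightarrow> f v = fold_path p (s v)"
    using assms by (auto simp: K_walk_def p_def)
  have s0: "s 0 = 0" and sn: "s (n - 1) = k * p" using s by (simp_all add: walk_def)
  have "\<exists>v<n. s v = j * p \<and> (j = 0 \<longrightarrow> v = 0)" if "j \<le> k" for j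
  proof (cases "j = 0")
    case True
    then show ?thesis using s0 n by (intro exI[of _ 0]) auto
  next
    case False
    have "j * p \<le> k * p" "n \<ge> 1" using that n by auto
    then show ?thesis using walk_first[OF s] False by blast
  qed
  then obtain i0 where i0: "\<And>j. j \<le> k \<Longrightarrow> i0 j < n \<and> s (i0 j) = j * p \<and> (j = 0 \<longrightarrow> i0 j = 0)" by metis
  define i where "i j = (if j = k then n - 1 else i0 j)" for j
  have i: "i j < n" "s (i j) = j * p" if "j \<le> k" for j
    using i0[of j] that sn n by (auto simp: i_def)
  have "i 0 = 0" using i0[of 0] k by (simp add: i_def)
  moreover have "i k = n - 1" by (simp add: i_def)
  moreover have less: "i j < i (Suc j)" if "j < k" for j
    using walk_less[OF s, of "i j" "i (Suc j)"] i[of j] i[of "Suc j"] that p by simp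
  moreover have "mono_on {i j..i (Suc j)} f \<or> antimono_on {i j..i (Suc j)} f" if j: "j < k" for j
  proof -
    have val: "f v = (if even j then s v - j * p else p - (s v - j * p)) \<and> j * p \<le> s v \<and> s v \<le> j * p + p \<and> v < n"
      if "v \<in> {i j..i (Suc j)}" for v
    proof -
      have v: "v < n" using that i[of "Suc j"] j by auto
      have "s (i j) \<le> s v" "s v \<le> s (i (Suc j))"
        using walk_mono[OF s, of "i j" v] walk_mono[OF s, of v "i (Suc j)"] that i[of "Suc j"] j v by auto
      then have "j * p \<le> s v" "s v \<le> j * p + p" using i[of j] i[of "Suc j"] j by auto
      then show ?thesis using f[OF v] fold_path_lap[OF p, of "s v - j * p" j] v by auto
    qed
    have sm: "s u \<le> s v" if "u \<le> v" "v \<in> {i j..i (Suc j)}" for u v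
      using walk_mono[OF s that(1)] val[OF that(2)] by auto
    show ?thesis
    proof (cases "even j")
      case True
      have "mono_on {i j..i (Suc j)} f"
      proof (rule mono_onI)
        fix u v assume "u \<in> {i j..i (Suc j)}" "v \<in> {i j..i (Suc j)}" "u \<le> v"
        then show "f u \<le> f v" using val[of u] val[of v] sm[of u v] True by auto
      qed
      then show ?thesis by blast
    next
      case False
      have "antimono_on {i j..i (Suc j)} f"
      proof (rule monotone_onI)
        fix u v assume "u \<in> {i j..i (Suc j)}" "v \<in> {i j..i (Suc j)}" "u \<le> v"
        then show "f v \<le> f u" using val[of u] val[of v] sm[of u v] False by auto
      qed
      then show ?thesis by blast
    qed
  qed
  moreover have "f (i j) = (if odd j then m - 1 else 0)" if "j \<le> k" for j
    using f[of "i j"] i[OF that] fold_path_mult[OF p, of j] m by simp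
  ultimately have "K_subdivision n m f k i" by (simp add: K_subdivision_def)
  then show ?thesis by blast
qed

text \<open>A morphism together with its degree is the same thing as a walk, and a walk is the same
  thing as the set of places where it moves. This turns the Ramsey property of the category into
  the finite Ramsey theorem for subsets.\<close>

theorem K_morphism_iff_walk:
  "K_morphism n m f \<and> K_degree n m f = k \<longleftrightarrow> (\<exists>s. K_walk n m k f s)"
proof
  assume L: "K_morphism n m f \<and> K_degree n m f = k"
  then obtain k' i where sub: "n \<ge> 2" "m \<ge> 2" "pointed_epi n m f" "K_subdivision n m f k' i"
    by (auto simp: K_morphism_def)
  then obtain s where s: "K_walk n m k' f s" using subdivision_imp_K_walk by blast
  have "K_degree n m f = k'" unfolding K_degree_def
  proof (rule the_equality)
    show "\<exists>i. K_subdivision n m f k' i" using sub by blast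
    show "k'' = k'" if "\<exists>i. K_subdivision n m f k'' i" for k''
      using that subdivision_imp_K_walk[OF sub(1-3)] K_walk_unique s by blast
  qed
  then show "\<exists>s. K_walk n m k f s" using s L by auto
next
  assume "\<exists>s. K_walk n m k f s"
  then obtain s where s: "K_walk n m k f s" by blast
  have epi: "n \<ge> 2" "m \<ge> 2" "pointed_epi n m f" using K_walk_imp_pointed_epi[OF s] s by (auto simp: K_walk_def)
  obtain i where i: "K_subdivision n m f k i" using K_walk_imp_subdivision[OF s] by blast
  have "K_degree n m f = k" unfolding K_degree_def
  proof (rule the_equality)
    show "\<exists>i. K_subdivision n m f k i" using i by blast
    show "k'' = k" if "\<exists>i. K_subdivision n m f k'' i" for k''
      using that subdivision_imp_K_walk[OF epi] K_walk_unique s by blast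
  qed
  then show "K_morphism n m f \<and> K_degree n m f = k" using epi i by (auto simp: K_morphism_def)
qed

text \<open>The discrete equivariant extension of a walk from \<open>{0..a}\<close> to all times, by translations and
  reflections of its single lap.\<close>

definition unfold_walk :: "nat \<Rightarrow> nat \<Rightarrow> (nat \<Rightarrow> nat) \<Rightarrow> nat \<Rightarrow> nat" where
  "unfold_walk a b s t =
     (if even (t div a) then t div a * b + s (t mod a) else Suc (t div a) * b - s (a - t mod a))"

lemma unfold_walk_lap:
  assumes s: "walk (Suc a) b s" and a: "a > 0" and x: "x \<le> a"
  shows "unfold_walk a b s (j * a + x) = (if even j then j * b + s x else Suc j * b - s (a - x))"
proof (cases "x = a")
  case True
  then have "j * a + x = Suc j * a" by simp
  then have "(j * a + x) div a = Suc j" "(j * a + x) mod a = 0"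
    using a by (simp_all only: nonzero_mult_div_cancel_right mod_mult_self2_is_0 neq0_conv)
  then show ?thesis using True s by (simp add: unfold_walk_def walk_def)
next
  case False
  then have "(j * a + x) div a = j" "(j * a + x) mod a = x" using a x by auto
  then show ?thesis by (simp add: unfold_walk_def)
qed

lemma unfold_walk_step:
  assumes s: "walk (Suc a) b s" and a: "a > 0"
  shows "unfold_walk a b s (Suc t) = unfold_walk a b s t \<or>
    unfold_walk a b s (Suc t) = Suc (unfold_walk a b s t)"
proof -
  obtain j x where t: "t = j * a + x" "x < a" using lap_split[OF a] by blast
  then have S: "Suc t = j * a + Suc x" by simp
  have step: "s (Suc v) = s v \<or> s (Suc v) = Suc (s v)" if "v < a" for v
    using s that unfolding walk_def by simp
  have u: "unfold_walk a b s t = (if even j then j * b + s x else Suc j * b - s (a - x))"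
    unfolding t(1) by (rule unfold_walk_lap[OF s a less_imp_le[OF t(2)]])
  have u': "unfold_walk a b s (Suc t) = (if even j then j * b + s (Suc x) else Suc j * b - s (a - Suc x))"
    unfolding S by (rule unfold_walk_lap[OF s a Suc_leI[OF t(2)]])
  show ?thesis
  proof (cases "even j")
    case True
    then show ?thesis using u u' step[OF t(2)] by auto
  next
    case False
    define y where "y = a - Suc x"
    have y: "a - x = Suc y" "y < a" using t(2) by (simp_all add: y_def)
    have "s (Suc y) \<le> b" using walk_le[OF s, of "Suc y"] y(2) by simp
    then have "s (Suc y) \<le> Suc j * b" by simp
    then show ?thesis using u u' step[OF y(2)] False unfolding y(1) y_def[symmetric] by auto
  qed
qed

text \<open>The extended walk covers folding: shifts and reflections of the source by multiples of
  \<open>2 * a\<close> become shifts and reflections of the target by multiples of \<open>2 * k * p\<close>, which the fold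
  does not see. This is why composites of zigzag maps are zigzag maps whose degrees multiply.\<close>

lemma fold_unfold_walk:
  assumes s: "walk (Suc a) (k * p) s" and a: "a > 0" and p: "p > 0"
  shows "fold_path p (unfold_walk a (k * p) s t) = fold_path p (s (fold_path a t))"
proof -
  obtain j x where t: "t = j * a + x" "x < a" using lap_split[OF a] by blast
  show ?thesis
  proof (cases "even j")
    case True
    then obtain z where z: "j = 2 * z" by (elim evenE)
    have "unfold_walk a (k * p) s t = j * (k * p) + s x"
      unfolding t(1) using unfold_walk_lap[OF s a less_imp_le[OF t(2)], of j] True by simp
    also have "\<dots> = 2 * (z * k) * p + s x" unfolding z by (simp add: algebra_simps)
    finally have "fold_path p (unfold_walk a (k * p) s t) = fold_path p (s x)"
      using fold_path_shift[OF p] by simp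
    also have "x = fold_path a t"
      unfolding t(1) using fold_path_lap[OF a less_imp_le[OF t(2)], of j] True by simp
    finally show ?thesis .
  next
    case False
    then have "even (Suc j)" by simp
    then obtain z where z: "Suc j = 2 * z" by (elim evenE)
    have "unfold_walk a (k * p) s t = Suc j * (k * p) - s (a - x)"
      unfolding t(1) using unfold_walk_lap[OF s a less_imp_le[OF t(2)], of j] False by simp
    also have "\<dots> = 2 * (z * k) * p - s (a - x)" unfolding z by (simp add: algebra_simps)
    finally have e: "unfold_walk a (k * p) s t = 2 * (z * k) * p - s (a - x)" .
    have "s (a - x) \<le> k * p" using walk_le[OF s, of "a - x"] by simp
    also have "\<dots> \<le> Suc j * (k * p)" by simp
    also have "\<dots> = 2 * (z * k) * p" unfolding z by (simp add: algebra_simps)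
    finally have "fold_path p (unfold_walk a (k * p) s t) = fold_path p (s (a - x))"
      unfolding e by (rule fold_path_reflect[OF p])
    also have "a - x = fold_path a t"
      unfolding t(1) using fold_path_lap[OF a less_imp_le[OF t(2)], of j] False by simp
    finally show ?thesis .
  qed
qed

lemma K_walk_compose:
  assumes g: "K_walk n l k g r" and f: "K_walk l m k' f s"
  shows "K_walk n m (k * k') (\<lambda>v. f (g v)) (\<lambda>v. unfold_walk (l - 1) (k' * (m - 1)) s (r v))"
proof -
  define a where "a = l - 1"
  define p where "p = m - 1"
  have l: "l \<ge> 2" "m \<ge> 2" "n \<ge> 2" "k \<ge> 1" "k' \<ge> 1" using g f unfolding K_walk_def by blast+
  have a: "l = Suc a" "a > 0" and p: "p > 0" using l(1,2) unfolding a_def p_def by linarith+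
  have "walk l (k' * p) s" using f unfolding K_walk_def p_def by blast
  then have s: "walk (Suc a) (k' * p) s" by (simp only: a(1))
  have r: "walk n (k * a) r" using g unfolding K_walk_def a_def by blast
  define u where "u = unfold_walk a (k' * p) s"
  have ends: "s 0 = 0" "s a = k' * p" "r 0 = 0" "r (n - 1) = k * a"
    using s r unfolding walk_def by simp_all
  have u_mult: "u (j * a) = j * (k' * p)" for j
    using unfold_walk_lap[OF s a(2), of 0 j] ends(1,2) unfolding u_def by simp
  have "u (r 0) = 0" "u (r (n - 1)) = k * k' * p"
    using u_mult[of 0] u_mult[of k] ends(3,4) by (simp_all add: mult.assoc)
  moreover have "u (r (Suc v)) = u (r v) \<or> u (r (Suc v)) = Suc (u (r v))" if "Suc v < n" for v
  proof -
    have "r (Suc v) = r v \<or> r (Suc v) = Suc (r v)" using r that unfolding walk_def by blast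
    then show ?thesis using unfold_walk_step[OF s a(2), of "r v"] unfolding u_def by (elim disjE) simp_all
  qed
  ultimately have "walk n (k * k' * p) (\<lambda>v. u (r v))" unfolding walk_def by blast
  moreover have "f (g v) = fold_path p (u (r v))" if "v < n" for v
  proof -
    have gv: "g v = fold_path a (r v)" using g that unfolding K_walk_def a_def by blast
    then have "g v < l" using fold_path_le[OF a(2), of "r v"] a(1) by simp
    then have "f (g v) = fold_path p (s (g v))" using f unfolding K_walk_def p_def by blast
    then show ?thesis using fold_unfold_walk[OF s a(2) p] gv unfolding u_def by simp
  qed
  moreover have "k * k' \<ge> 1" using l(4,5) by (simp add: Suc_le_eq)
  ultimately show ?thesis using l unfolding K_walk_def a_def p_def u_def by blast
qed

lemma Kstar_morphism_iff_walk:
  "Kstar_morphism B A f \<longleftrightarrow> Kstar_object B \<and> Kstar_object A \<and>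
     (\<exists>k s. K_walk (fst B) (fst A) k f s \<and> of_nat k = snd B / snd A)"
proof -
  have "(\<exists>k s. K_walk (fst B) (fst A) k f s \<and> of_nat k = snd B / snd A) \<longleftrightarrow>
      (\<exists>k. (\<exists>s. K_walk (fst B) (fst A) k f s) \<and> of_nat k = snd B / snd A)" by blast
  also have "\<dots> \<longleftrightarrow> K_morphism (fst B) (fst A) f \<and>
      of_nat (K_degree (fst B) (fst A) f) = snd B / snd A"
    unfolding K_morphism_iff_walk[symmetric] by auto
  finally show ?thesis unfolding Kstar_morphism_def by simp
qed

lemma Kstar_morphism_compose:
  assumes g: "Kstar_morphism C B g" and f: "Kstar_morphism B A f"
  shows "Kstar_morphism C A (\<lambda>v. f (g v))"
proof -
  obtain k r where g': "K_walk (fst C) (fst B) k g r" "of_nat k = snd C / snd B"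
    using g unfolding Kstar_morphism_iff_walk by blast
  obtain k' s where f': "K_walk (fst B) (fst A) k' f s" "of_nat k' = snd B / snd A"
    using f unfolding Kstar_morphism_iff_walk by blast
  have "snd B > 0" using g by (simp add: Kstar_morphism_def Kstar_object_def)
  then have "of_nat (k * k') = snd C / snd A" using g'(2) f'(2) by simp
  then show ?thesis
    using K_walk_compose[OF g'(1) f'(1)] f g unfolding Kstar_morphism_iff_walk by blast
qed

lemma Kstar_morphism_id:
  assumes "Kstar_object A"
  shows "Kstar_morphism A A (\<lambda>v. v)"
proof -
  have "K_walk (fst A) (fst A) 1 (\<lambda>v. v) (\<lambda>v. v)"
    using assms fold_path_id[of "fst A - 1"] by (auto simp: K_walk_def walk_def Kstar_object_def)
  then show ?thesis using assms unfolding Kstar_morphism_iff_walk Kstar_object_def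
    by (intro conjI exI[of _ 1] exI[of _ "\<lambda>v. v"]) auto
qed

lemma Kstar_morphism_less:
  assumes "Kstar_morphism B A f" "v < fst B"
  shows "f v < fst A"
proof -
  have "f v \<in> f ` {..<fst B}" using assms by simp
  also have "\<dots> = {..<fst A}"
    using assms unfolding Kstar_morphism_def K_morphism_def pointed_epi_def by blast
  finally show ?thesis by simp
qed

section \<open>Inverse limits and jumps of walks\<close>

lemma bond_refl [simp]: "bond F n n = id"
  by (simp add: bond_def)

lemma bond_Suc: "n \<le> N \<Longrightarrow> bond F n (Suc N) = bond F n N \<circ> F N"
  by (simp add: bond_def)

lemma bond_trans: "n \<le> k \<Longrightarrow> k \<le> N \<Longrightarrow> bond F n N v = bond F n k (bond F k N v)"
proof (induction "N - k" arbitrary: N v)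
  case 0
  then show ?case by simp
next
  case (Suc j)
  then obtain N' where N: "N = Suc N'" "k \<le> N'" by (cases N) auto
  then have "bond F n N' (F N' v) = bond F n k (bond F k N' (F N' v))"
    using Suc by (intro Suc(1)) auto
  then show ?case using Suc.prems N by (simp add: bond_Suc)
qed

lemma bond_step: "n < N \<Longrightarrow> bond F n N v = F n (bond F (Suc n) N v)"
  using bond_trans[of n "Suc n" N F v] by (simp add: bond_Suc)

lemma bond_thread:
  assumes "\<And>n. x n = F n (x (Suc n))" "n \<le> N"
  shows "bond F n N (x N) = x n"
  using assms(2)
proof (induction N)
  case (Suc N)
  then show ?case using assms(1)[of N] by (cases "n = Suc N") (auto simp: bond_Suc)
qed simp

lemma topspace_inverse_limit:
  "topspace (inverse_limit X F) = {x. (\<forall>n. x n \<in> topspace (X n)) \<and> (\<forall>n. x n = F n (x (Suc n)))}"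
  by (auto simp: inverse_limit_def PiE_def)

lemma continuous_map_projection: "continuous_map (inverse_limit X F) (X n) (\<lambda>x. x n)"
  unfolding inverse_limit_def
  by (intro continuous_map_from_subtopology continuous_map_product_projection) simp

lemma compact_inverse_limit:
  assumes "\<And>n. compact_space (X n)" "\<And>n. Hausdorff_space (X n)"
    and F: "\<And>n. continuous_map (X (Suc n)) (X n) (F n)"
  shows "compact_space (inverse_limit X F)"
proof -
  let ?P = "product_topology X UNIV"
  have "closedin ?P {x \<in> topspace ?P. x n = F n (x (Suc n))}" for n
  proof (rule closedin_continuous_maps_eq[OF assms(2)])
    show "continuous_map ?P (X n) (\<lambda>x. x n)" by (rule continuous_map_product_projection) simp
    have "continuous_map ?P (X (Suc n)) (\<lambda>x. x (Suc n))" by (rule continuous_map_product_projection) simp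
    from continuous_map_compose[OF this F] show "continuous_map ?P (X n) (\<lambda>x. F n (x (Suc n)))"
      by (simp add: o_def)
  qed
  then have "closedin ?P (\<Inter>n. {x \<in> topspace ?P. x n = F n (x (Suc n))})"
    by (intro closedin_Inter) auto
  moreover have "(\<Inter>n. {x \<in> topspace ?P. x n = F n (x (Suc n))}) = topspace ?P \<inter> {x. \<forall>n. x n = F n (x (Suc n))}"
    by auto
  ultimately have "closedin ?P (topspace ?P \<inter> {x. \<forall>n. x n = F n (x (Suc n))})" by simp
  moreover have "compact_space ?P" using assms(1) by (simp add: compact_space_product_topology)
  ultimately have "compactin ?P (topspace ?P \<inter> {x. \<forall>n. x n = F n (x (Suc n))})"
    by (rule closedin_compact_space[rotated])
  then have "compact_space (subtopology ?P (topspace ?P \<inter> {x. \<forall>n. x n = F n (x (Suc n))}))"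
    by (rule compact_space_subtopology)
  then show ?thesis unfolding inverse_limit_def
    by (metis subtopology_restrict)
qed

lemma closedin_far_pairs:
  "closedin (prod_topology (mtopology_of m) (mtopology_of m))
     {z \<in> mspace m \<times> mspace m. \<epsilon> \<le> mdist m (fst z) (snd z)}"
proof -
  let ?P = "prod_topology (mtopology_of m) (mtopology_of m)"
  have "continuous_map ?P euclideanreal (\<lambda>z. mdist m (fst z) (snd z))"
    by (intro continuous_map_mdist continuous_map_fst continuous_map_snd)
  from closedin_continuous_map_preimage[OF this, of "{\<epsilon>..}"]
  show ?thesis by simp
qed

definition jump_count :: "nat set \<Rightarrow> nat \<Rightarrow> nat" where
  "jump_count T v = card (T \<inter> {..<v})"

lemma jump_count_Suc: "jump_count T (Suc v) = (if v \<in> T then Suc (jump_count T v) else jump_count T v)"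
proof -
  have "T \<inter> {..<Suc v} = (if v \<in> T then insert v (T \<inter> {..<v}) else T \<inter> {..<v})"
    by (auto simp: less_Suc_eq)
  then show ?thesis by (simp add: jump_count_def)
qed

lemma walk_jump_count:
  assumes "T \<subseteq> {..<N}"
  shows "walk (Suc N) (card T) (jump_count T)"
proof -
  have "T \<inter> {..<N} = T" using assms by blast
  then show ?thesis by (simp add: walk_def jump_count_Suc) (simp add: jump_count_def)
qed

lemma walk_eq_jump_count:
  assumes s: "walk (Suc N) l s"
  defines "T \<equiv> {v. v < N \<and> s (Suc v) \<noteq> s v}"
  shows "v \<le> N \<Longrightarrow> s v = jump_count T v" and "card T = l"
proof -
  show eq: "s v = jump_count T v" if "v \<le> N" for v
    using that
  proof (induction v)
    case 0
    then show ?case using s by (simp add: walk_def jump_count_def)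
  next
    case (Suc v)
    then have "Suc v < Suc N" by simp
    then have "s (Suc v) = s v \<or> s (Suc v) = Suc (s v)" using s unfolding walk_def by blast
    moreover have "v \<in> T \<longleftrightarrow> s (Suc v) \<noteq> s v" using Suc.prems by (simp add: T_def)
    ultimately show ?case using Suc by (auto simp: jump_count_Suc)
  qed
  have "T \<inter> {..<N} = T" by (auto simp: T_def)
  then have "jump_count T N = card T" by (simp add: jump_count_def)
  moreover have "s N = l" using s by (simp add: walk_def)
  ultimately show "card T = l" using eq[of N] by simp
qed

lemma ramsey_sets:
  fixes t q r :: nat
  obtains N :: nat where "\<And>c :: nat set \<Rightarrow> nat. (\<And>T. T \<in> nsets {..<N} r \<Longrightarrow> c T < t) \<Longrightarrow>
    \<exists>B col. B \<in> nsets {..<N} q \<and> (\<forall>T\<in>nsets B r. c T = col)"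
proof -
  obtain N :: nat where N: "partn_lst {..<N} (replicate t q) r" using ramsey_full by blast
  show ?thesis
  proof (rule that[of N])
    fix c :: "nat set \<Rightarrow> nat" assume c: "\<And>T. T \<in> nsets {..<N} r \<Longrightarrow> c T < t"
    have cols: "c \<in> nsets {..<N} r \<rightarrow> {..<length (replicate t q)}"
      using c by (intro funcsetI) simp
    have "\<exists>i<length (replicate t q). monochromatic {..<N} (replicate t q ! i) r c i"
      using N[unfolded partn_lst_def] cols by (rule bspec)
    then obtain i where "i < t" "monochromatic {..<N} (replicate t q ! i) r c i"
      by (auto simp del: nth_replicate)
    then have "monochromatic {..<N} q r c i" by (simp only: nth_replicate)
    then obtain B where "B \<in> nsets {..<N} q" "c ` nsets B r \<subseteq> {i}" unfolding monochromatic_def by (elim bexE)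
    then show "\<exists>B col. B \<in> nsets {..<N} q \<and> (\<forall>T\<in>nsets B r. c T = col)"
      by (intro exI[of _ B] exI[of _ i] conjI ballI) auto
  qed
qed

section \<open>Automorphisms of the limit of a generic sequence\<close>

locale generic =
  fixes A :: "nat \<Rightarrow> nat \<times> rat" and F :: "nat \<Rightarrow> nat \<Rightarrow> nat"
  assumes generic: "generic_sequence A F"
begin

abbreviation "L \<equiv> topspace (Kstar_limit A F)"

lemma L_iff: "x \<in> L \<longleftrightarrow> (\<forall>n. x n < fst (A n)) \<and> (\<forall>n. x n = F n (x (Suc n)))"
  by (simp add: Kstar_limit_def topspace_inverse_limit)

lemma object: "Kstar_object (A n)"
  using generic unfolding generic_sequence_def by blast

lemma bonding: "Kstar_morphism (A (Suc n)) (A n) (F n)"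
  using generic unfolding generic_sequence_def by blast

lemma cofinal: "Kstar_object C \<Longrightarrow> \<exists>n f. Kstar_morphism (A n) C f"
  using generic unfolding generic_sequence_def by blast

lemma amalgamate:
  "Kstar_morphism (A n) C e \<Longrightarrow> Kstar_morphism B C g \<Longrightarrow>
     \<exists>N>n. \<exists>h. Kstar_morphism (A N) B h \<and> (\<forall>v<fst (A N). g (h v) = e (bond F n N v))"
  using generic unfolding generic_sequence_def by blast

lemma bond_morphism: "n \<le> N \<Longrightarrow> Kstar_morphism (A N) (A n) (bond F n N)"
proof (induction N)
  case 0
  then show ?case using Kstar_morphism_id[OF object[of 0]] by (simp add: id_def)
next
  case (Suc N)
  show ?case
  proof (cases "n = Suc N")
    case True
    then show ?thesis using Kstar_morphism_id[OF object[of n]] by (simp add: id_def)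
  next
    case False
    then have "n \<le> N" using Suc by simp
    then have "bond F n (Suc N) = (\<lambda>v. bond F n N (F N v))" by (auto simp: bond_Suc)
    then show ?thesis using Kstar_morphism_compose[OF bonding Suc.IH[OF \<open>n \<le> N\<close>]] by simp
  qed
qed

lemma thread: "x \<in> L \<Longrightarrow> n \<le> N \<Longrightarrow> bond F n N (x N) = x n"
  using L_iff by (intro bond_thread) blast+

lemma L_less: "x \<in> L \<Longrightarrow> x n < fst (A n)"
  using L_iff by blast

lemma L_eqI:
  assumes "x \<in> L" "y \<in> L" "\<And>n. \<exists>N\<ge>n. x N = y N"
  shows "x = y"
proof
  fix n
  obtain N where "N \<ge> n" "x N = y N" using assms(3) by blast
  then show "x n = y n" using thread[OF assms(1), of n N] thread[OF assms(2), of n N] by simp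
qed

text \<open>A compatible family of maps between cofinal subsequences defines a map of the limit. The
  value at level \<open>n\<close> is read off at level \<open>a n \<ge> n\<close> and pulled down by the bonding map.\<close>

lemma limit_map:
  fixes a b :: "nat \<Rightarrow> nat"
  assumes a: "strict_mono a" and b: "strict_mono b"
    and \<rho>: "\<And>j. Kstar_morphism (A (b j)) (A (a j)) (\<rho> j)"
    and consistent: "\<And>j x. x \<in> L \<Longrightarrow> bond F (a j) (a (Suc j)) (\<rho> (Suc j) (x (b (Suc j)))) = \<rho> j (x (b j))"
  obtains g where "limit_morphism A F g" "g \<in> L \<rightarrow> L" "\<And>j x. x \<in> L \<Longrightarrow> g x (a j) = \<rho> j (x (b j))"
proof -
  define g where "g x n = bond F n (a n) (\<rho> n (x (b n)))" for x n
  have a_mono: "a i \<le> a j" if "i \<le> j" for i j using a that by (simp add: strict_mono_less_eq)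
  have a_ge: "n \<le> a n" for n using a by (rule strict_mono_imp_increasing)
  have climb: "bond F n (a (i + e)) (\<rho> (i + e) (x (b (i + e)))) = bond F n (a i) (\<rho> i (x (b i)))"
    if "x \<in> L" "n \<le> a i" for n i e x
  proof (induction e)
    case (Suc e)
    have "n \<le> a (i + e)" "a (i + e) \<le> a (Suc (i + e))" 
      using order_trans[OF that(2) a_mono[of i "i + e"]] a_mono[of "i + e"] by simp_all
    then have "bond F n (a (Suc (i + e))) (\<rho> (Suc (i + e)) (x (b (Suc (i + e))))) =
        bond F n (a (i + e)) (\<rho> (i + e) (x (b (i + e))))"
      using bond_trans consistent[OF that(1), of "i + e"] by metis
    then show ?case using Suc by simp
  qed simp
  have g: "g x n = bond F n (a j) (\<rho> j (x (b j)))" if "x \<in> L" "n \<le> a j" for x n j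
  proof (cases "n \<le> j")
    case True
    then show ?thesis using climb[OF that(1) a_ge, of n "j - n"] by (simp add: g_def)
  next
    case False
    then show ?thesis using climb[OF that, of "n - j"] by (simp add: g_def)
  qed
  have at: "g x (a j) = \<rho> j (x (b j))" if "x \<in> L" for x j
    using g[OF that, of "a j" j] by simp
  have "g x \<in> L" if x: "x \<in> L" for x
    unfolding L_iff
  proof (intro conjI allI)
    fix n
    have "\<rho> n (x (b n)) < fst (A (a n))" using Kstar_morphism_less[OF \<rho>] L_less[OF x] by blast
    then show "g x n < fst (A n)" unfolding g_def
      using Kstar_morphism_less[OF bond_morphism[OF a_ge]] by blast
    have "n < a (Suc n)" using a_ge[of "Suc n"] by simp
    then show "g x n = F n (g x (Suc n))"
      using g[OF x, of n "Suc n"] g[OF x, of "Suc n" "Suc n"] bond_step[of n "a (Suc n)" F] by simp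
  qed
  moreover have "limit_morphism A F g" unfolding limit_morphism_def
  proof (intro exI conjI allI ballI)
    show "strict_mono b" by (rule b)
    show "Kstar_morphism (A (b n)) (A n) (\<lambda>v. bond F n (a n) (\<rho> n v))" for n
      by (rule Kstar_morphism_compose[OF \<rho> bond_morphism[OF a_ge]])
    show "g x n = bond F n (a n) (\<rho> n (x (b n)))" for x n by (simp add: g_def)
  qed
  ultimately show ?thesis using that at by blast
qed

text \<open>The combinatorial half of the back-and-forth argument: amalgamating \<open>\<phi> j\<close> with an
  identity produces the next \<open>\<phi> (j + 1)\<close> going the other way, such that the two compose to a
  bonding map.\<close>

lemma zigzag_chain:
  assumes "Kstar_morphism (A M) (A N) \<psi>"
  obtains p \<phi> where "p 0 = N" "p 1 = M" "\<phi> 0 = \<psi>"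
    "\<And>j. Kstar_morphism (A (p (Suc j))) (A (p j)) (\<phi> j)" "\<And>j. p j < p (Suc (Suc j))"
    "\<And>j v. v < fst (A (p (Suc (Suc j)))) \<Longrightarrow> \<phi> j (\<phi> (Suc j) v) = bond F (p j) (p (Suc (Suc j))) v"
proof -
  \<comment> \<open>\<open>t\<close> is one arrow of the zigzag, from \<open>A b\<close> to \<open>A a\<close>\<close>
  define P where "P j t = (case t of (a, b, \<phi>) \<Rightarrow> Kstar_morphism (A b) (A a) \<phi> \<and> (j = 0 \<longrightarrow> t = (N, M, \<psi>)))"
    for j :: nat and t :: "nat \<times> nat \<times> (nat \<Rightarrow> nat)"
  define R where "R t t' = (case (t, t') of ((a, b, \<phi>), (a', c, \<phi>')) \<Rightarrow> a' = b \<and> a < c \<and>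
     (\<forall>v<fst (A c). \<phi> (\<phi>' v) = bond F a c v))"
    for t t' :: "nat \<times> nat \<times> (nat \<Rightarrow> nat)"
  have "\<exists>t. P 0 t" using assms by (auto simp: P_def)
  moreover have "\<exists>t'. P (Suc j) t' \<and> R t t'" if Pt: "P j t" for j t
  proof -
    obtain a b \<phi> where t: "t = (a, b, \<phi>)" by (cases t)
    then have "Kstar_morphism (A b) (A a) \<phi>" using Pt by (simp add: P_def)
    from amalgamate[OF Kstar_morphism_id[OF object] this] obtain c \<phi>' where
      "c > a" "Kstar_morphism (A c) (A b) \<phi>'" "\<forall>v<fst (A c). \<phi> (\<phi>' v) = bond F a c v" by blast
    then have "P (Suc j) (b, c, \<phi>')" "R t (b, c, \<phi>')" by (simp_all add: P_def R_def t)
    then show ?thesis by blast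
  qed
  ultimately obtain f where f: "\<And>j. P j (f j)" "\<And>j. R (f j) (f (Suc j))"
    using dependent_nat_choice[of P "\<lambda>_. R"] by metis
  define p where "p j = fst (f j)" for j
  define \<phi> where "\<phi> j = snd (snd (f j))" for j
  have nxt: "fst (snd (f j)) = p (Suc j)" for j
    using f(2)[of j] by (auto simp: R_def p_def split: prod.splits)
  have fj: "f j = (p j, p (Suc j), \<phi> j)" for j
    using nxt[of j] by (simp add: p_def \<phi>_def prod_eq_iff)
  have f0: "f 0 = (N, M, \<psi>)" using f(1)[of 0] by (auto simp: P_def split: prod.splits)
  show ?thesis
  proof (rule that)
    show "p 0 = N" "p 1 = M" "\<phi> 0 = \<psi>" using f0 fj[of 0] by auto
    show "Kstar_morphism (A (p (Suc j))) (A (p j)) (\<phi> j)" for j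
      using f(1)[of j] unfolding fj P_def by simp
    show "p j < p (Suc (Suc j))" for j using f(2)[of j] unfolding fj R_def by simp
    show "\<phi> j (\<phi> (Suc j) v) = bond F (p j) (p (Suc (Suc j))) v" if "v < fst (A (p (Suc (Suc j))))" for j v
      using f(2)[of j] that unfolding fj R_def by simp
  qed
qed

lemma limit_morphism_cong:
  "limit_morphism A F f' \<Longrightarrow> (\<And>x. x \<in> L \<Longrightarrow> f x = f' x) \<Longrightarrow> limit_morphism A F f"
  unfolding limit_morphism_def by simp

text \<open>The maps \<open>\<phi> j\<close> of the zigzag with even index form a map of the limit, those with odd
  index form another one, and they are inverse to each other because consecutive maps compose to
  bonding maps.\<close>

theorem ultrahomogeneous:
  assumes "Kstar_morphism (A M) (A N) \<psi>"
  shows "\<exists>k\<in>Kstar_Aut A F. \<forall>x\<in>L. k x N = \<psi> (x M)"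
proof -
  obtain p \<phi> where p: "p 0 = N" "p 1 = M" "\<phi> 0 = \<psi>"
    and \<phi>: "\<And>j. Kstar_morphism (A (p (Suc j))) (A (p j)) (\<phi> j)"
    and less: "\<And>j. p j < p (Suc (Suc j))"
    and two: "\<And>j v. v < fst (A (p (Suc (Suc j)))) \<Longrightarrow> \<phi> j (\<phi> (Suc j) v) = bond F (p j) (p (Suc (Suc j))) v"
    using zigzag_chain[OF assms] by blast
  have round_trip: "\<phi> j (\<phi> (Suc j) (x (p (Suc (Suc j))))) = x (p j)" if "x \<in> L" for x j
    using two[OF L_less[OF that]] thread[OF that] less[of j] by (simp add: less_imp_le)
  have sm: "strict_mono (\<lambda>j. p (2 * j + e))" for e
    unfolding strict_mono_Suc_iff using less by simp
  have "\<exists>g. limit_morphism A F g \<and> g \<in> L \<rightarrow> L \<and>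
      (\<forall>j. \<forall>x\<in>L. g x (p (2 * j + e)) = \<phi> (2 * j + e) (x (p (Suc (2 * j + e)))))" for e
  proof -
    have 1: "Kstar_morphism (A (p (2 * j + Suc e))) (A (p (2 * j + e))) (\<phi> (2 * j + e))" for j
      using \<phi>[of "2 * j + e"] by simp
    have 2: "bond F (p (2 * j + e)) (p (2 * Suc j + e)) (\<phi> (2 * Suc j + e) (x (p (2 * Suc j + Suc e)))) =
        \<phi> (2 * j + e) (x (p (2 * j + Suc e)))" if x: "x \<in> L" for j x
    proof -
      let ?i = "2 * j + e"
      define v where "v = \<phi> (Suc (Suc ?i)) (x (p (Suc (Suc (Suc ?i)))))"
      have "v < fst (A (p (Suc (Suc ?i))))"
        unfolding v_def by (rule Kstar_morphism_less[OF \<phi> L_less[OF x]])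
      then have "bond F (p ?i) (p (Suc (Suc ?i))) v = \<phi> ?i (\<phi> (Suc ?i) v)" using two by simp
      also have "\<phi> (Suc ?i) v = x (p (Suc ?i))" unfolding v_def by (rule round_trip[OF x])
      finally show ?thesis by (simp add: v_def)
    qed
    show ?thesis using limit_map[OF sm[of e] sm[of "Suc e"] 1 2] by simp metis
  qed
  then obtain g where g: "\<And>e. limit_morphism A F (g e)" "\<And>e. g e \<in> L \<rightarrow> L"
    "\<And>e j x. x \<in> L \<Longrightarrow> g e x (p (2 * j + e)) = \<phi> (2 * j + e) (x (p (Suc (2 * j + e))))" by metis
  have large: "\<exists>i\<ge>n. \<exists>j. i = p (2 * j + e)" for n e
    using strict_mono_imp_increasing[OF sm[of e], of n] by blast
  have 01: "g 0 (g 1 x) = x" if x: "x \<in> L" for x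
  proof (rule L_eqI)
    have g1: "g 1 x \<in> L" using g(2)[of 1] x by blast
    then show "g 0 (g 1 x) \<in> L" using g(2)[of 0] by blast
    have "g 0 (g 1 x) (p (2 * j + 0)) = x (p (2 * j + 0))" for j
      using g(3)[OF g1, of 0 j] g(3)[OF x, of 1 j] round_trip[OF x, of "2 * j"] by simp
    then show "\<exists>N\<ge>n. g 0 (g 1 x) N = x N" for n using large[of n 0] by metis
  qed (rule x)
  have 10: "g 1 (g 0 x) = x" if x: "x \<in> L" for x
  proof (rule L_eqI)
    have g0: "g 0 x \<in> L" using g(2)[of 0] x by blast
    then show "g 1 (g 0 x) \<in> L" using g(2)[of 1] by blast
    have "g 1 (g 0 x) (p (2 * j + 1)) = x (p (2 * j + 1))" for j
      using g(3)[OF g0, of 1 j] g(3)[OF x, of 0 "Suc j"] round_trip[OF x, of "Suc (2 * j)"] by simp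
    then show "\<exists>N\<ge>n. g 1 (g 0 x) N = x N" for n using large[of n 1] by metis
  qed (rule x)
  define k where "k = restrict (g 0) L"
  have bij: "bij_betw k L L"
    by (rule bij_betw_byWitness[where f' = "g 1"]) (use 01 10 g(2)[of 0] g(2)[of 1] in \<open>auto simp: k_def\<close>)
  have inv: "inv_into L k x = g 1 x" if "x \<in> L" for x
    using bij 01[OF that] g(2)[of 1] that
    by (intro inv_into_f_eq) (auto simp: bij_betw_def k_def)
  have "limit_morphism A F k" using g(1)[of 0] by (rule limit_morphism_cong) (simp add: k_def)
  moreover have "limit_morphism A F (inv_into L k)" using g(1)[of 1] by (rule limit_morphism_cong) (rule inv)
  ultimately have "k \<in> Kstar_Aut A F" using bij by (simp add: Kstar_Aut_def Bij_def k_def)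
  moreover have "k x N = \<psi> (x M)" if "x \<in> L" for x
    using g(3)[OF that, of 0 0] that p by (simp add: k_def)
  ultimately show ?thesis by blast
qed

lemma limit_morphism_id: "limit_morphism A F (\<lambda>x. x)"
  unfolding limit_morphism_def
  by (intro exI[of _ "\<lambda>n. n"] exI[of _ "\<lambda>n v. v"]) (simp add: strict_mono_def Kstar_morphism_id object)

lemma limit_morphism_compose:
  assumes f: "limit_morphism A F f" and g: "limit_morphism A F g" and "g \<in> L \<rightarrow> L"
  shows "limit_morphism A F (\<lambda>x. f (g x))"
proof -
  obtain i fs where i: "strict_mono i" "\<And>n. Kstar_morphism (A (i n)) (A n) (fs n)"
    "\<And>n x. x \<in> L \<Longrightarrow> f x n = fs n (x (i n))" using f unfolding limit_morphism_def by blast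
  obtain j gs where j: "strict_mono j" "\<And>n. Kstar_morphism (A (j n)) (A n) (gs n)"
    "\<And>n x. x \<in> L \<Longrightarrow> g x n = gs n (x (j n))" using g unfolding limit_morphism_def by blast
  have gL: "g x \<in> L" if "x \<in> L" for x using that assms(3) by blast
  show ?thesis unfolding limit_morphism_def
  proof (intro exI conjI allI ballI)
    show "strict_mono (\<lambda>n. j (i n))" using i(1) j(1) by (simp add: strict_mono_def)
    show "Kstar_morphism (A (j (i n))) (A n) (\<lambda>v. fs n (gs (i n) v))" for n
      by (rule Kstar_morphism_compose[OF j(2) i(2)])
    show "f (g x) n = fs n (gs (i n) (x (j (i n))))" if "x \<in> L" for x n
      using i(3)[OF gL[OF that]] j(3)[OF that] by simp
  qed
qed

lemma limit_morphism_continuous: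
  assumes g: "limit_morphism A F g" and L: "g \<in> L \<rightarrow> L"
  shows "continuous_map (Kstar_limit A F) (Kstar_limit A F) g"
proof -
  let ?X = "\<lambda>n. discrete_topology {..<fst (A n)}"
  obtain i gs where i: "\<And>n. Kstar_morphism (A (i n)) (A n) (gs n)"
    "\<And>n x. x \<in> L \<Longrightarrow> g x n = gs n (x (i n))" using g unfolding limit_morphism_def by blast
  have "continuous_map (Kstar_limit A F) (?X n) (\<lambda>x. g x n)" for n
  proof -
    have "continuous_map (Kstar_limit A F) (?X (i n)) (\<lambda>x. x (i n))"
      unfolding Kstar_limit_def by (rule continuous_map_projection)
    moreover have "continuous_map (?X (i n)) (?X n) (gs n)"
      using Kstar_morphism_less[OF i(1)] by (auto simp: continuous_map_from_discrete_topology)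
    ultimately have "continuous_map (Kstar_limit A F) (?X n) (gs n \<circ> (\<lambda>x. x (i n)))"
      by (rule continuous_map_compose)
    then show ?thesis by (rule continuous_map_eq) (simp add: i(2))
  qed
  then have "continuous_map (Kstar_limit A F) (product_topology ?X UNIV) g"
    by (simp add: continuous_map_componentwise_UNIV)
  moreover have "g ` L \<subseteq> {x. \<forall>n. x n = F n (x (Suc n))}" using L L_iff by blast
  ultimately show ?thesis
    by (simp add: Kstar_limit_def inverse_limit_def continuous_map_in_subtopology image_subset_iff_funcset)
qed

lemma Aut_D:
  assumes "g \<in> Kstar_Aut A F"
  shows "g \<in> Bij L" "limit_morphism A F g" "limit_morphism A F (inv_into L g)" "bij_betw g L L"
    "g \<in> L \<rightarrow> L" "inv_into L g \<in> L \<rightarrow> L"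
proof -
  show g: "g \<in> Bij L" "limit_morphism A F g" "limit_morphism A F (inv_into L g)"
    using assms unfolding Kstar_Aut_def by blast+
  then show b: "bij_betw g L L" by (simp add: Bij_def)
  show "g \<in> L \<rightarrow> L" using b by (rule bij_betw_imp_funcset)
  show "inv_into L g \<in> L \<rightarrow> L" using bij_betw_inv_into[OF b] by (rule bij_betw_imp_funcset)
qed

lemma Aut_group: "permutation_group L (Kstar_Aut A F)"
  unfolding permutation_group_def
proof (intro conjI ballI subsetI)
  show "g \<in> Bij L" if "g \<in> Kstar_Aut A F" for g using Aut_D[OF that] by blast
  have id_inv: "inv_into L (\<lambda>x\<in>L. x) x = x" if "x \<in> L" for x
    using that by (intro inv_into_f_eq) (auto simp: inj_on_def)
  show "(\<lambda>x\<in>L. x) \<in> Kstar_Aut A F"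
    unfolding Kstar_Aut_def
  proof (intro CollectI conjI)
    show "(\<lambda>x\<in>L. x) \<in> Bij L" by (rule id_Bij)
    show "limit_morphism A F (\<lambda>x\<in>L. x)" using limit_morphism_id by (rule limit_morphism_cong) simp
    show "limit_morphism A F (inv_into L (\<lambda>x\<in>L. x))"
      using limit_morphism_id by (rule limit_morphism_cong) (rule id_inv)
  qed
  show "compose L g h \<in> Kstar_Aut A F" if gh: "g \<in> Kstar_Aut A F" "h \<in> Kstar_Aut A F" for g h
    unfolding Kstar_Aut_def
  proof (intro CollectI conjI)
    note g = Aut_D[OF gh(1)] and h = Aut_D[OF gh(2)]
    show B: "compose L g h \<in> Bij L" using g(1) h(1) by (rule compose_Bij)
    show "limit_morphism A F (compose L g h)"
      using limit_morphism_compose[OF g(2) h(2) h(5)] by (rule limit_morphism_cong) (simp add: compose_def)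
    have inv: "inv_into L (compose L g h) x = inv_into L h (inv_into L g x)" if "x \<in> L" for x
    proof (rule inv_into_f_eq)
      show "inj_on (compose L g h) L" using B by (simp add: Bij_def bij_betw_def)
      have gx: "inv_into L g x \<in> L" using g(6) that by blast
      then show "inv_into L h (inv_into L g x) \<in> L" using h(6) by blast
      then show "compose L g h (inv_into L h (inv_into L g x)) = x"
        using bij_betw_inv_into_right[OF h(4) gx] bij_betw_inv_into_right[OF g(4) that]
        by (simp add: compose_def)
    qed
    show "limit_morphism A F (inv_into L (compose L g h))"
      using limit_morphism_compose[OF h(3) g(3) g(6)] by (rule limit_morphism_cong) (rule inv)
  qed
  show "restrict (inv_into L g) L \<in> Kstar_Aut A F" if "g \<in> Kstar_Aut A F" for g
    unfolding Kstar_Aut_def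
  proof (intro CollectI conjI)
    note g = Aut_D[OF that]
    show B: "restrict (inv_into L g) L \<in> Bij L" using g(1) by (rule restrict_inv_into_Bij)
    show "limit_morphism A F (restrict (inv_into L g) L)"
      using g(3) by (rule limit_morphism_cong) simp
    have inv: "inv_into L (restrict (inv_into L g) L) x = g x" if "x \<in> L" for x
    proof (rule inv_into_f_eq)
      show "inj_on (restrict (inv_into L g) L) L" using B by (simp add: Bij_def bij_betw_def)
      show gx: "g x \<in> L" using g(5) that by blast
      then show "restrict (inv_into L g) L (g x) = x"
        using bij_betw_inv_into_left[OF g(4) that] by simp
    qed
    show "limit_morphism A F (inv_into L (restrict (inv_into L g) L))"
      using g(2) by (rule limit_morphism_cong) (rule inv)
  qed
qed

lemma Aut_homeos: "Kstar_Aut A F \<subseteq> homeos (Kstar_limit A F)"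
proof
  fix g assume "g \<in> Kstar_Aut A F"
  note g = Aut_D[OF this]
  show "g \<in> homeos (Kstar_limit A F)"
    using g(1) limit_morphism_continuous[OF g(2,5)] limit_morphism_continuous[OF g(3,6)]
    unfolding homeos_iff by blast
qed

lemma compact_limit: "compact_space (Kstar_limit A F)"
  unfolding Kstar_limit_def
proof (rule compact_inverse_limit)
  show "continuous_map (discrete_topology {..<fst (A (Suc n))}) (discrete_topology {..<fst (A n)}) (F n)" for n
    using Kstar_morphism_less[OF bonding] by (auto simp: continuous_map_from_discrete_topology)
qed (auto simp: compact_space_discrete_topology Hausdorff_space_discrete_topology)

text \<open>The closed relations of having equal \<open>n\<close>-th coordinates decrease to the diagonal, so one of
  them avoids the closed set of pairs at distance at least \<open>\<epsilon>\<close>.\<close>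

lemma coordinate_controls_distance:
  assumes m: "mtopology_of m = Kstar_limit A F" and "\<epsilon> > 0"
  shows "\<exists>n. \<forall>x\<in>L. \<forall>y\<in>L. x n = y n \<longrightarrow> mdist m x y < \<epsilon>"
proof -
  let ?X = "Kstar_limit A F"
  have S: "mspace m = L" using m by (metis topspace_mtopology_of)
  define R where "R n = {z \<in> topspace (prod_topology ?X ?X). fst z n = snd z n}" for n
  define Q where "Q = {z \<in> L \<times> L. \<epsilon> \<le> mdist m (fst z) (snd z)}"
  have proj: "continuous_map ?X (discrete_topology {..<fst (A n)}) (\<lambda>x. x n)" for n
    unfolding Kstar_limit_def by (rule continuous_map_projection)
  have "closedin (prod_topology ?X ?X) (R n)" for n unfolding R_def
  proof (rule closedin_continuous_maps_eq)
    show "Hausdorff_space (discrete_topology {..<fst (A n)})" by simp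
    show "continuous_map (prod_topology ?X ?X) (discrete_topology {..<fst (A n)}) (\<lambda>z. fst z n)"
      using continuous_map_compose[OF continuous_map_fst proj] by (simp add: o_def)
    show "continuous_map (prod_topology ?X ?X) (discrete_topology {..<fst (A n)}) (\<lambda>z. snd z n)"
      using continuous_map_compose[OF continuous_map_snd proj] by (simp add: o_def)
  qed
  moreover have "decseq R"
  proof (rule decseq_SucI, rule subsetI)
    fix n z assume "z \<in> R (Suc n)"
    then have z: "fst z \<in> L" "snd z \<in> L" "fst z (Suc n) = snd z (Suc n)" by (auto simp: R_def)
    have "fst z n = F n (fst z (Suc n))" "snd z n = F n (snd z (Suc n))" using z(1,2) L_iff by blast+
    then have "fst z n = snd z n" using z(3) by (simp only:)
    then show "z \<in> R n" using z by (simp add: R_def mem_Times_iff)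
  qed
  moreover have "closedin (prod_topology ?X ?X) Q"
    using closedin_far_pairs[of m \<epsilon>] unfolding m S Q_def .
  moreover have "(\<Inter>n. R n) \<inter> Q = {}"
  proof -
    have "mdist m (fst z) (snd z) = 0" if "z \<in> (\<Inter>n. R n)" for z
    proof -
      have "fst z n = snd z n" for n using that by (auto simp: R_def)
      then have "fst z = snd z" by blast
      moreover have "snd z \<in> mspace m" using that S by (auto simp: R_def)
      ultimately show ?thesis by (simp add: Metric_space.mdist_zero)
    qed
    then show ?thesis using \<open>\<epsilon> > 0\<close> by (force simp: Q_def)
  qed
  ultimately obtain n where n: "R n \<inter> Q = {}"
    using closed_relations_meet[OF compact_limit, of R Q] by blast
  have "mdist m x y < \<epsilon>" if "x \<in> L" "y \<in> L" "x n = y n" for x y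
  proof (rule ccontr)
    assume "\<not> ?thesis"
    then have "(x, y) \<in> R n \<inter> Q" using that by (simp add: R_def Q_def)
    then show False using n by blast
  qed
  then show ?thesis by blast
qed

text \<open>Up to \<open>\<epsilon>\<close>, an automorphism is a morphism \<open>A N \<rightarrow> A n\<close> applied to the
  coordinate \<open>N\<close>. Take a long path \<open>C\<close> with the weight of \<open>A N\<close>, and a morphism \<open>u\<close> onto it from a
  member of the sequence. The morphisms \<open>C \<rightarrow> A n\<close> correspond to the \<open>l\<close>-subsets \<open>T\<close> of
  the edges of \<open>C\<close>, all realised, after \<open>u\<close>, by automorphisms \<open>h T\<close>, and the morphisms
  \<open>C \<rightarrow> A N\<close> to the \<open>(b - 1)\<close>-subsets. Ramsey's theorem gives a set \<open>B\<close> of the latter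
  size all of whose \<open>l\<close>-subsets \<open>T\<close> have the same colour \<open>c (h T)\<close>. Let \<open>\<kappa>\<close> realise \<open>B\<close>.
  Then \<open>g \<kappa>\<close> is described by the composite of the morphism of \<open>B\<close> with that of \<open>g\<close>, whose
  walk can only move where the first one does: it belongs to an \<open>l\<close>-subset of \<open>B\<close>.\<close>

theorem Aut_oscillation_stable:
  assumes m: "mtopology_of m = Kstar_limit A F"
  shows "oscillation_stable m (Kstar_Aut A F)"
  unfolding oscillation_stable_def
proof (intro allI impI, elim conjE)
  let ?H = "Kstar_Aut A F"
  fix \<epsilon> :: real and G and c :: "((nat \<Rightarrow> nat) \<Rightarrow> (nat \<Rightarrow> nat)) \<Rightarrow> nat"
  assume e: "\<epsilon> > 0" and G: "finite G" "G \<subseteq> ?H" and c: "finite (c ` ?H)"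
  have S: "mspace m = L" using m by (metis topspace_mtopology_of)
  obtain n where n: "\<And>x y. x \<in> L \<Longrightarrow> y \<in> L \<Longrightarrow> x n = y n \<Longrightarrow> mdist m x y < \<epsilon>"
    using coordinate_controls_distance[OF m e] by blast
  show "\<exists>k\<in>?H. \<exists>i. \<forall>g\<in>G. \<exists>h\<in>?H. c h = i \<and> (\<forall>x\<in>mspace m. mdist m (g (k x)) (h x) \<le> \<epsilon>)"
  proof (cases "G = {}")
    case True
    have "(\<lambda>x\<in>L. x) \<in> ?H" using Aut_group unfolding permutation_group_def by blast
    then show ?thesis using True by blast
  next
    case False
    have "\<exists>N \<phi>. Kstar_morphism (A N) (A n) \<phi> \<and> (\<forall>x\<in>L. g x n = \<phi> (x N))" if "g \<in> G" for g
    proof -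
      have "limit_morphism A F g" using that G(2) Aut_D(2) by blast
      then show ?thesis unfolding limit_morphism_def by blast
    qed
    then obtain Ng \<phi>0 where \<phi>0: "\<And>g. g \<in> G \<Longrightarrow> Kstar_morphism (A (Ng g)) (A n) (\<phi>0 g)"
      "\<And>g x. g \<in> G \<Longrightarrow> x \<in> L \<Longrightarrow> g x n = \<phi>0 g (x (Ng g))" by metis
    \<comment> \<open>one level \<open>N\<close> that serves all \<open>g\<close> in \<open>G\<close>\<close>
    define N where "N = Max (Ng ` G)"
    have Ng: "Ng g \<le> N" if "g \<in> G" for g using that G(1) by (simp add: N_def)
    define \<phi> where "\<phi> g v = \<phi>0 g (bond F (Ng g) N v)" for g v
    have \<phi>: "Kstar_morphism (A N) (A n) (\<phi> g)" "\<And>x. x \<in> L \<Longrightarrow> g x n = \<phi> g (x N)" if "g \<in> G" for g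
    proof -
      show "Kstar_morphism (A N) (A n) (\<phi> g)" unfolding \<phi>_def
        by (rule Kstar_morphism_compose[OF bond_morphism[OF Ng[OF that]] \<phi>0(1)[OF that]])
      show "g x n = \<phi> g (x N)" if x: "x \<in> L" for x
        unfolding \<phi>_def thread[OF x Ng[OF \<open>g \<in> G\<close>]] by (rule \<phi>0(2)[OF \<open>g \<in> G\<close> x])
    qed
    define a b where "a = fst (A n)" and "b = fst (A N)"
    have ab: "a \<ge> 2" "b \<ge> 2" "snd (A n) > 0" "snd (A N) > 0"
      using object[of n] object[of N] unfolding Kstar_object_def a_def b_def by blast+
    have "\<exists>k s. K_walk b a k (\<phi> g) s \<and> of_nat k = snd (A N) / snd (A n)" if "g \<in> G" for g
      using \<phi>(1)[OF that] unfolding Kstar_morphism_iff_walk a_def b_def by blast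
    then obtain kg sg where kg: "\<And>g. g \<in> G \<Longrightarrow> K_walk b a (kg g) (\<phi> g) (sg g)"
      "\<And>g. g \<in> G \<Longrightarrow> of_nat (kg g) = snd (A N) / snd (A n)" by metis
    obtain g0 where g0: "g0 \<in> G" using False by blast
    \<comment> \<open>the weights determine the degree, so all \<open>\<phi> g\<close> have the same number \<open>k\<close> of laps\<close>
    define k where "k = kg g0"
    have k: "of_nat k = snd (A N) / snd (A n)" using kg(2)[OF g0] by (simp add: k_def)
    have s: "K_walk b a k (\<phi> g) (sg g)" if "g \<in> G" for g
    proof -
      have "of_nat (kg g) = (of_nat k :: rat)" using kg(2)[OF that] k by simp
      then have "kg g = k" by (rule of_nat_eq_iff[THEN iffD1])
      then show ?thesis using kg(1)[OF that] by simp
    qed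
    have k1: "k \<ge> 1" using s[OF g0] unfolding K_walk_def by blast
    define l where "l = k * (a - 1)"
    obtain t where t: "\<And>h. h \<in> ?H \<Longrightarrow> c h < t"
      using c unfolding finite_nat_set_iff_bounded by blast
    obtain N0 :: nat where ramsey: "\<And>c :: nat set \<Rightarrow> nat. (\<And>T. T \<in> nsets {..<N0} l \<Longrightarrow> c T < t) \<Longrightarrow>
        \<exists>B col. B \<in> nsets {..<N0} (b - 1) \<and> (\<forall>T\<in>nsets B l. c T = col)"
      using ramsey_sets[of l t "b - 1"] by blast
    \<comment> \<open>\<open>Suc N0\<close> rather than \<open>N0\<close> edges, so that \<open>C\<close> has at least two vertices\<close>
    define K where "K = Suc N0"
    define C where "C = (Suc K, snd (A N))"
    have C: "Kstar_object C" "fst C = Suc K" "snd C = snd (A N)" using ab by (simp_all add: C_def Kstar_object_def K_def)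
    obtain M u where u: "Kstar_morphism (A M) C u" using cofinal[OF C(1)] by blast
    have uless: "u (x M) < Suc K" if "x \<in> L" for x
      using Kstar_morphism_less[OF u L_less[OF that]] C(2) by simp
    define \<theta> where "\<theta> T v = fold_path (a - 1) (jump_count T v)" for T v
    have \<theta>: "Kstar_morphism C (A n) (\<theta> T)" if "T \<in> nsets {..<N0} l" for T
    proof -
      have T: "T \<subseteq> {..<K}" "card T = l" using that by (auto simp: nsets_def K_def)
      have "K_walk (Suc K) a k (\<theta> T) (jump_count T)"
        unfolding K_walk_def using walk_jump_count[OF T(1)] ab k1 T(2) by (simp add: l_def K_def \<theta>_def)
      then show ?thesis unfolding Kstar_morphism_iff_walk
        using C object[of n] k by (auto simp: a_def)
    qed
    have "\<exists>h. h \<in> ?H \<and> (\<forall>x\<in>L. h x n = \<theta> T (u (x M)))" if "T \<in> nsets {..<N0} l" for T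
      using ultrahomogeneous[OF Kstar_morphism_compose[OF u \<theta>[OF that]]] by blast
    then obtain h where h: "\<And>T. T \<in> nsets {..<N0} l \<Longrightarrow> h T \<in> ?H"
      "\<And>T x. T \<in> nsets {..<N0} l \<Longrightarrow> x \<in> L \<Longrightarrow> h T x n = \<theta> T (u (x M))" by metis
    obtain B col where B: "B \<in> nsets {..<N0} (b - 1)" "\<And>T. T \<in> nsets B l \<Longrightarrow> c (h T) = col"
      using ramsey[of "\<lambda>T. c (h T)"] t h(1) by blast
    have B': "B \<subseteq> {..<K}" "B \<subseteq> {..<N0}" "card B = b - 1" "finite B" using B(1) by (auto simp: nsets_def K_def)
    define \<psi> where "\<psi> v = fold_path (b - 1) (jump_count B v)" for v
    have \<psi>w: "K_walk (Suc K) b 1 \<psi> (jump_count B)"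
      unfolding K_walk_def using walk_jump_count[OF B'(1)] ab B'(3) by (simp add: K_def \<psi>_def)
    then have "Kstar_morphism C (A N) \<psi>" unfolding Kstar_morphism_iff_walk
      using C object[of N] ab by (intro conjI exI[of _ 1] exI[of _ "jump_count B"]) (auto simp: b_def)
    from ultrahomogeneous[OF Kstar_morphism_compose[OF u this]]
    obtain \<kappa> where \<kappa>: "\<kappa> \<in> ?H" "\<And>x. x \<in> L \<Longrightarrow> \<kappa> x N = \<psi> (u (x M))" by blast
    have "\<exists>h\<in>?H. c h = col \<and> (\<forall>x\<in>mspace m. mdist m (g (\<kappa> x)) (h x) \<le> \<epsilon>)" if g: "g \<in> G" for g
    proof -
      define s' where "s' v = unfold_walk (b - 1) (k * (a - 1)) (sg g) (jump_count B v)" for v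
      have w: "K_walk (Suc K) a (1 * k) (\<lambda>v. \<phi> g (\<psi> v)) s'"
        using K_walk_compose[OF \<psi>w s[OF g]] unfolding s'_def .
      then have walk: "walk (Suc K) l s'" unfolding K_walk_def l_def by simp
      define T where "T = {v. v < K \<and> s' (Suc v) \<noteq> s' v}"
      have "v \<in> B" if "s' (Suc v) \<noteq> s' v" for v
        using that unfolding s'_def jump_count_Suc by (metis (full_types))
      then have "T \<subseteq> B" by (auto simp: T_def)
      moreover have "card T = l" unfolding T_def by (rule walk_eq_jump_count(2)[OF walk])
      ultimately have TB: "T \<in> nsets B l" using B'(4) by (auto simp: nsets_def intro: finite_subset)
      then have T: "T \<in> nsets {..<N0} l" using nsets_mono[OF B'(2)] by blast
      have agree: "g (\<kappa> x) n = h T x n" if x: "x \<in> L" for x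
      proof -
        have \<kappa>x: "\<kappa> x \<in> L" using Aut_D(5)[OF \<kappa>(1)] x by blast
        define v where "v = u (x M)"
        have v: "v < Suc K" using uless[OF x] by (simp add: v_def)
        have "g (\<kappa> x) n = \<phi> g (\<psi> v)" using \<phi>(2)[OF g \<kappa>x] \<kappa>(2)[OF x] by (simp add: v_def)
        also have "\<dots> = fold_path (a - 1) (s' v)" using w v unfolding K_walk_def by blast
        also have "s' v = jump_count T v"
          unfolding T_def using walk_eq_jump_count(1)[OF walk] v by simp
        also have "fold_path (a - 1) (jump_count T v) = h T x n"
          using h(2)[OF T x] by (simp add: \<theta>_def v_def)
        finally show ?thesis .
      qed
      have "mdist m (g (\<kappa> x)) (h T x) \<le> \<epsilon>" if x: "x \<in> mspace m" for x
      proof -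
        have xL: "x \<in> L" using x S by simp
        have "g (\<kappa> x) \<in> L" "h T x \<in> L"
          using Aut_D(5)[OF \<kappa>(1)] Aut_D(5)[OF h(1)[OF T]] Aut_D(5)[of g] g G(2) xL by blast+
        from n[OF this agree[OF xL]] show ?thesis by simp
      qed
      then show ?thesis using h(1)[OF T] B(2)[OF TB] by blast
    qed
    then show ?thesis using \<kappa>(1) by blast
  qed
qed

theorem Aut_extremely_amenable:
  assumes m: "mtopology_of m = Kstar_limit A F"
  shows "extremely_amenable TYPE('x) (perm_group (mspace m) (Kstar_Aut A F))
           (uniform_topology m (Kstar_Aut A F))"
proof -
  have S: "mspace m = L" using m by (metis topspace_mtopology_of)
  interpret compact_metric_homeos m "Kstar_Aut A F"
    by unfold_locales (use m S compact_limit Aut_homeos Aut_group in simp_all)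
  show ?thesis by (rule extremely_amenable_if_oscillation_stable[OF Aut_oscillation_stable[OF m]])
qed

end

section \<open>Inverse limits of tent maps\<close>

text \<open>Folding the argument of an equivariant map changes its value only by reflections in
  multiples of \<open>b\<close>, which \<open>zig\<close> undoes.\<close>

lemma zig_equivariant:
  assumes H: "equivariant a (real k * b) H" and "a \<noteq> 0" "b \<noteq> 0"
  shows "zig (H (a * zig (x / a)) / b) = zig (H x / b)"
proof -
  define u where "u = zig (x / a)"
  obtain z :: int where "x / a = u + 2 * of_int z \<or> x / a = - u + 2 * of_int z"
    using zig_repr u_def by metis
  then have "x = a * u + 2 * a * of_int z \<or> x = - (a * u) + 2 * a * of_int z"
    using assms by (auto simp: field_simps)
  then have "H x = H (a * u) + 2 * (real k * b) * of_int z \<or> H x = - H (a * u) + 2 * (real k * b) * of_int z"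
    using equivariant_int[OF H, of _ z] equivariant_minus[OF H] by metis
  then have "H x / b = H (a * u) / b + 2 * of_int (int k * z) \<or> H x / b = - (H (a * u) / b) + 2 * of_int (int k * z)"
    using assms by (auto simp: field_simps)
  then show ?thesis unfolding u_def[symmetric] by (rule zig_congruent[symmetric])
qed

lemma zig_mult: "zig (real k * zig y) = zig (real k * y)"
proof -
  have "equivariant 1 (real k * 1) (\<lambda>x. real k * x)"
    using equivariant_scale[of 1 "real k"] by simp
  from zig_equivariant[OF this, of y] show ?thesis by simp
qed

text \<open>Near \<open>H x\<close> the triangle wave takes all values close to \<open>zig (H x)\<close>, but at an end of the
  interval the preimage may fall outside; it is then reflected back.\<close>

lemma zig_lift_open:
  assumes H: "lift 1 (real k) H" and x: "0 \<le> x" "x \<le> 1" and \<delta>: "\<delta> > 0"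
  shows "\<exists>e>0. \<forall>u. 0 \<le> u \<longrightarrow> u \<le> 1 \<longrightarrow> \<bar>u - zig (H x)\<bar> < e \<longrightarrow>
           (\<exists>y. 0 \<le> y \<and> y \<le> 1 \<and> \<bar>y - x\<bar> \<le> \<delta> \<and> zig (H y) = u)"
proof -
  let ?I = "Hilbert_Choice.inv H"
  have "continuous_on UNIV ?I" using lift_continuous[OF lift_inv[OF H]] .
  then obtain e where e: "e > 0" "\<And>w. \<bar>w - H x\<bar> < e \<Longrightarrow> \<bar>?I w - ?I (H x)\<bar> < \<delta>"
    using \<delta> unfolding continuous_on_iff dist_real_def by (metis UNIV_I)
  have "\<exists>y. 0 \<le> y \<and> y \<le> 1 \<and> \<bar>y - x\<bar> \<le> \<delta> \<and> zig (H y) = u"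
    if u: "0 \<le> u" "u \<le> 1" "\<bar>u - zig (H x)\<bar> < e" for u
  proof -
    define v where "v = zig (H x)"
    obtain z :: int where z: "H x = v + 2 * of_int z \<or> H x = - v + 2 * of_int z"
      using zig_repr v_def by metis
    obtain w where w: "w = u + 2 * of_int z \<or> w = - u + 2 * of_int z" "\<bar>w - H x\<bar> = \<bar>u - v\<bar>"
    proof (cases "H x = v + 2 * of_int z")
      case True
      then show ?thesis by (intro that[of "u + 2 * of_int z"]) simp_all
    next
      case False
      then have "H x = - v + 2 * of_int z" using z by blast
      then show ?thesis by (intro that[of "- u + 2 * of_int z"]) simp_all
    qed
    define y where "y = ?I w"
    have "\<bar>y - x\<bar> < \<delta>" using e(2)[of w] w(2) u(3) lift_inv_simps[OF H] by (simp add: y_def v_def)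
    moreover have "\<bar>zig y - zig x\<bar> \<le> \<bar>y - x\<bar>" by (rule zig_lipschitz)
    ultimately have "\<bar>zig y - x\<bar> \<le> \<delta>" using x by simp
    moreover have "zig (H (zig y)) = u"
    proof -
      have "zig (H (1 * zig (y / 1)) / 1) = zig (H y / 1)"
        using H by (intro zig_equivariant[of 1 k 1 H]) (simp_all add: lift_def)
      then have "zig (H (zig y)) = zig (H y)" by simp
      also have "H y = w" using lift_inv_simps[OF H] by (simp add: y_def)
      also have "zig w = u" using zig_unique[OF u(1,2) w(1)] .
      finally show ?thesis .
    qed
    ultimately show ?thesis using zig_range[of y] by blast
  qed
  then show ?thesis using e(1) by blast
qed

lemma openin_unit_intervalI:
  assumes "S \<subseteq> {0..1}"
    and "\<And>v. v \<in> S \<Longrightarrow> \<exists>e>0. \<forall>u. 0 \<le> u \<longrightarrow> u \<le> 1 \<longrightarrow> \<bar>u - v\<bar> < e \<longrightarrow> u \<in> S"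
  shows "openin unit_interval S"
  unfolding openin_euclidean_subtopology_iff dist_real_def
  using assms by (meson atLeastAtMost_iff)

lemma openin_unit_intervalD:
  assumes "openin unit_interval S" "v \<in> S"
  shows "\<exists>e>0. \<forall>u. 0 \<le> u \<longrightarrow> u \<le> 1 \<longrightarrow> \<bar>u - v\<bar> < e \<longrightarrow> u \<in> S"
  using assms unfolding openin_euclidean_subtopology_iff dist_real_def
  by (meson atLeastAtMost_iff)

lemma pointed_open_map_zig_lift:
  assumes H: "lift 1 (real k) H"
  shows "pointed_open_map (\<lambda>x. zig (H x))"
  unfolding pointed_open_map_def
proof (intro conjI)
  have "continuous_on {0..1} (\<lambda>x. zig (H x))"
    by (rule continuous_on_zig[OF lift_continuous[OF H]])
  then show "continuous_map unit_interval unit_interval (\<lambda>x. zig (H x))"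
    using zig_range by (auto simp: continuous_map_in_subtopology image_subset_iff)
  show "zig (H 0) = 0" using lift_0[OF H] by simp
  show "open_map unit_interval unit_interval (\<lambda>x. zig (H x))"
    unfolding open_map_def
  proof (intro allI impI)
    fix U assume U: "openin unit_interval U"
    then have U01: "U \<subseteq> {0..1}" by (rule openin_imp_subset)
    show "openin unit_interval ((\<lambda>x. zig (H x)) ` U)"
    proof (rule openin_unit_intervalI)
      show "(\<lambda>x. zig (H x)) ` U \<subseteq> {0..1}" using zig_range by auto
      fix v assume "v \<in> (\<lambda>x. zig (H x)) ` U"
      then obtain x where x: "x \<in> U" "v = zig (H x)" by blast
      have x01: "0 \<le> x" "x \<le> 1" using x U01 by auto
      obtain \<delta> where \<delta>: "\<delta> > 0" "\<And>y. 0 \<le> y \<Longrightarrow> y \<le> 1 \<Longrightarrow> \<bar>y - x\<bar> < \<delta> \<Longrightarrow> y \<in> U"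
        using openin_unit_intervalD[OF U x(1)] by blast
      have "\<delta> / 2 > 0" using \<delta>(1) by simp
      from zig_lift_open[OF H x01 this] obtain e where e: "e > 0"
        "\<And>u. 0 \<le> u \<Longrightarrow> u \<le> 1 \<Longrightarrow> \<bar>u - zig (H x)\<bar> < e \<Longrightarrow>
           \<exists>y. 0 \<le> y \<and> y \<le> 1 \<and> \<bar>y - x\<bar> \<le> \<delta> / 2 \<and> zig (H y) = u" by blast
      have "u \<in> (\<lambda>x. zig (H x)) ` U" if u: "0 \<le> u" "u \<le> 1" "\<bar>u - v\<bar> < e" for u
      proof -
        obtain y where y: "0 \<le> y" "y \<le> 1" "\<bar>y - x\<bar> \<le> \<delta> / 2" "zig (H y) = u"
          using e(2)[OF u(1,2)] u(3) x(2) by blast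
        then have "y \<in> U" using \<delta> by (intro \<delta>(2)) auto
        then show ?thesis using y(4) by blast
      qed
      then show "\<exists>e>0. \<forall>u. 0 \<le> u \<longrightarrow> u \<le> 1 \<longrightarrow> \<bar>u - v\<bar> < e \<longrightarrow> u \<in> (\<lambda>x. zig (H x)) ` U"
        using e(1) by blast
    qed
  qed
qed

locale tent_limit =
  fixes X :: "'k topology" and d :: "nat \<Rightarrow> nat" and \<pi> :: "'k \<Rightarrow> nat \<Rightarrow> real"
  assumes presentation: "tent_presentation X d \<pi>"
begin

abbreviation "Y \<equiv> inverse_limit (\<lambda>n. unit_interval) (\<lambda>n. tent_map (d n))"

text \<open>The degree of the composite bonding map from level \<open>n\<close> to level \<open>0\<close>. The number
  \<open>D n * \<pi> x n\<close> is referred to as the time of \<open>x\<close> at level \<open>n\<close>: measured in time, all bonding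
  maps are foldings without dilation, so that a single map of the line can act on all levels at
  once.\<close>

definition D :: "nat \<Rightarrow> nat" where
  "D n = (\<Prod>i<n. d i)"

lemma d_pos: "d n > 0"
  using presentation unfolding tent_presentation_def by (meson less_le_trans zero_less_one)

lemma D_0 [simp]: "D 0 = 1" and D_Suc: "D (Suc n) = d n * D n"
  by (simp_all add: D_def mult.commute)

lemma D_pos: "D n > 0"
  unfolding D_def using d_pos by (intro prod_pos) blast

lemma D_real_pos [simp]: "real (D n) > 0"
  using D_pos by simp

lemma D_dvd: "n \<le> m \<Longrightarrow> D n dvd D m"
proof (induction m)
  case (Suc m)
  then show ?case by (cases "n = Suc m") (auto simp: D_Suc)
qed simp

lemma D_ratio:
  assumes "n \<le> m"
  obtains r where "r > 0" "D m = r * D n" "real (D m) / real (D n) = real r"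
proof -
  obtain r where r: "D m = D n * r" using D_dvd[OF assms] by (elim dvdE)
  then have "r > 0" using D_pos[of m] by (cases r) auto
  moreover have "real (D m) / real (D n) = real r" using D_pos[of n] unfolding r by simp
  ultimately show ?thesis using r by (intro that[of r]) simp_all
qed

lemma homeo: "homeomorphic_map X Y \<pi>"
  using presentation unfolding tent_presentation_def by blast

lemma Y_iff: "y \<in> topspace Y \<longleftrightarrow> (\<forall>n. 0 \<le> y n \<and> y n \<le> 1) \<and> (\<forall>n. y n = zig (real (d n) * y (Suc n)))"
  by (simp add: topspace_inverse_limit tent_map_zig)

lemma \<pi>_Y: "x \<in> topspace X \<Longrightarrow> \<pi> x \<in> topspace Y"
  using homeo homeomorphic_imp_surjective_map by blast

lemma \<pi>_range: "x \<in> topspace X \<Longrightarrow> 0 \<le> \<pi> x n" "x \<in> topspace X \<Longrightarrow> \<pi> x n \<le> 1"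
  using \<pi>_Y Y_iff by blast+

lemma \<pi>_eqI: "x \<in> topspace X \<Longrightarrow> y \<in> topspace X \<Longrightarrow> (\<And>n. \<pi> x n = \<pi> y n) \<Longrightarrow> x = y"
  using homeomorphic_imp_injective_map[OF homeo] by (meson ext inj_onD)

lemma \<pi>_onto: "y \<in> topspace Y \<Longrightarrow> \<exists>x\<in>topspace X. \<pi> x = y"
  using homeomorphic_imp_surjective_map[OF homeo] by (metis imageE)

text \<open>The composite of tent maps is a tent map whose degree is the product of the degrees.\<close>

lemma \<pi>_zig:
  assumes x: "x \<in> topspace X" and "n \<le> m"
  shows "\<pi> x n = zig (real (D m) * \<pi> x m / real (D n))"
  using assms(2)
proof (induction m)
  case 0
  then show ?case using \<pi>_range[OF x] by simp
next
  case (Suc m)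
  show ?case
  proof (cases "n = Suc m")
    case True
    then show ?thesis using \<pi>_range[OF x] D_pos[of n] by simp
  next
    case False
    then have nm: "n \<le> m" using Suc by simp
    then obtain r where r: "real (D m) / real (D n) = real r" using D_ratio by blast
    have "real (D m) * \<pi> x m / real (D n) = real (D m) / real (D n) * \<pi> x m" by simp
    then have "\<pi> x n = zig (real r * \<pi> x m)" unfolding r using Suc.IH[OF nm] by (simp only:)
    also have "\<pi> x m = zig (real (d m) * \<pi> x (Suc m))" using \<pi>_Y[OF x] Y_iff by blast
    also have "zig (real r * zig (real (d m) * \<pi> x (Suc m))) = zig (real r * (real (d m) * \<pi> x (Suc m)))"
      by (rule zig_mult)
    also have "real r * (real (d m) * \<pi> x (Suc m)) = real (D (Suc m)) * \<pi> x (Suc m) / real (D n)"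
      unfolding r[symmetric] D_Suc by simp
    finally show ?thesis .
  qed
qed

text \<open>Folding a time \<open>t\<close> at every level gives a compatible sequence. This provides points with any
  prescribed coordinate.\<close>

lemma \<pi>_thread_point: "\<exists>x\<in>topspace X. \<forall>m. \<pi> x m = zig (t / real (D m))"
proof -
  have "(\<lambda>m. zig (t / real (D m))) \<in> topspace Y"
    unfolding Y_iff
  proof (intro conjI allI)
    fix m
    show "0 \<le> zig (t / real (D m))" "zig (t / real (D m)) \<le> 1" by (rule zig_range)+
    have "real (d m) * (t / real (D (Suc m))) = t / real (D m)"
      using d_pos[of m] unfolding D_Suc by simp
    then show "zig (t / real (D m)) = zig (real (d m) * zig (t / real (D (Suc m))))"
      by (simp only: zig_mult)
  qed
  from \<pi>_onto[OF this] obtain x where "x \<in> topspace X" "\<pi> x = (\<lambda>m. zig (t / real (D m)))"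
    by blast
  then show ?thesis by (intro bexI[of _ x]) simp_all
qed

lemma \<pi>_surj:
  assumes "0 \<le> v" "v \<le> 1"
  shows "\<exists>x\<in>topspace X. \<pi> x n = v"
proof -
  obtain x where x: "x \<in> topspace X" "\<forall>m. \<pi> x m = zig (real (D n) * v / real (D m))"
    using \<pi>_thread_point[of "real (D n) * v"] by blast
  have "real (D n) * v / real (D n) = v" using D_pos[of n] by simp
  then have "\<pi> x n = v" using x(2) assms by simp
  then show ?thesis using x(1) by blast
qed

lemma \<pi>_lipschitz:
  assumes "x \<in> topspace X" "y \<in> topspace X" "n \<le> m"
  shows "real (D n) * \<bar>\<pi> x n - \<pi> y n\<bar> \<le> real (D m) * \<bar>\<pi> x m - \<pi> y m\<bar>"
proof -
  have "\<bar>\<pi> x n - \<pi> y n\<bar> \<le> \<bar>real (D m) * \<pi> x m / real (D n) - real (D m) * \<pi> y m / real (D n)\<bar>"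
    unfolding \<pi>_zig[OF assms(1,3)] \<pi>_zig[OF assms(2,3)] by (rule zig_lipschitz)
  also have "\<dots> = \<bar>(real (D m) / real (D n)) * (\<pi> x m - \<pi> y m)\<bar>"
    by (simp add: right_diff_distrib)
  also have "\<dots> = real (D m) / real (D n) * \<bar>\<pi> x m - \<pi> y m\<bar>" by (simp add: abs_mult)
  finally have "real (D n) * \<bar>\<pi> x n - \<pi> y n\<bar> \<le> real (D n) * (real (D m) / real (D n) * \<bar>\<pi> x m - \<pi> y m\<bar>)"
    by (intro mult_left_mono) auto
  then show ?thesis using D_pos[of n] by simp
qed

lemma \<pi>_continuous: "continuous_map X unit_interval (\<lambda>x. \<pi> x n)"
proof -
  have "continuous_map X Y \<pi>" using homeo by (rule homeomorphic_imp_continuous_map)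
  from continuous_map_compose[OF this continuous_map_projection] show ?thesis by (simp add: o_def)
qed

lemma \<pi>_continuous_real: "continuous_map X euclideanreal (\<lambda>x. \<pi> x n)"
  using \<pi>_continuous continuous_map_into_fulltopology by blast

lemma compact_Hausdorff: "compact_space X" "Hausdorff_space X"
proof -
  have cont: "continuous_map unit_interval unit_interval (tent_map (d n))" for n
  proof -
    have "tent_map (d n) = (\<lambda>x. zig (real (d n) * x))" by (simp add: tent_map_zig fun_eq_iff)
    moreover have "continuous_on {0..1} (\<lambda>x. zig (real (d n) * x))" by (intro continuous_intros)
    ultimately show ?thesis using zig_range by (auto simp: continuous_map_in_subtopology)
  qed
  have "compact_space Y"
    by (rule compact_inverse_limit[OF _ _ cont]) (simp_all add: compact_space_subtopology Hausdorff_space_subtopology)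
  then show "compact_space X"
    using homeo homeomorphic_compact_space homeomorphic_map_imp_homeomorphic_space by blast
  have "Hausdorff_space Y" unfolding inverse_limit_def
    by (intro Hausdorff_space_subtopology) (simp add: Hausdorff_space_product_topology Hausdorff_space_subtopology)
  then show "Hausdorff_space X"
    using homeo homeomorphic_Hausdorff_space homeomorphic_map_imp_homeomorphic_space by blast
qed

text \<open>Closeness is measured in time, since distances in time do not increase under bonding maps;
  hence these relations decrease.\<close>

definition near :: "nat \<Rightarrow> ('k \<times> 'k) set" where
  "near n = {z \<in> topspace X \<times> topspace X.
     real (D n) * \<bar>\<pi> (fst z) n - \<pi> (snd z) n\<bar> \<le> 1 / real (Suc n)}"

lemma near_separates:
  assumes Q: "closedin (prod_topology X X) Q" and diag: "\<And>x. (x, x) \<notin> Q"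
  shows "\<exists>n0. \<forall>n\<ge>n0. near n \<inter> Q = {}"
proof -
  have "closedin (prod_topology X X) (near n)" for n
  proof -
    have "continuous_map (prod_topology X X) euclideanreal (\<lambda>z. \<pi> (fst z) n)"
      using continuous_map_compose[OF continuous_map_fst \<pi>_continuous_real] by (simp add: o_def)
    moreover have "continuous_map (prod_topology X X) euclideanreal (\<lambda>z. \<pi> (snd z) n)"
      using continuous_map_compose[OF continuous_map_snd \<pi>_continuous_real] by (simp add: o_def)
    ultimately have "continuous_map (prod_topology X X) euclideanreal
        (\<lambda>z. real (D n) * \<bar>\<pi> (fst z) n - \<pi> (snd z) n\<bar>)"
      by (intro continuous_intros)
    from closedin_continuous_map_preimage[OF this, of "{..1 / real (Suc n)}"]
    show ?thesis by (simp add: near_def)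
  qed
  moreover have dec: "decseq near"
  proof (rule decseq_SucI, rule subsetI)
    fix n z assume "z \<in> near (Suc n)"
    then have z: "fst z \<in> topspace X" "snd z \<in> topspace X"
      "real (D (Suc n)) * \<bar>\<pi> (fst z) (Suc n) - \<pi> (snd z) (Suc n)\<bar> \<le> 1 / real (Suc (Suc n))"
      unfolding near_def by auto
    have "real (D n) * \<bar>\<pi> (fst z) n - \<pi> (snd z) n\<bar> \<le> 1 / real (Suc (Suc n))"
      using \<pi>_lipschitz[OF z(1,2), of n "Suc n"] z(3) by linarith
    also have "\<dots> \<le> 1 / real (Suc n)" by (simp add: frac_le)
    finally show "z \<in> near n" using z(1,2) unfolding near_def by (simp add: mem_Times_iff)
  qed
  moreover have "(\<Inter>n. near n) \<inter> Q = {}"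
  proof -
    have "fst z = snd z" if "z \<in> (\<Inter>n. near n)" for z
    proof (rule \<pi>_eqI)
      have z: "z \<in> near n" for n using that by blast
      show X: "fst z \<in> topspace X" "snd z \<in> topspace X" using z[of 0] unfolding near_def by auto
      fix n
      have "real (D n) * \<bar>\<pi> (fst z) n - \<pi> (snd z) n\<bar> \<le> 1 / real (Suc m)" if "n \<le> m" for m
        using \<pi>_lipschitz[OF X that] z[of m] unfolding near_def by simp
      then have "\<exists>N. \<forall>m\<ge>N. real (D n) * \<bar>\<pi> (fst z) n - \<pi> (snd z) n\<bar> \<le> 1 / real (Suc m)" by blast
      moreover have "(\<lambda>m. 1 / real (Suc m)) \<longlonglongrightarrow> 0"
        using LIMSEQ_inverse_real_of_nat by (simp add: inverse_eq_divide)
      ultimately have "real (D n) * \<bar>\<pi> (fst z) n - \<pi> (snd z) n\<bar> \<le> 0"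
        using LIMSEQ_le_const by blast
      then have "\<bar>\<pi> (fst z) n - \<pi> (snd z) n\<bar> \<le> 0"
        using D_pos[of n] by (simp add: mult_le_0_iff)
      then show "\<pi> (fst z) n = \<pi> (snd z) n" by simp
    qed
    then show ?thesis using diag by (metis (no_types, lifting) IntE equals0I prod.collapse)
  qed
  ultimately obtain n where n: "near n \<inter> Q = {}"
    using closed_relations_meet[OF compact_Hausdorff(1), of near Q] Q by blast
  have "near n' \<inter> Q = {}" if "n' \<ge> n" for n'
    using decseqD[OF dec that] n by blast
  then show ?thesis by blast
qed

lemma nearI:
  assumes "x \<in> topspace X" "y \<in> topspace X" "\<bar>\<pi> x n - \<pi> y n\<bar> \<le> 1 / (real (Suc n) * real (D n))"
  shows "(x, y) \<in> near n"
proof -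
  have "real (D n) * \<bar>\<pi> x n - \<pi> y n\<bar> \<le> real (D n) * (1 / (real (Suc n) * real (D n)))"
    using assms(3) by (intro mult_left_mono) auto
  also have "\<dots> = 1 / real (Suc n)" using D_pos[of n] by simp
  finally show ?thesis using assms(1,2) by (simp add: near_def)
qed

lemma uniformly_controlled:
  assumes p: "continuous_map X euclideanreal p" and "\<epsilon> > 0"
  shows "\<exists>n0. \<forall>n\<ge>n0. \<exists>\<delta>>0. \<forall>x\<in>topspace X. \<forall>y\<in>topspace X. \<bar>\<pi> x n - \<pi> y n\<bar> \<le> \<delta> \<longrightarrow> \<bar>p x - p y\<bar> < \<epsilon>"
proof -
  define Q where "Q = {z \<in> topspace X \<times> topspace X. \<bar>p (fst z) - p (snd z)\<bar> \<ge> \<epsilon>}"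
  have "continuous_map (prod_topology X X) euclideanreal (\<lambda>z. p (fst z))"
    using continuous_map_compose[OF continuous_map_fst p] by (simp add: o_def)
  moreover have "continuous_map (prod_topology X X) euclideanreal (\<lambda>z. p (snd z))"
    using continuous_map_compose[OF continuous_map_snd p] by (simp add: o_def)
  ultimately have "continuous_map (prod_topology X X) euclideanreal (\<lambda>z. \<bar>p (fst z) - p (snd z)\<bar>)"
    by (intro continuous_intros)
  from closedin_continuous_map_preimage[OF this, of "{\<epsilon>..}"]
  have "closedin (prod_topology X X) Q" by (simp add: Q_def)
  moreover have "(x, x) \<notin> Q" for x using assms(2) by (simp add: Q_def)
  ultimately obtain n0 where n0: "\<And>n. n \<ge> n0 \<Longrightarrow> near n \<inter> Q = {}" using near_separates by blast
  have "\<bar>p x - p y\<bar> < \<epsilon>" if "n \<ge> n0" "x \<in> topspace X" "y \<in> topspace X"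
    "\<bar>\<pi> x n - \<pi> y n\<bar> \<le> 1 / (real (Suc n) * real (D n))" for n x y
  proof (rule ccontr)
    assume "\<not> ?thesis"
    then have "(x, y) \<in> near n \<inter> Q" using nearI[OF that(2-4)] that by (simp add: Q_def)
    then show False using n0[OF that(1)] by blast
  qed
  moreover have "1 / (real (Suc n) * real (D n)) > 0" for n using D_pos[of n] by simp
  ultimately show ?thesis by blast
qed

text \<open>A point \<open>x\<close> of an open \<open>U\<close> has a neighbourhood inside \<open>U\<close> that is described by the \<open>m\<close>-th
  coordinate alone, for some \<open>m \<ge> n\<close>, and the bonding map from level \<open>m\<close> to level \<open>n\<close> is open.\<close>

lemma \<pi>_open: "open_map X unit_interval (\<lambda>x. \<pi> x n)"
  unfolding open_map_def
proof (intro allI impI)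
  fix U assume U: "openin X U"
  then have UX: "U \<subseteq> topspace X" by (rule openin_subset)
  show "openin unit_interval ((\<lambda>x. \<pi> x n) ` U)"
  proof (rule openin_unit_intervalI)
    show "(\<lambda>x. \<pi> x n) ` U \<subseteq> {0..1}" using UX \<pi>_range by auto
    fix v assume "v \<in> (\<lambda>x. \<pi> x n) ` U"
    then obtain x where x: "x \<in> U" "v = \<pi> x n" by blast
    have xX: "x \<in> topspace X" using x UX by blast
    define Q where "Q = {x} \<times> (topspace X - U)"
    have "closedin (prod_topology X X) Q" unfolding Q_def
      using closedin_Hausdorff_singleton[OF compact_Hausdorff(2) xX] closedin_diff[OF closedin_topspace U]
      by (simp add: closedin_prod_Times_iff)
    moreover have "(y, y) \<notin> Q" for y using x(1) by (auto simp: Q_def)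
    ultimately obtain n0 where n0: "\<And>m. m \<ge> n0 \<Longrightarrow> near m \<inter> Q = {}" using near_separates by blast
    define m where "m = max n n0"
    have m: "m \<ge> n" "near m \<inter> Q = {}" using n0[of m] by (simp_all add: m_def)
    define \<delta> where "\<delta> = 1 / (real (Suc m) * real (D m))"
    have \<delta>: "\<delta> > 0" using D_pos[of m] by (simp add: \<delta>_def)
    have inU: "y \<in> U" if "y \<in> topspace X" "\<bar>\<pi> y m - \<pi> x m\<bar> \<le> \<delta>" for y
    proof (rule ccontr)
      assume "y \<notin> U"
      then have "(x, y) \<in> Q" using that(1) by (simp add: Q_def)
      moreover have "(x, y) \<in> near m" using nearI[OF xX that(1)] that(2) by (simp add: \<delta>_def abs_minus_commute)
      ultimately show False using m(2) by blast
    qed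
    obtain r where r: "r > 0" "real (D m) / real (D n) = real r" using D_ratio[OF m(1)] by blast
    have L: "lift 1 (real r) (\<lambda>w. real r * w)" using lift_scale[of "real r" 1] r(1) by simp
    have coord: "\<pi> y n = zig (real r * \<pi> y m)" if "y \<in> topspace X" for y
    proof -
      have "real (D m) * \<pi> y m / real (D n) = real (D m) / real (D n) * \<pi> y m" by simp
      then show ?thesis unfolding r(2) using \<pi>_zig[OF that m(1)] by (simp only:)
    qed
    obtain e where e: "e > 0" "\<And>u. 0 \<le> u \<Longrightarrow> u \<le> 1 \<Longrightarrow> \<bar>u - zig (real r * \<pi> x m)\<bar> < e \<Longrightarrow>
        \<exists>w. 0 \<le> w \<and> w \<le> 1 \<and> \<bar>w - \<pi> x m\<bar> \<le> \<delta> \<and> zig (real r * w) = u"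
      using zig_lift_open[OF L \<pi>_range(1)[OF xX] \<pi>_range(2)[OF xX] \<delta>] by blast
    have "u \<in> (\<lambda>x. \<pi> x n) ` U" if u: "0 \<le> u" "u \<le> 1" "\<bar>u - v\<bar> < e" for u
    proof -
      obtain w where w: "0 \<le> w" "w \<le> 1" "\<bar>w - \<pi> x m\<bar> \<le> \<delta>" "zig (real r * w) = u"
        using e(2)[OF u(1,2)] u(3) coord[OF xX] x(2) by auto
      obtain y where y: "y \<in> topspace X" "\<pi> y m = w" using \<pi>_surj[OF w(1,2)] by blast
      have "y \<in> U" using inU[OF y(1)] w(3) y(2) by simp
      moreover have "\<pi> y n = u" using coord[OF y(1)] y(2) w(4) by simp
      ultimately show ?thesis by blast
    qed
    then show "\<exists>e>0. \<forall>u. 0 \<le> u \<longrightarrow> u \<le> 1 \<longrightarrow> \<bar>u - v\<bar> < e \<longrightarrow> u \<in> (\<lambda>x. \<pi> x n) ` U"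
      using e(1) by blast
  qed
qed

end

section \<open>Laps of open maps of the interval\<close>

definition subdivides :: "(real \<Rightarrow> real) \<Rightarrow> nat \<Rightarrow> (nat \<Rightarrow> real) \<Rightarrow> bool" where
  "subdivides f n x \<longleftrightarrow> x 0 = 0 \<and> x n = 1 \<and>
     (\<forall>i<n. x i < x (Suc i) \<and> homeomorphic_map (top_of_set {x i..x (Suc i)}) unit_interval f)"

lemma interval_degree_altdef: "interval_degree f = (THE n. \<exists>x. subdivides f n x)"
  unfolding interval_degree_def subdivides_def ..

lemma homeomorphic_intervalD:
  fixes a b :: real
  assumes "homeomorphic_map (top_of_set {a..b}) unit_interval f"
  shows "continuous_on {a..b} f" "inj_on f {a..b}" "f ` {a..b} = {0..1}"
proof -
  have "continuous_map (top_of_set {a..b}) unit_interval f"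
    using assms by (rule homeomorphic_imp_continuous_map)
  then show "continuous_on {a..b} f" by (simp add: continuous_map_in_subtopology)
  show "inj_on f {a..b}" using homeomorphic_imp_injective_map[OF assms] by simp
  show "f ` {a..b} = {0..1}" using homeomorphic_imp_surjective_map[OF assms] by simp
qed

lemma homeomorphic_interval_ends:
  fixes a b :: real
  assumes "homeomorphic_map (top_of_set {a..b}) unit_interval f" "a < b"
  shows "f a = 0 \<and> f b = 1 \<or> f a = 1 \<and> f b = 0"
proof -
  note f = homeomorphic_intervalD[OF assms(1)]
  have range: "0 \<le> f t \<and> f t \<le> 1" if "a \<le> t" "t \<le> b" for t
  proof -
    have "f t \<in> f ` {a..b}" using that by simp
    then show ?thesis unfolding f(3) by simp
  qed
  have hit: "\<exists>t. a \<le> t \<and> t \<le> b \<and> f t = v" if "0 \<le> v" "v \<le> 1" for v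
  proof -
    have "v \<in> f ` {a..b}" unfolding f(3) using that by simp
    then show ?thesis by auto
  qed
  have interior: "f a < f t \<and> f t < f b \<or> f b < f t \<and> f t < f a" if "a < t" "t < b" for t
    by (rule continuous_inj_imp_mono[OF that f(1,2)])
  obtain s where s: "a \<le> s" "s \<le> b" "f s = 0" using hit[of 0] by auto
  obtain t where t: "a \<le> t" "t \<le> b" "f t = 1" using hit[of 1] by auto
  have "s = a \<or> s = b" using interior[of s] s range[of a] range[of b] assms(2) by fastforce
  moreover have "t = a \<or> t = b" using interior[of t] t range[of a] range[of b] assms(2) by fastforce
  ultimately show ?thesis using s(3) t(3) by auto
qed

lemma homeomorphic_intervalI:
  assumes "continuous_on {a..b} f" "inj_on f {a..b}" "f ` {a..b} = {0..1::real}"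
  shows "homeomorphic_map (top_of_set {a..b::real}) unit_interval f"
proof (rule bijective_closed_imp_homeomorphic_map)
  show c: "continuous_map (top_of_set {a..b}) unit_interval f"
    using assms by (auto simp: continuous_map_in_subtopology)
  show "closed_map (top_of_set {a..b}) unit_interval f"
    using c by (intro continuous_imp_closed_map)
      (simp_all add: compact_space_subtopology Hausdorff_space_subtopology)
qed (use assms in simp_all)

lemma subdivision_mono:
  assumes "subdivides f n x" "i \<le> j" "j \<le> n"
  shows "x i \<le> x j"
  using assms(2,3)
proof (induction j)
  case (Suc j)
  then have "x j < x (Suc j)" using assms(1) by (simp add: subdivides_def)
  then show ?case using Suc by (cases "i = Suc j") auto
qed simp

lemma subdivision_lap:
  assumes "subdivides f n x" "0 \<le> c" "c \<le> 1"
  shows "\<exists>i<n. x i \<le> c \<and> c \<le> x (Suc i)"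
proof -
  have ends: "x 0 = 0" "x n = 1" using assms(1) by (simp_all add: subdivides_def)
  have n: "n > 0" using ends by (cases n) auto
  define i where "i = (LEAST i. c \<le> x i)"
  have "c \<le> x n" using ends assms by simp
  then have i: "c \<le> x i" "i \<le> n" unfolding i_def by (rule LeastI, rule Least_le)
  show ?thesis
  proof (cases i)
    case 0
    then have "c = 0" using i ends assms by simp
    then show ?thesis using ends n subdivision_mono[OF assms(1), of 0 1] by (intro exI[of _ 0]) auto
  next
    case (Suc j)
    then have "\<not> c \<le> x j" unfolding i_def by (metis lessI not_less_Least)
    then show ?thesis using i Suc by (intro exI[of _ j]) auto
  qed
qed

text \<open>On each lap of \<open>f\<close> the map \<open>g\<close> passes from below to above \<open>1/2\<close> or conversely, so it takes
  the value \<open>1/2\<close> in the interior. Two of these \<open>n\<close> points never share a lap of \<open>g\<close>.\<close>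

lemma close_subdivisions_le:
  assumes f: "subdivides f n x" and g: "subdivides g m y" and cont: "continuous_on {0..1} g"
    and close: "\<And>t. 0 \<le> t \<Longrightarrow> t \<le> 1 \<Longrightarrow> \<bar>f t - g t\<bar> < 1/2"
  shows "n \<le> m"
proof -
  have x: "x i < x (Suc i)" "homeomorphic_map (top_of_set {x i..x (Suc i)}) unit_interval f" if "i < n" for i
    using f that unfolding subdivides_def by blast+
  have x01: "0 \<le> x i" "x i \<le> 1" if "i \<le> n" for i
    using subdivision_mono[OF f, of 0 i] subdivision_mono[OF f, of i n] that f
    unfolding subdivides_def by auto
  have "\<exists>c. x i < c \<and> c < x (Suc i) \<and> g c = 1/2" if i: "i < n" for i
  proof -
    have ends: "f (x i) = 0 \<and> f (x (Suc i)) = 1 \<or> f (x i) = 1 \<and> f (x (Suc i)) = 0"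
      using homeomorphic_interval_ends[OF x(2)[OF i] x(1)[OF i]] .
    have cl: "\<bar>f (x i) - g (x i)\<bar> < 1/2" "\<bar>f (x (Suc i)) - g (x (Suc i))\<bar> < 1/2"
      using close x01[of i] x01[of "Suc i"] i by auto
    have "{x i..x (Suc i)} \<subseteq> {0..1}" using x01[of i] x01[of "Suc i"] i by auto
    then have c: "continuous_on {x i..x (Suc i)} g" using cont continuous_on_subset by blast
    have "\<exists>c. x i \<le> c \<and> c \<le> x (Suc i) \<and> g c = 1/2"
    proof (cases "f (x i) = 0")
      case True
      then have "f (x (Suc i)) = 1" using ends by simp
      with True have "g (x i) \<le> 1/2" "1/2 \<le> g (x (Suc i))" using cl by linarith+
      then show ?thesis using IVT'[of g "x i" "1/2" "x (Suc i)"] x(1)[OF i] c by auto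
    next
      case False
      then have "f (x i) = 1" "f (x (Suc i)) = 0" using ends by simp_all
      then have "g (x (Suc i)) \<le> 1/2" "1/2 \<le> g (x i)" using cl by linarith+
      then show ?thesis using IVT2'[of g "x (Suc i)" "1/2" "x i"] x(1)[OF i] c by auto
    qed
    then obtain c where c: "x i \<le> c" "c \<le> x (Suc i)" "g c = 1/2" by blast
    moreover have "c \<noteq> x i" "c \<noteq> x (Suc i)" using c(3) cl ends by auto
    ultimately show ?thesis by (metis less_le)
  qed
  then obtain c where c: "\<And>i. i < n \<Longrightarrow> x i < c i" "\<And>i. i < n \<Longrightarrow> c i < x (Suc i)"
    "\<And>i. i < n \<Longrightarrow> g (c i) = 1/2" by metis
  have "\<exists>j<m. y j \<le> c i \<and> c i \<le> y (Suc j)" if i: "i < n" for i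
  proof (rule subdivision_lap[OF g])
    show "0 \<le> c i" "c i \<le> 1" using c(1,2)[OF i] x01[of i] x01[of "Suc i"] i by linarith+
  qed
  then obtain J where J: "\<And>i. i < n \<Longrightarrow> J i < m" "\<And>i. i < n \<Longrightarrow> y (J i) \<le> c i"
    "\<And>i. i < n \<Longrightarrow> c i \<le> y (Suc (J i))" by metis
  have sep: "c i < c i'" if "i < i'" "i' < n" for i i'
  proof -
    have "c i < x (Suc i)" using c(2)[of i] that by simp
    also have "\<dots> \<le> x i'" using subdivision_mono[OF f, of "Suc i" i'] that by simp
    also have "\<dots> < c i'" using c(1)[OF that(2)] .
    finally show ?thesis .
  qed
  have "inj_on J {..<n}"
  proof (rule inj_onI)
    fix i i' assume ii': "i \<in> {..<n}" "i' \<in> {..<n}" "J i = J i'"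
    then have lt: "i < n" "i' < n" by auto
    have "inj_on g {y (J i)..y (Suc (J i))}"
      using g J(1)[OF lt(1)] homeomorphic_intervalD(2) unfolding subdivides_def by blast
    moreover have "c i \<in> {y (J i)..y (Suc (J i))}" "c i' \<in> {y (J i)..y (Suc (J i))}"
      using J(2,3)[OF lt(1)] J(2,3)[OF lt(2)] ii'(3) by auto
    moreover have "g (c i) = g (c i')" using c(3)[OF lt(1)] c(3)[OF lt(2)] by simp
    ultimately have "c i = c i'" by (meson inj_onD)
    then show "i = i'" using sep[of i i'] sep[of i' i] lt by (cases i i' rule: linorder_cases) simp_all
  qed
  moreover have "J ` {..<n} \<subseteq> {..<m}" using J(1) by auto
  ultimately show "n \<le> m" using card_inj_on_le[of J "{..<n}" "{..<m}"] by simp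
qed

lemma pointed_open_mapD:
  assumes "pointed_open_map f"
  shows "continuous_on {0..1} f" "\<And>t. 0 \<le> t \<Longrightarrow> t \<le> 1 \<Longrightarrow> 0 \<le> f t" "\<And>t. 0 \<le> t \<Longrightarrow> t \<le> 1 \<Longrightarrow> f t \<le> 1"
    "f 0 = 0" "\<And>U. openin unit_interval U \<Longrightarrow> openin unit_interval (f ` U)"
  using assms unfolding pointed_open_map_def continuous_map_in_subtopology open_map_def
  by (auto simp: image_subset_iff)

lemma interval_degree_eq:
  assumes f: "pointed_open_map f" and x: "subdivides f n x"
  shows "interval_degree f = n"
  unfolding interval_degree_altdef
proof (rule the_equality)
  show "\<exists>x. subdivides f n x" using x by blast
  show "m = n" if m: "\<exists>x. subdivides f m x" for m
  proof -
    obtain y where y: "subdivides f m y" using m by blast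
    show ?thesis
      using close_subdivisions_le[OF x y pointed_open_mapD(1)[OF f]]
        close_subdivisions_le[OF y x pointed_open_mapD(1)[OF f]] by simp
  qed
qed

text \<open>The image of a neighbourhood of \<open>t\<close> is open in \<open>[0,1]\<close> and has \<open>f t\<close> as its greatest or
  least element.\<close>

lemma open_map_local_extremum:
  assumes f: "pointed_open_map f" and t: "0 \<le> t" "t \<le> 1" and ab: "a < t" "t < b"
  shows "(\<And>s. 0 \<le> s \<Longrightarrow> s \<le> 1 \<Longrightarrow> a < s \<Longrightarrow> s < b \<Longrightarrow> f s \<le> f t) \<Longrightarrow> f t = 1"
    and "(\<And>s. 0 \<le> s \<Longrightarrow> s \<le> 1 \<Longrightarrow> a < s \<Longrightarrow> s < b \<Longrightarrow> f t \<le> f s) \<Longrightarrow> f t = 0"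
proof -
  note fD = pointed_open_mapD[OF f]
  define U where "U = {0..1} \<inter> {a<..<b}"
  have "openin unit_interval U" unfolding U_def by (simp add: openin_open_Int)
  then have "openin unit_interval (f ` U)" by (rule fD(5))
  moreover have tU: "f t \<in> f ` U" using t ab by (auto simp: U_def)
  ultimately obtain e where e: "e > 0" "\<And>u. 0 \<le> u \<Longrightarrow> u \<le> 1 \<Longrightarrow> \<bar>u - f t\<bar> < e \<Longrightarrow> u \<in> f ` U"
    using openin_unit_intervalD by blast
  have r: "0 \<le> f t" "f t \<le> 1" using fD(2,3) t by auto
  show "f t = 1" if le: "\<And>s. 0 \<le> s \<Longrightarrow> s \<le> 1 \<Longrightarrow> a < s \<Longrightarrow> s < b \<Longrightarrow> f s \<le> f t"
  proof (rule ccontr)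
    assume "f t \<noteq> 1"
    then have "f t < 1" using r by simp
    define u where "u = min 1 (f t + e/2)"
    have "f t < u" "0 \<le> u" "u \<le> 1" "\<bar>u - f t\<bar> < e" using e(1) \<open>f t < 1\<close> r by (auto simp: u_def)
    then have "u \<in> f ` U" using e(2) by blast
    then have "u \<le> f t" using le by (auto simp: U_def)
    then show False using \<open>f t < u\<close> by simp
  qed
  show "f t = 0" if le: "\<And>s. 0 \<le> s \<Longrightarrow> s \<le> 1 \<Longrightarrow> a < s \<Longrightarrow> s < b \<Longrightarrow> f t \<le> f s"
  proof (rule ccontr)
    assume "f t \<noteq> 0"
    then have "0 < f t" using r by simp
    define u where "u = max 0 (f t - e/2)"
    have "u < f t" "0 \<le> u" "u \<le> 1" "\<bar>u - f t\<bar> < e" using e(1) \<open>0 < f t\<close> r by (auto simp: u_def)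
    then have "u \<in> f ` U" using e(2) by blast
    then have "f t \<le> u" using le by (auto simp: U_def)
    then show False using \<open>u < f t\<close> by simp
  qed
qed

text \<open>Let \<open>u\<close> and \<open>v\<close> be places of maximum and minimum on \<open>[s,t]\<close>. If one of these values differs
  from the common value at the ends, it is taken in the interior and is an extremum, so it is \<open>1\<close>
  or \<open>0\<close>. If both agree with it, \<open>f\<close> is constant, which would make an interior value both \<open>0\<close> and
  \<open>1\<close>.\<close>

lemma open_map_returns:
  assumes f: "pointed_open_map f" and st: "0 \<le> s" "s < t" "t \<le> 1" and eq: "f s = f t"
  shows "\<exists>w. s < w \<and> w < t \<and> f w \<noteq> f s \<and> (f w = 0 \<or> f w = 1)"
proof -
  note fD = pointed_open_mapD[OF f]
  have cont: "continuous_on {s..t} f" using continuous_on_subset[OF fD(1), of "{s..t}"] st by auto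
  have ne: "{s..t} \<noteq> {}" using st by simp
  obtain u where u: "u \<in> {s..t}" "\<And>w. w \<in> {s..t} \<Longrightarrow> f w \<le> f u"
    using continuous_attains_sup[OF compact_Icc ne cont] by blast
  obtain v where v: "v \<in> {s..t}" "\<And>w. w \<in> {s..t} \<Longrightarrow> f v \<le> f w"
    using continuous_attains_inf[OF compact_Icc ne cont] by blast
  show ?thesis
  proof (cases "f u = f s")
    case False
    then have u': "s < u" "u < t" using u(1) eq by (auto simp: less_le)
    have "f u = 1"
    proof (rule open_map_local_extremum(1)[OF f])
      show "f r \<le> f u" if "s < r" "r < t" for r using u(2)[of r] that by simp
    qed (use u' st in simp_all)
    then show ?thesis using u' False by blast
  next
    case u_eq: True
    show ?thesis
    proof (cases "f v = f s")
      case False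
      then have v': "s < v" "v < t" using v(1) eq by (auto simp: less_le)
      have "f v = 0"
      proof (rule open_map_local_extremum(2)[OF f])
        show "f v \<le> f r" if "s < r" "r < t" for r using v(2)[of r] that by simp
      qed (use v' st in simp_all)
      then show ?thesis using v' False by blast
    next
      case True
      define w where "w = (s + t) / 2"
      have w: "s < w" "w < t" using st by (auto simp: w_def)
      have const: "f r = f w" if "s < r" "r < t" for r
      proof -
        have "f r \<le> f s" "f s \<le> f r" "f w \<le> f s" "f s \<le> f w"
          using u(2)[of r] v(2)[of r] u(2)[of w] v(2)[of w] that w unfolding u_eq True by simp_all
        then show ?thesis by linarith
      qed
      have "f w = 1"
      proof (rule open_map_local_extremum(1)[OF f])
        show "f r \<le> f w" if "s < r" "r < t" for r using const[OF that] by (rule eq_refl)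
      qed (use w st in simp_all)
      moreover have "f w = 0"
      proof (rule open_map_local_extremum(2)[OF f])
        show "f w \<le> f r" if "s < r" "r < t" for r using const[OF that] by (rule eq_refl[OF sym])
      qed (use w st in simp_all)
      ultimately show ?thesis by simp
    qed
  qed
qed

lemma finite_separated:
  fixes Z :: "real set"
  assumes "Z \<subseteq> {0..1}" "\<delta> > 0" and sep: "\<And>u v. u \<in> Z \<Longrightarrow> v \<in> Z \<Longrightarrow> u < v \<Longrightarrow> v - u \<ge> \<delta>"
  shows "finite Z"
proof -
  have inj: "inj_on (\<lambda>u. \<lfloor>u / \<delta>\<rfloor>) Z"
  proof (rule inj_onI)
    fix u v assume uv: "u \<in> Z" "v \<in> Z" "\<lfloor>u / \<delta>\<rfloor> = \<lfloor>v / \<delta>\<rfloor>"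
    have "\<lfloor>a / \<delta>\<rfloor> < \<lfloor>b / \<delta>\<rfloor>" if "a \<in> Z" "b \<in> Z" "a < b" for a b
    proof -
      have "(a + \<delta>) / \<delta> \<le> b / \<delta>"
        using sep[OF that] assms(2) by (intro divide_right_mono) simp_all
      moreover have "(a + \<delta>) / \<delta> = a / \<delta> + 1" using assms(2) by (simp add: add_divide_distrib)
      ultimately have "a / \<delta> + 1 \<le> b / \<delta>" by (simp only:)
      then show ?thesis by linarith
    qed
    from this[of u v] this[of v u] show "u = v"
      using uv by (cases u v rule: linorder_cases) simp_all
  qed
  have "(\<lambda>u. \<lfloor>u / \<delta>\<rfloor>) ` Z \<subseteq> {0..\<lfloor>1 / \<delta>\<rfloor>}"
  proof (rule image_subsetI)
    fix u assume "u \<in> Z"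
    then have "0 \<le> u" "u \<le> 1" using assms(1) by auto
    then have "0 \<le> u / \<delta>" "u / \<delta> \<le> 1 / \<delta>"
      using assms(2) by (simp_all add: divide_right_mono)
    then show "\<lfloor>u / \<delta>\<rfloor> \<in> {0..\<lfloor>1 / \<delta>\<rfloor>}" by (simp add: floor_mono)
  qed
  then have "finite ((\<lambda>u. \<lfloor>u / \<delta>\<rfloor>) ` Z)" by (rule finite_subset) simp
  then show ?thesis using inj by (simp add: finite_image_iff)
qed

text \<open>The subdivision points are the set \<open>Z\<close> where \<open>f\<close> is \<open>0\<close> or \<open>1\<close>. By uniform continuity points
  of \<open>Z\<close> with different values are at least \<open>\<delta>\<close> apart, and between two with equal values
  there is one with the other value, so \<open>Z\<close> is finite. Between neighbouring points \<open>f\<close> cannot take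
  a value twice.\<close>

theorem pointed_open_map_subdivides:
  assumes f: "pointed_open_map f"
  shows "\<exists>n x. subdivides f n x"
proof -
  note fD = pointed_open_mapD[OF f]
  define Z where "Z = {t. 0 \<le> t \<and> t \<le> 1 \<and> (f t = 0 \<or> f t = 1)}"
  have returns: "\<exists>w\<in>Z. s < w \<and> w < t \<and> f w \<noteq> f s" if st: "0 \<le> s" "s < t" "t \<le> 1" "f s = f t" for s t
  proof -
    obtain w where "s < w" "w < t" "f w \<noteq> f s" "f w = 0 \<or> f w = 1"
      using open_map_returns[OF f st] by blast
    then show ?thesis using st by (intro bexI[of _ w]) (auto simp: Z_def)
  qed
  have "uniformly_continuous_on {0..1} f" using fD(1) by (intro compact_uniformly_continuous) auto
  then obtain \<delta> where \<delta>: "\<delta> > 0" "\<And>s t. s \<in> {0..1} \<Longrightarrow> t \<in> {0..1} \<Longrightarrow> \<bar>s - t\<bar> < \<delta> \<Longrightarrow> \<bar>f s - f t\<bar> < 1"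
    unfolding uniformly_continuous_on_def dist_real_def by (metis zero_less_one)
  have sep_ne: "v - u \<ge> \<delta>" if "u \<in> Z" "v \<in> Z" "u < v" "f u \<noteq> f v" for u v
  proof (rule ccontr)
    assume "\<not> ?thesis"
    then have "\<bar>f u - f v\<bar> < 1" using that by (intro \<delta>(2)) (auto simp: Z_def)
    then show False using that by (auto simp: Z_def)
  qed
  have sep: "v - u \<ge> \<delta>" if uv: "u \<in> Z" "v \<in> Z" "u < v" for u v
  proof (cases "f u = f v")
    case True
    then obtain w where w: "w \<in> Z" "u < w" "w < v" "f w \<noteq> f u"
      using returns[of u v] uv by (auto simp: Z_def)
    then have "w - u \<ge> \<delta>" using sep_ne[of u w] uv by auto
    then show ?thesis using w by simp
  qed (use sep_ne uv in blast)
  have "Z \<subseteq> {0..1}" by (auto simp: Z_def)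
  then have fin: "finite Z" using \<delta>(1) sep by (rule finite_separated)
  have Z0: "0 \<in> Z" using fD(4) by (simp add: Z_def)
  \<comment> \<open>otherwise an extremum of \<open>f\<close> to the right of the last point of \<open>Z\<close> would be another point of \<open>Z\<close>\<close>
  have Z1: "1 \<in> Z"
  proof (rule ccontr)
    assume n1: "1 \<notin> Z"
    define u where "u = Max Z"
    have "Z \<noteq> {}" using Z0 by blast
    then have u: "u \<in> Z" "\<And>w. w \<in> Z \<Longrightarrow> w \<le> u"
      unfolding u_def using Max_in[OF fin] Max_ge[OF fin] by blast+
    then have u1: "0 \<le> u" "u < 1" using n1 by (auto simp: Z_def less_le)
    have out: "f w \<noteq> 0 \<and> f w \<noteq> 1" if "u < w" "w \<le> 1" for w
      using u(2)[of w] that u1 by (auto simp: Z_def)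
    have cont: "continuous_on {u..1} f" using continuous_on_subset[OF fD(1), of "{u..1}"] u1 by auto
    have ne: "{u..1} \<noteq> {}" using u1 by simp
    show False
    proof (cases "f u = 0")
      case True
      obtain w where w: "w \<in> {u..1}" "\<And>s. s \<in> {u..1} \<Longrightarrow> f s \<le> f w"
        using continuous_attains_sup[OF compact_Icc ne cont] by blast
      have "f 1 \<noteq> 0" "0 \<le> f 1" using out[of 1] u1 fD(2)[of 1] by auto
      then have "f w > 0" using w(2)[of 1] u1 by auto
      then have uw: "u < w" using w(1) True by (cases "w = u") auto
      have "f w = 1"
      proof (rule open_map_local_extremum(1)[OF f, of _ u 2])
        show "f r \<le> f w" if "r \<le> 1" "u < r" for r using w(2)[of r] that by simp
      qed (use w(1) uw u1 in auto)
      then show False using out[of w] uw w(1) by auto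
    next
      case False
      then have fu: "f u = 1" using u(1) by (auto simp: Z_def)
      obtain w where w: "w \<in> {u..1}" "\<And>s. s \<in> {u..1} \<Longrightarrow> f w \<le> f s"
        using continuous_attains_inf[OF compact_Icc ne cont] by blast
      have "f 1 \<noteq> 1" "f 1 \<le> 1" using out[of 1] u1 fD(3)[of 1] by auto
      then have "f w < 1" using w(2)[of 1] u1 by auto
      then have uw: "u < w" using w(1) fu by (cases "w = u") auto
      have "f w = 0"
      proof (rule open_map_local_extremum(2)[OF f, of _ u 2])
        show "f w \<le> f r" if "r \<le> 1" "u < r" for r using w(2)[of r] that by simp
      qed (use w(1) uw u1 in auto)
      then show False using out[of w] uw w(1) by auto
    qed
  qed
  have gap: "homeomorphic_map (top_of_set {u..v}) unit_interval f"
    if uv: "u \<in> Z" "v \<in> Z" "u < v" and no: "\<And>w. w \<in> Z \<Longrightarrow> u < w \<Longrightarrow> \<not> w < v" for u v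
  proof (rule homeomorphic_intervalI)
    have uv01: "0 \<le> u" "v \<le> 1" using uv by (auto simp: Z_def)
    show cont: "continuous_on {u..v} f" using continuous_on_subset[OF fD(1), of "{u..v}"] uv01 by auto
    have ne: "f s \<noteq> f t" if st: "u \<le> s" "s < t" "t \<le> v" for s t
    proof
      assume "f s = f t"
      then obtain w where "w \<in> Z" "s < w" "w < t" using returns[of s t] st uv01 by auto
      then show False using no[of w] st by auto
    qed
    show "inj_on f {u..v}"
    proof (rule inj_onI)
      fix s t assume "s \<in> {u..v}" "t \<in> {u..v}" "f s = f t"
      then show "s = t" using ne[of s t] ne[of t s] by (cases s t rule: linorder_cases) auto
    qed
    have "f u \<noteq> f v" using ne[of u v] uv by auto
    then have ends: "f u = 0 \<and> f v = 1 \<or> f u = 1 \<and> f v = 0" using uv by (auto simp: Z_def)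
    show "f ` {u..v} = {0..1}"
    proof (intro equalityI subsetI)
      fix r assume "r \<in> f ` {u..v}"
      then show "r \<in> {0..1}" using fD(2,3) uv01 by auto
    next
      fix r :: real assume r: "r \<in> {0..1}"
      have "\<exists>s. u \<le> s \<and> s \<le> v \<and> f s = r"
        using ends
      proof
        assume "f u = 0 \<and> f v = 1"
        then show ?thesis using IVT'[of f u r v] r cont uv(3) by auto
      next
        assume "f u = 1 \<and> f v = 0"
        then show ?thesis using IVT2'[of f v r u] r cont uv(3) by auto
      qed
      then show "r \<in> f ` {u..v}" by auto
    qed
  qed
  define zs where "zs = sorted_list_of_set Z"
  have zs: "set zs = Z" "sorted_wrt (<) zs" using fin by (simp_all add: zs_def)
  define n where "n = length zs - 1"
  have len: "length zs = Suc n" using zs(1) Z0 by (cases zs) (auto simp: n_def)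
  have less: "zs ! i < zs ! j" if "i < j" "j \<le> n" for i j
    using sorted_wrt_nth_less[OF zs(2), of i j] that len by simp
  have in_Z: "zs ! i \<in> Z" if "i \<le> n" for i using nth_mem[of i zs] zs(1) that len by simp
  have index: "\<exists>i\<le>n. zs ! i = w" if w: "w \<in> Z" for w
  proof -
    have "w \<in> set zs" using w zs(1) by simp
    then obtain i where "i < length zs" "zs ! i = w" by (auto simp: in_set_conv_nth)
    then show ?thesis using len by (intro exI[of _ i]) simp
  qed
  have first: "zs ! 0 = 0"
  proof -
    obtain i where i: "i \<le> n" "zs ! i = 0" using index[OF Z0] by blast
    have "0 \<le> zs ! 0" using in_Z[of 0] by (simp add: Z_def)
    then show ?thesis using i less[of 0 i] by (cases "i = 0") auto
  qed
  have last: "zs ! n = 1"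
  proof -
    obtain i where i: "i \<le> n" "zs ! i = 1" using index[OF Z1] by blast
    have "zs ! n \<le> 1" using in_Z[of n] by (simp add: Z_def)
    then show ?thesis using i less[of i n] by (cases "i = n") auto
  qed
  have "homeomorphic_map (top_of_set {zs ! i..zs ! Suc i}) unit_interval f" if i: "i < n" for i
  proof (rule gap)
    show "zs ! i \<in> Z" "zs ! Suc i \<in> Z" "zs ! i < zs ! Suc i" using in_Z less i by auto
    fix w assume w: "w \<in> Z" "zs ! i < w"
    obtain j where j: "j \<le> n" "zs ! j = w" using index[OF w(1)] by blast
    show "\<not> w < zs ! Suc i"
    proof
      assume "w < zs ! Suc i"
      then have "\<not> Suc i \<le> j" using less[of "Suc i" j] j by (cases "j = Suc i") auto
      then have "j \<le> i" by simp
      then show False using less[of j i] j w(2) i by (cases "j = i") auto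
    qed
  qed
  then have "subdivides f n (\<lambda>i. zs ! i)" using first last less by (simp add: subdivides_def)
  then show ?thesis by blast
qed

lemma lift_subdivides:
  assumes H: "lift 1 (real k) H" and k: "k > 0"
  shows "subdivides (\<lambda>x. zig (H x)) k (\<lambda>i. Hilbert_Choice.inv H (real i))"
  unfolding subdivides_def
proof (intro conjI allI impI)
  let ?I = "Hilbert_Choice.inv H"
  note I = lift_inv[OF H]
  show "?I (real 0) = 0" using lift_0[OF I] by simp
  show "?I (real k) = 1" using lift_end[OF I] by simp
  fix i assume "i < k"
  show less: "?I (real i) < ?I (real (Suc i))" using lift_less[OF I] by simp
  show "homeomorphic_map (top_of_set {?I (real i)..?I (real (Suc i))}) unit_interval (\<lambda>x. zig (H x))"
  proof (rule homeomorphic_intervalI)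
    show "continuous_on {?I (real i)..?I (real (Suc i))} (\<lambda>x. zig (H x))"
      by (rule continuous_on_zig[OF lift_continuous[OF H]])
    have lap: "\<exists>u. 0 \<le> u \<and> u \<le> 1 \<and> H x = of_int (int i) + u \<and> zig (H x) = (if even i then u else 1 - u)"
      if "x \<in> {?I (real i)..?I (real (Suc i))}" for x
    proof -
      have "H (?I (real i)) \<le> H x" "H x \<le> H (?I (real (Suc i)))"
        using that lift_le[OF H] by auto
      then have "real i \<le> H x" "H x \<le> real i + 1" using lift_inv_simps[OF H] by simp_all
      then show ?thesis using zig_lap[of "H x - real i" "int i"] by (intro exI[of _ "H x - real i"]) auto
    qed
    show "inj_on (\<lambda>x. zig (H x)) {?I (real i)..?I (real (Suc i))}"
    proof (rule inj_onI)
      fix x y assume xy: "x \<in> {?I (real i)..?I (real (Suc i))}" "y \<in> {?I (real i)..?I (real (Suc i))}"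
        "zig (H x) = zig (H y)"
      obtain u v where "H x = of_int (int i) + u" "zig (H x) = (if even i then u else 1 - u)"
        "H y = of_int (int i) + v" "zig (H y) = (if even i then v else 1 - v)"
        using lap[OF xy(1)] lap[OF xy(2)] by blast
      then have "H x = H y" using xy(3) by (auto split: if_splits)
      then show "x = y" using lift_inv_simps(2)[OF H] by metis
    qed
    show "(\<lambda>x. zig (H x)) ` {?I (real i)..?I (real (Suc i))} = {0..1}"
    proof (intro equalityI subsetI)
      fix r assume "r \<in> (\<lambda>x. zig (H x)) ` {?I (real i)..?I (real (Suc i))}"
      then show "r \<in> {0..1}" using zig_range by auto
    next
      fix r :: real assume r: "r \<in> {0..1}"
      define u where "u = (if even i then r else 1 - r)"
      have u: "0 \<le> u" "u \<le> 1" using r by (auto simp: u_def)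
      define x where "x = ?I (real i + u)"
      have x: "x \<in> {?I (real i)..?I (real (Suc i))}"
        using u lift_le[OF I] by (simp add: x_def)
      have "zig (H x) = zig (of_int (int i) + u)" using lift_inv_simps[OF H] by (simp add: x_def)
      also have "\<dots> = r" using zig_lap[OF u, of "int i"] by (simp add: u_def)
      finally show "r \<in> (\<lambda>x. zig (H x)) ` {?I (real i)..?I (real (Suc i))}" using x by blast
    qed
  qed
qed

lemma interval_degree_zig_lift:
  "lift 1 (real k) H \<Longrightarrow> k > 0 \<Longrightarrow> interval_degree (\<lambda>x. zig (H x)) = k"
  using interval_degree_eq[OF pointed_open_map_zig_lift lift_subdivides] by blast

lemma interval_degree_close:
  assumes f: "pointed_open_map f" and g: "pointed_open_map g"
    and close: "\<And>t. 0 \<le> t \<Longrightarrow> t \<le> 1 \<Longrightarrow> \<bar>f t - g t\<bar> < 1/2"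
  shows "interval_degree f = interval_degree g"
proof -
  obtain n x where x: "subdivides f n x" using pointed_open_map_subdivides[OF f] by blast
  obtain m y where y: "subdivides g m y" using pointed_open_map_subdivides[OF g] by blast
  have "n \<le> m" by (rule close_subdivisions_le[OF x y pointed_open_mapD(1)[OF g] close])
  moreover have "m \<le> n"
    by (rule close_subdivisions_le[OF y x pointed_open_mapD(1)[OF f]])
      (use close in \<open>simp add: abs_minus_commute\<close>)
  ultimately show ?thesis using interval_degree_eq[OF f x] interval_degree_eq[OF g y] by simp
qed

section \<open>Monotone lifts of open maps\<close>

text \<open>Coordinates on the \<open>j\<close>-th lap of the triangle wave: on odd laps the interval is traversed
  backwards.\<close>

definition flip :: "nat \<Rightarrow> real \<Rightarrow> real" where
  "flip j x = (if even j then x else 1 - x)"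

lemma zig_flip: "0 \<le> u \<Longrightarrow> u \<le> 1 \<Longrightarrow> zig (real j + u) = flip j u"
  using zig_lap[of u "int j"] by (simp add: flip_def)

lemma flip_flip [simp]: "flip j (flip j x) = x"
  by (simp add: flip_def)

lemma flip_Suc: "flip (Suc j) x = 1 - flip j x"
  by (simp add: flip_def)

lemma flip_dist: "\<bar>flip j x - flip j y\<bar> = \<bar>x - y\<bar>"
  by (simp add: flip_def abs_minus_commute)

lemma flip_range: "0 \<le> x \<Longrightarrow> x \<le> 1 \<Longrightarrow> 0 \<le> flip j x \<and> flip j x \<le> 1"
  by (simp add: flip_def)

text \<open>No shallow peaks: if the sequence rises at \<open>\<mu>\<close> by more than \<open>3 * \<epsilon>\<close> above both
  ends of a block, then it comes close to \<open>1\<close> in this block. The first and the last index are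
  exempt from the comparison, for there the interval ends.\<close>

definition high_peaks :: "(nat \<Rightarrow> real) \<Rightarrow> nat \<Rightarrow> real \<Rightarrow> bool" where
  "high_peaks a M \<epsilon> \<longleftrightarrow> (\<forall>r \<mu> s. r \<le> \<mu> \<and> \<mu> \<le> s \<and> s \<le> M \<and>
     (r = 0 \<or> a r + 3 * \<epsilon> < a \<mu>) \<and> (s = M \<or> a s + 3 * \<epsilon> < a \<mu>) \<longrightarrow>
     (\<exists>l. r \<le> l \<and> l \<le> s \<and> a l > 1 - \<epsilon>))"

lemma high_peaksD:
  assumes "high_peaks a M \<epsilon>" "r \<le> \<mu>" "\<mu> \<le> s" "s \<le> M"
    "r = 0 \<or> a r + 3 * \<epsilon> < a \<mu>" "s = M \<or> a s + 3 * \<epsilon> < a \<mu>"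
  obtains l where "r \<le> l" "l \<le> s" "a l > 1 - \<epsilon>"
proof -
  have "\<exists>l. r \<le> l \<and> l \<le> s \<and> a l > 1 - \<epsilon>"
    using assms(2-) by (intro assms(1)[unfolded high_peaks_def, THEN spec, THEN spec, THEN spec, THEN mp] conjI)
  then show ?thesis using that by (elim exE conjE)
qed

text \<open>Were \<open>a 0\<close> in the middle, the first departure from it by more than \<open>3 * \<epsilon>\<close> would
  exhibit \<open>0\<close> as a shallow peak or a shallow valley.\<close>

lemma high_peaks_start:
  assumes peaks: "high_peaks a M \<epsilon>" "high_peaks (\<lambda>l. 1 - a l) M \<epsilon>"
    and top: "l \<le> M" "a l > 1 - \<epsilon>" and \<epsilon>: "\<epsilon> > 0"
  shows "a 0 \<le> 4 * \<epsilon> \<or> a 0 \<ge> 1 - 4 * \<epsilon>"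
proof (rule ccontr)
  assume "\<not> ?thesis"
  then have mid: "a 0 > 4 * \<epsilon>" "a 0 < 1 - 4 * \<epsilon>" by auto
  define far where "far l \<longleftrightarrow> \<bar>a l - a 0\<bar> > 3 * \<epsilon>" for l
  define s where "s = (LEAST l. far l)"
  have fl: "far l" using top(2) mid by (simp add: far_def)
  have s: "far s" "s \<le> l" unfolding s_def by (rule LeastI[of far, OF fl], rule Least_le[of far, OF fl])
  have before: "\<bar>a i - a 0\<bar> \<le> 3 * \<epsilon>" if "i < s" for i
    using not_less_Least[of i far] that unfolding s_def far_def by simp
  have sM: "s \<le> M" using s(2) top(1) by simp
  show False
  proof (cases "a s > a 0")
    case True
    then have up: "a s > a 0 + 3 * \<epsilon>" using s(1) by (simp add: far_def)
    obtain i where i: "i \<le> s" "1 - a i > 1 - \<epsilon>"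
    proof (rule high_peaksD[OF peaks(2), of 0 0 s])
      show "s = M \<or> 1 - a s + 3 * \<epsilon> < 1 - a 0" using up by simp
    qed (use sM in simp_all)
    show False
    proof (cases "i = s")
      case True
      then show ?thesis using i(2) up mid(1) \<epsilon> by simp
    next
      case False
      then have "\<bar>a i - a 0\<bar> \<le> 3 * \<epsilon>" using before i(1) by simp
      then show ?thesis using i(2) mid(1) by linarith
    qed
  next
    case False
    then have down: "a s + 3 * \<epsilon> < a 0" using s(1) by (simp add: far_def)
    obtain i where i: "i \<le> s" "a i > 1 - \<epsilon>"
      by (rule high_peaksD[OF peaks(1), of 0 0 s]) (use sM down in simp_all)
    show False
    proof (cases "i = s")
      case True
      then show ?thesis using i(2) down mid(2) \<epsilon> by simp
    next
      case False
      then have "\<bar>a i - a 0\<bar> \<le> 3 * \<epsilon>" using before i(1) by simp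
      then show ?thesis using i(2) mid(2) by linarith
    qed
  qed
qed

text \<open>The state of a monotone lift \<open>b\<close> of the sequence \<open>a\<close> after \<open>s\<close> steps: it runs in lap \<open>j\<close>,
  which it entered at step \<open>\<tau>\<close>, and it rests at the highest point of this lap that \<open>a\<close> has
  reached so far, at step \<open>\<mu>\<close>. The present value of \<open>a\<close> may have sunk below that.\<close>

definition lifted_upto ::
  "(nat \<Rightarrow> real) \<Rightarrow> real \<Rightarrow> nat \<Rightarrow> nat \<Rightarrow> nat \<Rightarrow> nat \<Rightarrow> (nat \<Rightarrow> real) \<Rightarrow> bool" where
  "lifted_upto a \<epsilon> s j \<tau> \<mu> b \<longleftrightarrow> \<tau> \<le> \<mu> \<and> \<mu> \<le> s \<and> flip j (a \<tau>) \<le> \<epsilon> \<and>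
     (\<forall>l. \<tau> \<le> l \<and> l \<le> s \<longrightarrow> flip j (a l) < 1 - \<epsilon>) \<and>
     b s = real j + flip j (a \<mu>) \<and> flip j (a s) \<le> flip j (a \<mu>) \<and> b 0 = a 0 \<and>
     (\<forall>l<s. b l \<le> b (Suc l) \<and> b (Suc l) \<le> b l + 3 * \<epsilon>) \<and> (\<forall>l\<le>s. \<bar>zig (b l) - a l\<bar> \<le> 4 * \<epsilon>)"

lemma lifted_upto_extend:
  assumes "lifted_upto a \<epsilon> s j \<tau> \<mu> b"
    and "\<tau>' \<le> \<mu>'" "\<mu>' \<le> Suc s" "flip j' (a \<tau>') \<le> \<epsilon>"
    "\<And>l. \<tau>' \<le> l \<Longrightarrow> l \<le> Suc s \<Longrightarrow> flip j' (a l) < 1 - \<epsilon>"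
    "v = real j' + flip j' (a \<mu>')" "flip j' (a (Suc s)) \<le> flip j' (a \<mu>')"
    "b s \<le> v" "v \<le> b s + 3 * \<epsilon>" "\<bar>zig v - a (Suc s)\<bar> \<le> 4 * \<epsilon>"
  shows "lifted_upto a \<epsilon> (Suc s) j' \<tau>' \<mu>' (b(Suc s := v))"
  using assms unfolding lifted_upto_def by (simp add: less_Suc_eq le_Suc_eq)

text \<open>The lift follows the running maximum of the current lap. If \<open>a\<close> sank by more than
  \<open>4 * \<epsilon>\<close> below it before reaching the end of the lap, the maximum would be a shallow
  peak; so freezing the lift costs at most \<open>4 * \<epsilon>\<close>. As soon as \<open>a\<close> comes within
  \<open>\<epsilon>\<close> of the end of the lap, the next lap begins.\<close>

lemma lifted_upto_exists:
  assumes \<epsilon>: "0 < \<epsilon>" "\<epsilon> < 1/20" and range: "\<And>l. l \<le> M \<Longrightarrow> 0 \<le> a l \<and> a l \<le> 1"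
    and step: "\<And>l. l < M \<Longrightarrow> \<bar>a (Suc l) - a l\<bar> < \<epsilon>"
    and peaks: "high_peaks a M \<epsilon>" "high_peaks (\<lambda>l. 1 - a l) M \<epsilon>" and start: "a 0 \<le> \<epsilon>"
    and "s \<le> M"
  shows "\<exists>j \<tau> \<mu> b. lifted_upto a \<epsilon> s j \<tau> \<mu> b"
  using \<open>s \<le> M\<close>
proof (induction s)
  case 0
  have "lifted_upto a \<epsilon> 0 0 0 0 (\<lambda>_. a 0)"
    using range[of 0] start \<epsilon> by (simp add: lifted_upto_def flip_def)
  then show ?case by blast
next
  case (Suc s)
  then obtain j \<tau> \<mu> b where L: "lifted_upto a \<epsilon> s j \<tau> \<mu> b" by auto
  have L': "\<tau> \<le> \<mu>" "\<mu> \<le> s" "flip j (a \<tau>) \<le> \<epsilon>" "\<And>l. \<tau> \<le> l \<Longrightarrow> l \<le> s \<Longrightarrow> flip j (a l) < 1 - \<epsilon>"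
    "b s = real j + flip j (a \<mu>)" "flip j (a s) \<le> flip j (a \<mu>)"
    using L unfolding lifted_upto_def by simp_all
  have pk: "high_peaks (\<lambda>l. flip j (a l)) M \<epsilon>" using peaks by (cases "even j") (simp_all add: flip_def)
  define x where "x = flip j (a (Suc s))"
  have x01: "0 \<le> x" "x \<le> 1" using flip_range range[OF Suc.prems] unfolding x_def by blast+
  have xs: "\<bar>x - flip j (a s)\<bar> < \<epsilon>" using step[of s] Suc.prems unfolding x_def flip_dist by simp
  have m: "flip j (a \<mu>) < 1 - \<epsilon>" using L'(1,2,4) by blast
  have m01: "0 \<le> flip j (a \<mu>)" "flip j (a \<mu>) \<le> 1"
    using flip_range range[of \<mu>] L'(2) Suc.prems by simp_all
  show ?case
  proof (cases "x \<ge> 1 - \<epsilon>")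
    case True
    \<comment> \<open>the end of the lap is reached: the lift jumps across it, by at most \<open>3 * \<epsilon>\<close>\<close>
    define v where "v = real (Suc j) + flip (Suc j) (a (Suc s))"
    have v: "v = real j + 1 + (1 - x)" by (simp add: v_def flip_Suc x_def)
    have "zig v = flip (Suc j) (flip (Suc j) (a (Suc s)))" unfolding v_def
      by (rule zig_flip) (use x01 in \<open>simp_all add: flip_Suc x_def\<close>)
    then have "zig v = a (Suc s)" by (simp only: flip_flip)
    moreover have "b s \<le> v" "v \<le> b s + 3 * \<epsilon>"
      unfolding v L'(5) using m L'(6) xs True x01 \<epsilon> by linarith+
    moreover have "flip (Suc j) (a (Suc s)) \<le> \<epsilon>" using True by (simp add: flip_Suc x_def)
    moreover have "flip (Suc j) (a l) < 1 - \<epsilon>" if "Suc s \<le> l" "l \<le> Suc s" for l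
      using \<open>flip (Suc j) (a (Suc s)) \<le> \<epsilon>\<close> that \<epsilon> le_antisym[OF that(2,1)] by simp
    ultimately have "lifted_upto a \<epsilon> (Suc s) (Suc j) (Suc s) (Suc s) (b(Suc s := v))"
      using \<epsilon> by (intro lifted_upto_extend[OF L]) (simp_all add: v_def)
    then show ?thesis by blast
  next
    case False
    have low: "flip j (a l) < 1 - \<epsilon>" if "\<tau> \<le> l" "l \<le> Suc s" for l
      using L'(4)[of l] that False unfolding x_def by (cases "l = Suc s") simp_all
    show ?thesis
    proof (cases "flip j (a \<mu>) \<le> x")
      case True
      \<comment> \<open>a new maximum of the current lap\<close>
      define v where "v = real j + flip j (a (Suc s))"
      have "zig v = a (Suc s)"
        unfolding v_def using zig_flip[of "flip j (a (Suc s))" j] x01 by (simp add: x_def)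
      moreover have "b s \<le> v" "v \<le> b s + 3 * \<epsilon>"
        unfolding v_def L'(5) x_def[symmetric] using True L'(6) xs \<epsilon> by linarith+
      ultimately have "lifted_upto a \<epsilon> (Suc s) j \<tau> (Suc s) (b(Suc s := v))"
        using low L'(1-3) \<epsilon> by (intro lifted_upto_extend[OF L]) (simp_all add: v_def)
      then show ?thesis by blast
    next
      case drop: False
      \<comment> \<open>below the maximum: the lift stays where it is\<close>
      have close: "flip j (a \<mu>) - x \<le> 4 * \<epsilon>"
      proof (rule ccontr)
        assume "\<not> ?thesis"
        then have big: "x + 4 * \<epsilon> < flip j (a \<mu>)" by simp
        have ends: "\<tau> = 0 \<or> flip j (a \<tau>) + 3 * \<epsilon> < flip j (a \<mu>)"
          "Suc s = M \<or> flip j (a (Suc s)) + 3 * \<epsilon> < flip j (a \<mu>)"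
          using big L'(3) x01(1) \<epsilon>(1) unfolding x_def[symmetric] by linarith+
        obtain l where "\<tau> \<le> l" "l \<le> Suc s" "flip j (a l) > 1 - \<epsilon>"
          by (rule high_peaksD[OF pk L'(1) le_SucI[OF L'(2)] Suc.prems ends])
        then show False using low[of l] by simp
      qed
      have "zig (b s) = flip j (flip j (a \<mu>))" unfolding L'(5) by (rule zig_flip[OF m01])
      then have "zig (b s) = a \<mu>" by simp
      moreover have "\<bar>a \<mu> - a (Suc s)\<bar> \<le> 4 * \<epsilon>"
        using close drop flip_dist[of j "a \<mu>" "a (Suc s)"] unfolding x_def by linarith
      ultimately have "lifted_upto a \<epsilon> (Suc s) j \<tau> \<mu> (b(Suc s := b s))"
        using low L' \<epsilon> drop by (intro lifted_upto_extend[OF L]) (simp_all add: x_def)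
      then show ?thesis by blast
    qed
  qed
qed

text \<open>In the last, unfinished lap the running maximum is at most \<open>4 * \<epsilon>\<close>, for the right
  end of the sequence is exempt from the comparison that defines peaks. Cutting the lift off at
  the integer \<open>j\<close> makes it end there, at the cost of another \<open>4 * \<epsilon>\<close>.\<close>

lemma monotone_lift_exists:
  assumes \<epsilon>: "0 < \<epsilon>" "\<epsilon> < 1/20" and range: "\<And>l. l \<le> M \<Longrightarrow> 0 \<le> a l \<and> a l \<le> 1"
    and step: "\<And>l. l < M \<Longrightarrow> \<bar>a (Suc l) - a l\<bar> < \<epsilon>"
    and peaks: "high_peaks a M \<epsilon>" "high_peaks (\<lambda>l. 1 - a l) M \<epsilon>" and start: "a 0 \<le> \<epsilon>"
    and top: "h \<le> M" "a h > 1 - \<epsilon>"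
  obtains k :: nat and b where "k \<ge> 1" "b 0 = 0" "b M = real k"
    "\<And>l. l < M \<Longrightarrow> b l \<le> b (Suc l) \<and> b (Suc l) \<le> b l + 4 * \<epsilon>"
    "\<And>l. l \<le> M \<Longrightarrow> \<bar>zig (b l) - a l\<bar> \<le> 8 * \<epsilon>"
proof -
  obtain j \<tau> \<mu> b where L: "lifted_upto a \<epsilon> M j \<tau> \<mu> b"
    using lifted_upto_exists[OF \<epsilon> range step peaks start order_refl] by blast
  have L': "\<tau> \<le> \<mu>" "\<mu> \<le> M" "flip j (a \<tau>) \<le> \<epsilon>" "\<And>l. \<tau> \<le> l \<Longrightarrow> l \<le> M \<Longrightarrow> flip j (a l) < 1 - \<epsilon>"
    "b M = real j + flip j (a \<mu>)" "b 0 = a 0"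
    "\<And>l. l < M \<Longrightarrow> b l \<le> b (Suc l) \<and> b (Suc l) \<le> b l + 3 * \<epsilon>" "\<And>l. l \<le> M \<Longrightarrow> \<bar>zig (b l) - a l\<bar> \<le> 4 * \<epsilon>"
    using L unfolding lifted_upto_def by simp_all
  have pk: "high_peaks (\<lambda>l. flip j (a l)) M \<epsilon>" using peaks by (cases "even j") (simp_all add: flip_def)
  have last: "flip j (a \<mu>) \<le> 4 * \<epsilon>"
  proof (rule ccontr)
    assume "\<not> ?thesis"
    then have "\<tau> = 0 \<or> flip j (a \<tau>) + 3 * \<epsilon> < flip j (a \<mu>)" using L'(3) by linarith
    then obtain l where "\<tau> \<le> l" "l \<le> M" "flip j (a l) > 1 - \<epsilon>"
      by (rule high_peaksD[OF pk L'(1,2) order_refl _ disjI1[OF refl]])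
    then show False using L'(4)[of l] by simp
  qed
  have mono: "b l \<le> b l'" if "l \<le> l'" "l' \<le> M" for l l'
    using that
  proof (induction l')
    case (Suc l')
    then show ?case using L'(7)[of l'] by (cases "l = Suc l'") auto
  qed simp
  have m0: "0 \<le> flip j (a \<mu>)" using flip_range range[OF L'(2)] by blast
  have nonneg: "0 \<le> b l" if "l \<le> M" for l
    using mono[of 0 l] that L'(6) range[of 0] by simp
  have below: "b l \<le> real j + 4 * \<epsilon>" if "l \<le> M" for l
    using mono[OF that order_refl] L'(5) last by simp
  have j: "j \<ge> 1"
  proof (rule ccontr)
    assume "\<not> j \<ge> 1"
    then have "j = 0" by simp
    then have b: "0 \<le> b h" "b h \<le> 4 * \<epsilon>" using below[OF top(1)] nonneg[OF top(1)] by simp_all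
    then have "zig (b h) = b h" using \<epsilon> by simp
    then have "a h \<le> 8 * \<epsilon>" using L'(8)[OF top(1)] b by linarith
    then show False using top(2) \<epsilon> by linarith
  qed
  have M: "M > 0"
  proof (rule ccontr)
    assume "\<not> M > 0"
    then have "h = 0" using top(1) by simp
    then show False using top(2) start \<epsilon> by simp
  qed
  define b' where "b' l = (if l = 0 then 0 else min (b l) (real j))" for l
  show ?thesis
  proof (rule that[of j b'])
    show "j \<ge> 1" by (rule j)
    show "b' 0 = 0" by (simp add: b'_def)
    show "b' M = real j" using M L'(5) m0 by (simp add: b'_def)
    show "b' l \<le> b' (Suc l) \<and> b' (Suc l) \<le> b' l + 4 * \<epsilon>" if "l < M" for l
    proof (cases "l = 0")
      case True
      then show ?thesis using L'(7)[OF that] L'(6) start nonneg[of "Suc l"] that j by (simp add: b'_def min_def)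
    next
      case False
      then show ?thesis using L'(7)[OF that] \<epsilon> by (simp add: b'_def min_def)
    qed
    show "\<bar>zig (b' l) - a l\<bar> \<le> 8 * \<epsilon>" if "l \<le> M" for l
    proof (cases "l = 0")
      case True
      then show ?thesis using start range[of 0] \<epsilon> by (simp add: b'_def)
    next
      case False
      then have "\<bar>b' l - b l\<bar> \<le> 4 * \<epsilon>" using below[OF that] \<epsilon> by (simp add: b'_def min_def)
      then show ?thesis using zig_lipschitz[of "b' l" "b l"] L'(8)[OF that] by linarith
    qed
  qed
qed

lemma cell_of_point:
  assumes "0 \<le> v" "v \<le> 1" "M > 0"
  obtains l where "l < M" "real l / real M \<le> v" "v \<le> real (Suc l) / real M"
proof (cases "v = 1")
  case True
  show ?thesis by (rule that[of "M - 1"]) (use True assms in simp_all)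
next
  case False
  define l where "l = nat \<lfloor>v * real M\<rfloor>"
  have l: "real l \<le> v * real M" "v * real M < real l + 1"
    using assms by (simp_all add: l_def)
  have "v * real M < 1 * real M" using False assms by (intro mult_strict_right_mono) auto
  then have "l < M" using l by simp
  moreover have "real l / real M \<le> v" "v \<le> real (Suc l) / real M"
    using l assms(3) by (simp_all add: field_simps)
  ultimately show ?thesis by (rule that)
qed

lemma open_map_flip: "open_map unit_interval unit_interval (\<lambda>v. 1 - v)"
  unfolding open_map_def
proof (intro allI impI)
  fix U :: "real set" assume U: "openin unit_interval U"
  show "openin unit_interval ((\<lambda>v. 1 - v) ` U)"
  proof (rule openin_unit_intervalI)
    show "(\<lambda>v. 1 - v) ` U \<subseteq> {0..1}" using openin_imp_subset[OF U] by auto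
    fix v assume "v \<in> (\<lambda>v. 1 - v) ` U"
    then have "1 - v \<in> U" by auto
    then obtain e where e: "e > 0" "\<And>u. 0 \<le> u \<Longrightarrow> u \<le> 1 \<Longrightarrow> \<bar>u - (1 - v)\<bar> < e \<Longrightarrow> u \<in> U"
      using openin_unit_intervalD[OF U] by blast
    have "u \<in> (\<lambda>v. 1 - v) ` U" if "0 \<le> u" "u \<le> 1" "\<bar>u - v\<bar> < e" for u
      by (rule image_eqI[of _ _ "1 - u"]) (use e(2)[of "1 - u"] that in auto)
    then show "\<exists>e>0. \<forall>u. 0 \<le> u \<longrightarrow> u \<le> 1 \<longrightarrow> \<bar>u - v\<bar> < e \<longrightarrow> u \<in> (\<lambda>v. 1 - v) ` U"
      using e(1) by blast
  qed
qed

definition open_onto_interval :: "'a topology \<Rightarrow> ('a \<Rightarrow> real) \<Rightarrow> bool" where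
  "open_onto_interval X p \<longleftrightarrow> continuous_map X unit_interval p \<and> open_map X unit_interval p \<and>
     p ` topspace X = {0..1}"

lemma open_onto_interval_flip:
  assumes "open_onto_interval X p"
  shows "open_onto_interval X (\<lambda>x. 1 - p x)"
proof -
  have p: "continuous_map X unit_interval p" "open_map X unit_interval p" "p ` topspace X = {0..1}"
    using assms unfolding open_onto_interval_def by blast+
  have c: "continuous_map unit_interval unit_interval (\<lambda>v. 1 - v :: real)"
    by (auto simp: continuous_map_in_subtopology intro!: continuous_intros)
  have "(\<lambda>x. 1 - p x) ` topspace X = (\<lambda>v. 1 - v) ` {0..1}" unfolding p(3)[symmetric] by (simp add: image_image)
  also have "\<dots> = {0..1}" by (auto intro!: image_eqI[of _ _ "1 - _"])
  finally show ?thesis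
    using continuous_map_compose[OF p(1) c] open_map_compose[OF p(2) open_map_flip]
    unfolding open_onto_interval_def o_def by blast
qed

context tent_limit
begin

text \<open>Openness forbids shallow peaks: the maximum of \<open>p\<close> over the part of \<open>X\<close> above the block is
  attained away from those of its ends that are not exempt, hence at a point of the interior, and
  the open image of the interior has a greatest element only if this element is \<open>1\<close>.\<close>

lemma high_peaks_sample:
  assumes p: "open_onto_interval X p" and M: "M > 0"
    and close: "\<And>x y. x \<in> topspace X \<Longrightarrow> y \<in> topspace X \<Longrightarrow> \<bar>\<pi> x n - \<pi> y n\<bar> \<le> 1 / real M \<Longrightarrow> \<bar>p x - p y\<bar> < \<epsilon>"
    and \<xi>: "\<And>l. l \<le> M \<Longrightarrow> \<xi> l \<in> topspace X \<and> \<pi> (\<xi> l) n = real l / real M"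
  shows "high_peaks (\<lambda>l. p (\<xi> l)) M \<epsilon>"
  unfolding high_peaks_def
proof (intro allI impI, elim conjE)
  fix r \<mu> s
  assume r\<mu>: "r \<le> \<mu>" "\<mu> \<le> s" "s \<le> M" and rlow: "r = 0 \<or> p (\<xi> r) + 3 * \<epsilon> < p (\<xi> \<mu>)"
    and slow: "s = M \<or> p (\<xi> s) + 3 * \<epsilon> < p (\<xi> \<mu>)"
  have p': "continuous_map X unit_interval p" "open_map X unit_interval p" "p ` topspace X = {0..1}"
    using p unfolding open_onto_interval_def by blast+
  have preal: "continuous_map X euclideanreal p" using p'(1) continuous_map_into_fulltopology by blast
  have \<epsilon>: "\<epsilon> > 0" using close[of "\<xi> 0" "\<xi> 0"] \<xi>[of 0] M by simp
  \<comment> \<open>\<open>C\<close> is the closed block and \<open>W\<close> its interior, relative to the interval at the exempt ends\<close>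
  define C where "C = {x \<in> topspace X. \<pi> x n \<in> {real r / real M..real s / real M}}"
  define W where "W = {x \<in> topspace X. \<pi> x n \<in> {v \<in> {0..1}. (r = 0 \<or> real r / real M < v) \<and> (s = M \<or> v < real s / real M)}}"
  have cC: "closedin X C" unfolding C_def
    by (rule closedin_continuous_map_preimage[OF \<pi>_continuous_real]) simp
  have "compactin X C" by (rule closedin_compact_space[OF compact_Hausdorff(1) cC])
  then have "compactin euclideanreal (p ` C)" by (rule image_compactin[OF _ preal])
  then have pC: "compact (p ` C)" by simp
  have \<mu>C: "\<xi> \<mu> \<in> C"
    using \<xi>[of \<mu>] r\<mu> M by (simp add: C_def divide_right_mono)
  then have "p ` C \<noteq> {}" by blast
  from compact_attains_sup[OF pC this] obtain w where w: "w \<in> p ` C" "\<And>y. y \<in> p ` C \<Longrightarrow> y \<le> w"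
    by blast
  then obtain x where x: "x \<in> C" "\<And>y. y \<in> C \<Longrightarrow> p y \<le> p x" by blast
  have xX: "x \<in> topspace X" and xb: "real r / real M \<le> \<pi> x n" "\<pi> x n \<le> real s / real M"
    using x(1) by (auto simp: C_def)
  have px: "p x \<ge> p (\<xi> \<mu>)" using x(2)[OF \<mu>C] .
  have noend: "\<pi> x n \<noteq> real l / real M" if "l \<le> M" "p (\<xi> l) + 3 * \<epsilon> < p (\<xi> \<mu>)" for l
  proof
    assume "\<pi> x n = real l / real M"
    then have "\<bar>p x - p (\<xi> l)\<bar> < \<epsilon>" using close[OF xX, of "\<xi> l"] \<xi>[OF that(1)] by simp
    then show False using px that(2) \<epsilon> by linarith
  qed
  have "openin unit_interval {v \<in> {0..1}. (r = 0 \<or> real r / real M < v) \<and> (s = M \<or> v < real s / real M)}"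
  proof -
    have "open {v :: real. r = 0 \<or> real r / real M < v}"
    proof (cases "r = 0")
      case False
      then have "{v. r = 0 \<or> real r / real M < v} = {real r / real M<..}" by (simp add: greaterThan_def)
      then show ?thesis by (simp only: open_greaterThan)
    qed simp
    moreover have "open {v :: real. s = M \<or> v < real s / real M}"
    proof (cases "s = M")
      case False
      then have "{v. s = M \<or> v < real s / real M} = {..<real s / real M}" by (simp add: lessThan_def)
      then show ?thesis by (simp only: open_lessThan)
    qed simp
    ultimately have "open ({v. r = 0 \<or> real r / real M < v} \<inter> {v. s = M \<or> v < real s / real M})"
      by (rule open_Int)
    from openin_open_Int[OF this, of "{0..1}"] show ?thesis
      by (simp add: Int_def conj_assoc)
  qed
  then have "openin X W" unfolding W_def by (rule openin_continuous_map_preimage[OF \<pi>_continuous])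
  then have pW: "openin unit_interval (p ` W)" using p'(2) unfolding open_map_def by blast
  have "r = 0 \<or> real r / real M < \<pi> x n" using rlow noend[of r] r\<mu> xb(1) by (cases "r = 0") auto
  moreover have "s = M \<or> \<pi> x n < real s / real M" using slow noend[of s] r\<mu> xb(2) by (cases "s = M") auto
  ultimately have xW: "x \<in> W" unfolding W_def using xX \<pi>_range[OF xX] by simp
  have WC: "y \<in> C" if "y \<in> W" for y
  proof -
    have y: "y \<in> topspace X" "r = 0 \<or> real r / real M < \<pi> y n" "s = M \<or> \<pi> y n < real s / real M"
      using that by (auto simp: W_def)
    have "real r / real M \<le> \<pi> y n" using y(2) \<pi>_range(1)[OF y(1)] by auto
    moreover have "\<pi> y n \<le> real s / real M" using y(3) \<pi>_range(2)[OF y(1)] M by auto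
    ultimately show ?thesis using y(1) by (simp add: C_def)
  qed
  have "p x = 1"
  proof (rule ccontr)
    assume "p x \<noteq> 1"
    moreover have px01: "0 \<le> p x \<and> p x \<le> 1" using p'(3) xX by (metis atLeastAtMost_iff imageI)
    ultimately have lt: "p x < 1" by simp
    obtain e where e: "e > 0" "\<And>u. 0 \<le> u \<Longrightarrow> u \<le> 1 \<Longrightarrow> \<bar>u - p x\<bar> < e \<Longrightarrow> u \<in> p ` W"
      using openin_unit_intervalD[OF pW, of "p x"] xW by blast
    define u where "u = min 1 (p x + e / 2)"
    have u: "p x < u" "0 \<le> u" "u \<le> 1" "\<bar>u - p x\<bar> < e" using lt e(1) px01 by (auto simp: u_def)
    then obtain y where "y \<in> W" "u = p y" using e(2) by blast
    then show False using x(2)[OF WC] u(1) by force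
  qed
  obtain l where l: "r \<le> l" "l \<le> s" "\<bar>\<pi> x n - real l / real M\<bar> \<le> 1 / real M"
  proof (cases "\<pi> x n = real s / real M")
    case True
    then show ?thesis using r\<mu> by (intro that[of s]) simp_all
  next
    case False
    obtain l where l: "real l / real M \<le> \<pi> x n" "\<pi> x n \<le> real (Suc l) / real M"
      using cell_of_point[OF \<pi>_range(1)[OF xX] \<pi>_range(2)[OF xX] M] by blast
    have "real l / real M < real s / real M" using l(1) xb(2) False by linarith
    then have ls: "l < s" using M by (simp add: divide_less_cancel)
    show ?thesis
    proof (cases "r \<le> l")
      case True
      have "real (Suc l) / real M = real l / real M + 1 / real M" by (simp add: add_divide_distrib)
      then have "\<bar>\<pi> x n - real l / real M\<bar> \<le> 1 / real M" using l by linarith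
      then show ?thesis using True ls by (intro that[of l]) simp_all
    next
      case False
      then have "Suc l \<le> r" by simp
      then have "real (Suc l) / real M \<le> real r / real M" by (intro divide_right_mono) simp_all
      then have "\<pi> x n = real r / real M" using l(2) xb(1) by linarith
      then show ?thesis using r\<mu> by (intro that[of r]) simp_all
    qed
  qed
  have "l \<le> M" using l(2) r\<mu>(3) by simp
  then have "\<bar>p x - p (\<xi> l)\<bar> < \<epsilon>" using close[OF xX, of "\<xi> l"] \<xi>[of l] l(3) by simp
  then have "p (\<xi> l) > 1 - \<epsilon>" using \<open>p x = 1\<close> by linarith
  then show "\<exists>l. r \<le> l \<and> l \<le> s \<and> 1 - \<epsilon> < p (\<xi> l)" using l(1,2) by blast
qed

text \<open>The finite data to which the lifting construction applies: a sequence without shallow peaks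
  or valleys that approximates \<open>p\<close> as a function of the \<open>n\<close>-th coordinate.\<close>

definition good_sample :: "('k \<Rightarrow> real) \<Rightarrow> nat \<Rightarrow> real \<Rightarrow> nat \<Rightarrow> (nat \<Rightarrow> real) \<Rightarrow> bool" where
  "good_sample p n \<epsilon> M a \<longleftrightarrow> M > 0 \<and> (\<forall>l\<le>M. 0 \<le> a l \<and> a l \<le> 1) \<and> (\<forall>l<M. \<bar>a (Suc l) - a l\<bar> < \<epsilon>) \<and>
     high_peaks a M \<epsilon> \<and> high_peaks (\<lambda>l. 1 - a l) M \<epsilon> \<and> (\<exists>l\<le>M. a l > 1 - \<epsilon>) \<and>
     (\<forall>l<M. \<forall>x\<in>topspace X. real l / real M \<le> \<pi> x n \<and> \<pi> x n \<le> real (Suc l) / real M \<longrightarrow> \<bar>p x - a l\<bar> < \<epsilon>)"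

lemma good_sampleD:
  assumes "good_sample p n \<epsilon> M a"
  shows "M > 0" "\<And>l. l \<le> M \<Longrightarrow> 0 \<le> a l \<and> a l \<le> 1" "\<And>l. l < M \<Longrightarrow> \<bar>a (Suc l) - a l\<bar> < \<epsilon>"
    "high_peaks a M \<epsilon>" "high_peaks (\<lambda>l. 1 - a l) M \<epsilon>" "\<exists>l\<le>M. a l > 1 - \<epsilon>"
    "\<And>l x. l < M \<Longrightarrow> x \<in> topspace X \<Longrightarrow> real l / real M \<le> \<pi> x n \<Longrightarrow> \<pi> x n \<le> real (Suc l) / real M \<Longrightarrow> \<bar>p x - a l\<bar> < \<epsilon>"
  using assms unfolding good_sample_def by simp_all

lemma good_samples_exist:
  assumes p: "open_onto_interval X p" and \<epsilon>: "\<epsilon> > 0"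
  shows "\<exists>n0. \<forall>n\<ge>n0. \<exists>M a. good_sample p n \<epsilon> M a"
proof -
  have p': "continuous_map X unit_interval p" "p ` topspace X = {0..1}"
    using p unfolding open_onto_interval_def by blast+
  have "continuous_map X euclideanreal p" using p'(1) continuous_map_into_fulltopology by blast
  from uniformly_controlled[OF this \<epsilon>] obtain n0 where n0: "\<And>n. n \<ge> n0 \<Longrightarrow> \<exists>\<delta>>0. \<forall>x\<in>topspace X. \<forall>y\<in>topspace X.
      \<bar>\<pi> x n - \<pi> y n\<bar> \<le> \<delta> \<longrightarrow> \<bar>p x - p y\<bar> < \<epsilon>" by blast
  have "\<exists>M a. good_sample p n \<epsilon> M a"
    if n: "n \<ge> n0" for n
  proof -
    obtain \<delta> where \<delta>: "\<delta> > 0" "\<And>x y. x \<in> topspace X \<Longrightarrow> y \<in> topspace X \<Longrightarrow> \<bar>\<pi> x n - \<pi> y n\<bar> \<le> \<delta> \<Longrightarrow> \<bar>p x - p y\<bar> < \<epsilon>"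
      using n0[OF n] by blast
    obtain m where m: "1 / real (Suc m) < \<delta>" using nat_approx_posE[OF \<delta>(1)] by blast
    define M where "M = Suc m"
    have M: "M > 0" "1 / real M \<le> \<delta>" using m by (simp_all add: M_def)
    have close: "\<bar>p x - p y\<bar> < \<epsilon>" if "x \<in> topspace X" "y \<in> topspace X" "\<bar>\<pi> x n - \<pi> y n\<bar> \<le> 1 / real M" for x y
      by (rule \<delta>(2)[OF that(1,2) order_trans[OF that(3) M(2)]])
    have "\<exists>x. x \<in> topspace X \<and> \<pi> x n = real l / real M" if "l \<le> M" for l
      using \<pi>_surj[of "real l / real M" n] that M(1) by auto
    then obtain \<xi> where \<xi>: "\<And>l. l \<le> M \<Longrightarrow> \<xi> l \<in> topspace X \<and> \<pi> (\<xi> l) n = real l / real M" by metis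
    define a where "a l = p (\<xi> l)" for l
    have cell: "\<bar>p x - a l\<bar> < \<epsilon>"
      if x: "x \<in> topspace X" "l < M" "real l / real M \<le> \<pi> x n" "\<pi> x n \<le> real (Suc l) / real M" for x l
    proof -
      have "real (Suc l) / real M = real l / real M + 1 / real M" by (simp add: add_divide_distrib)
      then have "\<bar>\<pi> x n - real l / real M\<bar> \<le> 1 / real M" using x(3,4) by linarith
      then show ?thesis using close[OF x(1), of "\<xi> l"] \<xi>[of l] x(2) by (simp add: a_def)
    qed
    have "0 \<le> a l \<and> a l \<le> 1" if "l \<le> M" for l
    proof -
      have "a l \<in> p ` topspace X" using \<xi>[OF that] by (simp add: a_def)
      then show ?thesis unfolding p'(2) by simp
    qed
    moreover have "\<bar>a (Suc l) - a l\<bar> < \<epsilon>" if l: "l < M" for l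
    proof -
      have "\<bar>p (\<xi> (Suc l)) - a l\<bar> < \<epsilon>"
        by (rule cell) (use \<xi>[of "Suc l"] l in \<open>simp_all add: divide_right_mono\<close>)
      then show ?thesis by (simp add: a_def)
    qed
    moreover have "high_peaks a M \<epsilon>"
      using high_peaks_sample[OF p M(1) close \<xi>] unfolding a_def by blast
    moreover have "high_peaks (\<lambda>l. 1 - a l) M \<epsilon>"
      unfolding a_def
    proof (rule high_peaks_sample[OF open_onto_interval_flip[OF p] M(1) _ \<xi>])
      show "\<bar>1 - p x - (1 - p y)\<bar> < \<epsilon>" if "x \<in> topspace X" "y \<in> topspace X" "\<bar>\<pi> x n - \<pi> y n\<bar> \<le> 1 / real M" for x y
        using close[OF that] by simp
    qed
    moreover have "\<exists>l\<le>M. a l > 1 - \<epsilon>"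
    proof -
      have "1 \<in> p ` topspace X" unfolding p'(2) by simp
      then obtain x where x: "x \<in> topspace X" "p x = 1" by force
      obtain l where l: "l < M" "real l / real M \<le> \<pi> x n" "\<pi> x n \<le> real (Suc l) / real M"
        using cell_of_point[OF \<pi>_range(1)[OF x(1)] \<pi>_range(2)[OF x(1)] M(1)] by blast
      have "\<bar>p x - a l\<bar> < \<epsilon>" by (rule cell[OF x(1) l])
      then show ?thesis using x(2) l(1) by (intro exI[of _ l]) simp
    qed
    ultimately have "good_sample p n \<epsilon> M a" unfolding good_sample_def using M(1) cell by simp
    then show ?thesis by blast
  qed
  then show ?thesis by blast
qed

text \<open>The endpoint of the continuum sits at the left end of the time line, where samples without
  shallow peaks and valleys start near \<open>0\<close> or \<open>1\<close>.\<close>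

lemma open_onto_interval_endpoint:
  assumes p: "open_onto_interval X p" and e: "e \<in> topspace X" "\<And>n. \<pi> e n = 0"
  shows "p e = 0 \<or> p e = 1"
proof (rule ccontr)
  assume ne: "\<not> ?thesis"
  have "p e \<in> p ` topspace X" using e(1) by simp
  then have "p e \<in> {0..1}" using p unfolding open_onto_interval_def by blast
  then have pe: "0 < p e" "p e < 1" using ne by auto
  define \<epsilon> where "\<epsilon> = min (p e) (1 - p e) / 10"
  have \<epsilon>: "\<epsilon> > 0" "10 * \<epsilon> \<le> p e" "10 * \<epsilon> \<le> 1 - p e" using pe by (simp_all add: \<epsilon>_def)
  obtain n0 where "\<forall>n\<ge>n0. \<exists>M a. good_sample p n \<epsilon> M a"
    using good_samples_exist[OF p \<epsilon>(1)] by blast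
  then obtain M a where "good_sample p n0 \<epsilon> M a" by blast
  note a = good_sampleD[OF this]
  have "\<bar>p e - a 0\<bar> < \<epsilon>" using a(7)[OF a(1) e(1)] e(2) by simp
  moreover have "a 0 \<le> 4 * \<epsilon> \<or> a 0 \<ge> 1 - 4 * \<epsilon>" using high_peaks_start[OF a(4,5) _ _ \<epsilon>(1)] a(6) by blast
  ultimately show False using \<epsilon> by linarith
qed

text \<open>For large \<open>n\<close> the map \<open>p\<close> is nearly a function of the \<open>n\<close>-th coordinate. Sampling it on a
  fine grid gives a sequence without shallow peaks and valleys, whose monotone lift is
  interpolated linearly.\<close>

theorem open_map_approximation:
  assumes p: "open_onto_interval X p" and e: "\<And>x. x \<in> topspace X \<Longrightarrow> (\<And>n. \<pi> x n = 0) \<Longrightarrow> p x = 0"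
    and \<epsilon>: "\<epsilon> > 0"
  shows "\<exists>n0. \<forall>n\<ge>n0. \<exists>k H. k \<ge> 1 \<and> lift (real (D n)) (real k) H \<and>
     (\<forall>x\<in>topspace X. \<bar>zig (H (real (D n) * \<pi> x n)) - p x\<bar> < \<epsilon>)"
proof -
  define \<eta> where "\<eta> = min (\<epsilon> / 20) (1 / 100)"
  have \<eta>: "0 < \<eta>" "\<eta> < 1/20" "20 * \<eta> \<le> \<epsilon>" using \<epsilon> by (simp_all add: \<eta>_def)
  obtain n0 where n0: "\<And>n. n \<ge> n0 \<Longrightarrow> \<exists>M a. good_sample p n \<eta> M a"
    using good_samples_exist[OF p \<eta>(1)] by blast
  obtain e where e0: "e \<in> topspace X" "\<And>n. \<pi> e n = 0"
    using \<pi>_thread_point[of 0] by auto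
  have pe: "p e = 0" by (rule e[OF e0])
  have "\<exists>k H. k \<ge> 1 \<and> lift (real (D n)) (real k) H \<and>
     (\<forall>x\<in>topspace X. \<bar>zig (H (real (D n) * \<pi> x n)) - p x\<bar> < \<epsilon>)" if n: "n \<ge> n0" for n
  proof -
    obtain M a where "good_sample p n \<eta> M a" using n0[OF n] by blast
    note a = good_sampleD[OF this]
    obtain h where h: "h \<le> M" "a h > 1 - \<eta>" using a(6) by blast
    have "\<bar>p e - a 0\<bar> < \<eta>" using a(7)[OF a(1) e0(1)] e0(2) by simp
    then have a0: "a 0 \<le> \<eta>" unfolding pe by simp
    obtain k b where k: "k \<ge> 1" and b: "b 0 = 0" "b M = real k"
      "\<And>l. l < M \<Longrightarrow> b l \<le> b (Suc l) \<and> b (Suc l) \<le> b l + 4 * \<eta>"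
      "\<And>l. l \<le> M \<Longrightarrow> \<bar>zig (b l) - a l\<bar> \<le> 8 * \<eta>"
      using monotone_lift_exists[OF \<eta>(1,2) a(2,3,4,5) a0 h] by blast
    \<comment> \<open>so that the linear part changes values by at most \<open>\<eta>\<close>\<close>
    define c where "c = \<eta> / real k"
    have c: "0 < c" "c < 1" "c * real k = \<eta>"
    proof -
      show "0 < c" using \<eta>(1) k by (simp add: c_def)
      have "\<eta> < 1 * real k" using \<eta>(2) k by simp
      then show "c < 1" using k by (simp add: c_def divide_less_eq)
      show "c * real k = \<eta>" using k by (simp add: c_def)
    qed
    define u where "u l = real (D n) * (real l / real M)" for l
    \<comment> \<open>mixing in a small linear part makes the lift strictly increasing and keeps its ends\<close>
    define v where "v l = (1 - c) * b l + c * (real k * (real l / real M))" for l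
    have bmono: "b l \<le> b l'" if "l \<le> l'" "l' \<le> M" for l l'
      using that
    proof (induction l')
      case (Suc l')
      then show ?case using b(3)[of l'] by (cases "l = Suc l'") auto
    qed simp
    have bk: "0 \<le> b l" "b l \<le> real k" if "l \<le> M" for l
      using bmono[of 0 l] bmono[of l M] that b(1,2) by auto
    have vb: "\<bar>v l - b l\<bar> \<le> \<eta>" if l: "l \<le> M" for l
    proof -
      have "v l - b l = c * (real k * (real l / real M) - b l)" by (simp add: v_def algebra_simps)
      moreover have "\<bar>real k * (real l / real M) - b l\<bar> \<le> real k"
      proof -
        have "0 \<le> real l / real M" "real l / real M \<le> 1" using l a(1) by simp_all
        then have "0 \<le> real k * (real l / real M)" "real k * (real l / real M) \<le> real k * 1"
          by (simp, intro mult_left_mono) simp_all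
        then show ?thesis using bk[OF l] by linarith
      qed
      ultimately have "\<bar>v l - b l\<bar> \<le> c * real k" using c(1) by (simp add: abs_mult)
      then show ?thesis using c(3) by simp
    qed
    have MM: "real M / real M = 1" using a(1) by simp
    have frac_less: "real l / real M < real (Suc l) / real M" for l
      by (rule divide_strict_right_mono) (use a(1) in simp_all)
    have u_ends: "u 0 = 0" "u M = real (D n)" unfolding u_def MM by simp_all
    have uless: "u l < u (Suc l)" if "l < M" for l
      unfolding u_def by (rule mult_strict_left_mono[OF frac_less D_real_pos])
    have v_ends: "v 0 = 0" "v M = real k"
      unfolding v_def MM b(1,2) by (simp, simp only: left_diff_distrib mult_1 mult_1_right diff_add_cancel)
    have vless: "v l < v (Suc l)" if "l < M" for l
    proof -
      have "(1 - c) * b l \<le> (1 - c) * b (Suc l)"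
        by (rule mult_left_mono) (use b(3)[OF that] c(2) in simp_all)
      moreover have "c * (real k * (real l / real M)) < c * (real k * (real (Suc l) / real M))"
        by (rule mult_strict_left_mono[OF mult_strict_left_mono[OF frac_less] c(1)]) (use k in simp)
      ultimately show ?thesis unfolding v_def by (rule add_le_less_mono)
    qed
    obtain H where H: "lift (real (D n)) (real k) H" "\<And>l. l \<le> M \<Longrightarrow> H (u l) = v l"
      using piecewise_linear_lift[where u=u and v=v, OF a(1) u_ends uless v_ends vless] by blast
    have "\<bar>zig (H (real (D n) * \<pi> x n)) - p x\<bar> < \<epsilon>" if x: "x \<in> topspace X" for x
    proof -
      obtain l where l: "l < M" "real l / real M \<le> \<pi> x n" "\<pi> x n \<le> real (Suc l) / real M"
        using cell_of_point[OF \<pi>_range(1)[OF x] \<pi>_range(2)[OF x] a(1)] by blast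
      define t where "t = real (D n) * \<pi> x n"
      have ut: "u l \<le> t" "t \<le> u (Suc l)"
        unfolding u_def t_def by (rule mult_left_mono[OF l(2)], simp, rule mult_left_mono[OF l(3)], simp)
      have "H (u l) \<le> H t" "H t \<le> H (u (Suc l))" unfolding lift_le[OF H(1)] by (rule ut)+
      then have "v l \<le> H t" "H t \<le> v (Suc l)" using H(2)[of l] H(2)[of "Suc l"] l(1) by simp_all
      then have "\<bar>H t - b l\<bar> \<le> 5 * \<eta>"
        using vb[of l] vb[of "Suc l"] b(3)[OF l(1)] l(1) unfolding abs_le_iff by simp
      then have "\<bar>zig (H t) - zig (b l)\<bar> \<le> 5 * \<eta>" using zig_lipschitz order_trans by blast
      moreover have "\<bar>zig (b l) - a l\<bar> \<le> 8 * \<eta>" using b(4) l(1) by simp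
      moreover have "\<bar>p x - a l\<bar> < \<eta>" by (rule a(7)[OF l(1) x l(2,3)])
      ultimately have "\<bar>zig (H t) - p x\<bar> < 20 * \<eta>" using \<eta>(1) by linarith
      then show ?thesis using \<eta>(3) unfolding t_def by linarith
    qed
    then show ?thesis using k H(1) by blast
  qed
  then show ?thesis by blast
qed

end

section \<open>The degree of an open map onto the interval\<close>

text \<open>\<open>fs n\<close> is chosen as good as possible among the accuracies \<open>j \<le> n\<close>; the default value
  serves the small \<open>n\<close> at which no accuracy is available.\<close>

lemma diagonal_choice:
  fixes E :: "nat \<Rightarrow> nat \<Rightarrow> 'a \<Rightarrow> bool"
  assumes anti: "\<And>n j i f. E n j f \<Longrightarrow> i \<le> j \<Longrightarrow> E n i f"
    and ev: "\<And>j. \<exists>n0. \<forall>n\<ge>n0. \<exists>f. P f \<and> E n j f" and default: "P f0"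
  shows "\<exists>fs. (\<forall>n. P (fs n)) \<and> (\<forall>j. eventually (\<lambda>n. E n j (fs n)) sequentially)"
proof -
  have "\<exists>f. P f \<and> (\<forall>j\<le>n. (\<exists>f'. P f' \<and> E n j f') \<longrightarrow> E n j f)" for n
  proof (cases "\<exists>j\<le>n. \<exists>f'. P f' \<and> E n j f'")
    case True
    define J where "J = {j. j \<le> n \<and> (\<exists>f'. P f' \<and> E n j f')}"
    have J: "finite J" "J \<noteq> {}" using True by (auto simp: J_def)
    have "Max J \<in> J" using Max_in[OF J] .
    then obtain f where f: "P f" "E n (Max J) f" by (auto simp: J_def)
    have "E n j f" if "j \<le> n" "\<exists>f'. P f' \<and> E n j f'" for j
      by (rule anti[OF f(2)], rule Max_ge[OF J(1)]) (use that in \<open>simp add: J_def\<close>)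
    then show ?thesis using f(1) by blast
  next
    case False
    then show ?thesis using default by blast
  qed
  then obtain fs where fs: "\<And>n. P (fs n)" "\<And>n j. j \<le> n \<Longrightarrow> \<exists>f'. P f' \<and> E n j f' \<Longrightarrow> E n j (fs n)"
    by metis
  have "eventually (\<lambda>n. E n j (fs n)) sequentially" for j
  proof -
    obtain n0 where n0: "\<And>n. n \<ge> n0 \<Longrightarrow> \<exists>f. P f \<and> E n j f" using ev by blast
    have "E n j (fs n)" if "n \<ge> max n0 j" for n using fs(2)[of j n] n0[of n] that by simp
    then show ?thesis unfolding eventually_sequentially by blast
  qed
  then show ?thesis using fs(1) by blast
qed

context tent_limit
begin

lemma coordinate_open_onto: "open_onto_interval X (\<lambda>x. \<pi> x n)"
  unfolding open_onto_interval_def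
proof (intro conjI \<pi>_continuous \<pi>_open equalityI subsetI)
  show "v \<in> {0..1}" if "v \<in> (\<lambda>x. \<pi> x n) ` topspace X" for v using that \<pi>_range by auto
  show "v \<in> (\<lambda>x. \<pi> x n) ` topspace X" if "v \<in> {0..1}" for v
    using \<pi>_surj[of v n] that by auto
qed

lemma time_change:
  assumes x: "x \<in> topspace X" and "i \<le> n" and H: "equivariant (real (D i)) (real k * b) H" and b: "b \<noteq> 0"
  shows "zig (H (real (D i) * \<pi> x i) / b) = zig (H (real (D n) * \<pi> x n) / b)"
  unfolding \<pi>_zig[OF x \<open>i \<le> n\<close>]
  by (rule zig_equivariant[OF H _ b]) (use D_pos[of i] in simp)

text \<open>The constant \<open>1/4\<close> is half of the \<open>1/2\<close> below which the number of laps of an open map is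
  stable, so two approximations of \<open>p\<close> can be compared with each other.\<close>

definition approximates :: "('k \<Rightarrow> real) \<Rightarrow> nat \<Rightarrow> nat \<Rightarrow> (real \<Rightarrow> real) \<Rightarrow> bool" where
  "approximates p i k H \<longleftrightarrow> k \<ge> 1 \<and> lift (real (D i)) (real k) H \<and>
     (\<forall>x\<in>topspace X. \<bar>zig (H (real (D i) * \<pi> x i)) - p x\<bar> < 1/4)"

text \<open>At level \<open>n \<ge> i\<close> both \<open>fs n\<close> and the folded lift are within \<open>1/4\<close> of \<open>p\<close>, so they have
  equally many laps; the lift has \<open>k * D n / D i\<close> of them.\<close>

lemma eventually_degree:
  assumes H: "approximates p i k H" and fs: "\<And>n. pointed_open_map (fs n)"
    and lim: "uniform_limit (topspace X) (\<lambda>n x. fs n (\<pi> x n)) p sequentially"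
  shows "eventually (\<lambda>n. real (interval_degree (fs n)) / real (D n) = real k / real (D i)) sequentially"
proof -
  have k: "k \<ge> 1" and L: "lift (real (D i)) (real k) H"
    and close: "\<And>x. x \<in> topspace X \<Longrightarrow> \<bar>zig (H (real (D i) * \<pi> x i)) - p x\<bar> < 1/4"
    using H unfolding approximates_def by blast+
  have "eventually (\<lambda>n. \<forall>x\<in>topspace X. dist (fs n (\<pi> x n)) (p x) < 1/4) sequentially"
    using lim[unfolded uniform_limit_iff, THEN spec, of "1/4"] by simp
  moreover have "eventually (\<lambda>n. n \<ge> i) sequentially" by (rule eventually_ge_at_top)
  ultimately show ?thesis
  proof eventually_elim
    case (elim n)
    obtain r where r: "r > 0" "D n = r * D i" "real (D n) / real (D i) = real r"
      using D_ratio[OF elim(2)] by blast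
    have rDn: "real r * real (D i) = real (D n)" using r(2) by simp
    have "lift (real (D n)) (real r * real k) H" using lift_multiple[OF L, of r] unfolding rDn .
    moreover have "lift 1 (real (D n)) (\<lambda>y. real (D n) * y)" using lift_scale[OF D_real_pos, of 1 n] by simp
    ultimately have L1: "lift 1 (real (r * k)) (\<lambda>y. H (real (D n) * y))"
      using lift_compose by fastforce
    have rk: "r * k > 0" using r(1) k by simp
    have "interval_degree (fs n) = interval_degree (\<lambda>y. zig (H (real (D n) * y)))"
    proof (rule interval_degree_close[OF fs pointed_open_map_zig_lift[OF L1]])
      fix t :: real assume "0 \<le> t" "t \<le> 1"
      then obtain x where x: "x \<in> topspace X" "\<pi> x n = t" using \<pi>_surj by blast
      have "equivariant (real (D i)) (real k * 1) H" using L by (simp add: lift_def)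
      from time_change[OF x(1) elim(2) this]
      have "zig (H (real (D i) * \<pi> x i)) = zig (H (real (D n) * t))" using x(2) by simp
      moreover have "\<bar>fs n t - p x\<bar> < 1/4" using elim(1) x unfolding dist_real_def by blast
      ultimately show "\<bar>fs n t - zig (H (real (D n) * t))\<bar> < 1/2" using close[OF x(1)] by linarith
    qed
    also have "\<dots> = r * k" by (rule interval_degree_zig_lift[OF L1 rk])
    finally show ?case using r(1) unfolding r(2) by simp
  qed
qed

lemma approximants_exist:
  assumes p: "open_onto_interval X p" and e: "\<And>x. x \<in> topspace X \<Longrightarrow> (\<And>n. \<pi> x n = 0) \<Longrightarrow> p x = 0"
  obtains fs where "\<And>n. pointed_open_map (fs n)"
    "uniform_limit (topspace X) (\<lambda>n x. fs n (\<pi> x n)) p sequentially"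
proof -
  define E where "E n j f \<longleftrightarrow> (\<forall>x\<in>topspace X. \<bar>f (\<pi> x n) - p x\<bar> < 1 / real (Suc j))"
    for n j :: nat and f :: "real \<Rightarrow> real"
  have ev: "\<exists>n0. \<forall>n\<ge>n0. \<exists>f. pointed_open_map f \<and> E n j f" for j
  proof -
    have "1 / real (Suc j) > 0" by simp
    from open_map_approximation[OF p e this] obtain n0 where n0: "\<And>n. n \<ge> n0 \<Longrightarrow>
      \<exists>k H. k \<ge> 1 \<and> lift (real (D n)) (real k) H \<and>
        (\<forall>x\<in>topspace X. \<bar>zig (H (real (D n) * \<pi> x n)) - p x\<bar> < 1 / real (Suc j))" by blast
    have "\<exists>f. pointed_open_map f \<and> E n j f" if n: "n \<ge> n0" for n
    proof -
      obtain k H where H: "lift (real (D n)) (real k) H"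
        "\<forall>x\<in>topspace X. \<bar>zig (H (real (D n) * \<pi> x n)) - p x\<bar> < 1 / real (Suc j)" using n0[OF n] by blast
      have "lift 1 (real (D n)) (\<lambda>y. real (D n) * y)" using lift_scale[OF D_real_pos, of 1 n] by simp
      from lift_compose[OF H(1) this] have "pointed_open_map (\<lambda>y. zig (H (real (D n) * y)))"
        by (rule pointed_open_map_zig_lift)
      moreover have "E n j (\<lambda>y. zig (H (real (D n) * y)))" using H(2) unfolding E_def .
      ultimately show ?thesis by blast
    qed
    then show ?thesis by blast
  qed
  have anti: "E n i f" if "E n j f" "i \<le> j" for n j i f
  proof -
    have "1 / real (Suc j) \<le> 1 / real (Suc i)" using that(2) by (intro divide_left_mono) auto
    then show ?thesis using that(1) unfolding E_def by (meson order_less_le_trans)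
  qed
  have "lift 1 (real 1) (\<lambda>x. x)" using lift_id[of 1] by simp
  then have default: "pointed_open_map (\<lambda>x. zig x)" by (rule pointed_open_map_zig_lift)
  have "\<exists>fs. (\<forall>n. pointed_open_map (fs n)) \<and> (\<forall>j. eventually (\<lambda>n. E n j (fs n)) sequentially)"
  proof (rule diagonal_choice[of E])
    show "E n i f" if "E n j f" "i \<le> j" for n j i f using that by (rule anti)
    show "\<exists>n0. \<forall>n\<ge>n0. \<exists>f. pointed_open_map f \<and> E n j f" for j by (rule ev)
    show "pointed_open_map (\<lambda>x. zig x)" by (rule default)
  qed
  then obtain fs where fs: "\<And>n. pointed_open_map (fs n)" "\<And>j. eventually (\<lambda>n. E n j (fs n)) sequentially"
    by blast
  have "uniform_limit (topspace X) (\<lambda>n x. fs n (\<pi> x n)) p sequentially"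
    unfolding uniform_limit_iff
  proof (intro allI impI)
    fix \<epsilon> :: real assume "\<epsilon> > 0"
    then obtain j where j: "1 / real (Suc j) < \<epsilon>" using nat_approx_posE by blast
    show "eventually (\<lambda>n. \<forall>x\<in>topspace X. dist (fs n (\<pi> x n)) (p x) < \<epsilon>) sequentially"
      using fs(2)[of j]
    proof eventually_elim
      case (elim n)
      then show ?case using j unfolding E_def dist_real_def by fastforce
    qed
  qed
  then show ?thesis using fs(1) that by blast
qed

text \<open>Both \<open>k / D i\<close> and \<open>k' / D i'\<close> are the eventual number of laps per unit of time of one
  sequence of open maps converging to \<open>p\<close>.\<close>

lemma approximates_unique:
  assumes p: "open_onto_interval X p" and e: "\<And>x. x \<in> topspace X \<Longrightarrow> (\<And>n. \<pi> x n = 0) \<Longrightarrow> p x = 0"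
    and H: "approximates p i k H" and H': "approximates p i' k' H'"
  shows "k * D i' = k' * D i"
proof -
  obtain fs where fs: "\<And>n. pointed_open_map (fs n)"
    "uniform_limit (topspace X) (\<lambda>n x. fs n (\<pi> x n)) p sequentially"
    using approximants_exist[OF p e] by blast
  from eventually_conj[OF eventually_degree[OF H fs] eventually_degree[OF H' fs]]
  obtain n where "real (interval_degree (fs n)) / real (D n) = real k / real (D i)"
    "real (interval_degree (fs n)) / real (D n) = real k' / real (D i')"
    unfolding eventually_sequentially by blast
  then have "real k / real (D i) = real k' / real (D i')" by simp
  then have "real k * real (D i') = real k' * real (D i)"
    using D_real_pos[of i] D_real_pos[of i'] by (simp add: frac_eq_eq)
  then have "real (k * D i') = real (k' * D i)" by simp
  then show ?thesis by (simp only: of_nat_eq_iff)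
qed

lemma bond_tent: "bond (\<lambda>n. tent_map (d n)) 0 (Suc n) x = zig (real (D (Suc n)) * x)"
proof (induction n arbitrary: x)
  case 0
  then show ?case by (simp add: bond_Suc tent_map_zig D_Suc)
next
  case (Suc n)
  have "bond (\<lambda>n. tent_map (d n)) 0 (Suc (Suc n)) x = bond (\<lambda>n. tent_map (d n)) 0 (Suc n) (tent_map (d (Suc n)) x)"
    by (simp add: bond_Suc[of 0 "Suc n"])
  also have "\<dots> = zig (real (D (Suc n)) * zig (real (d (Suc n)) * x))"
    unfolding Suc.IH by (simp add: tent_map_zig)
  also have "\<dots> = zig (real (D (Suc n)) * (real (d (Suc n)) * x))" by (rule zig_mult)
  also have "real (D (Suc n)) * (real (d (Suc n)) * x) = real (D (Suc (Suc n))) * x"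
    by (simp add: D_Suc[of "Suc n"])
  finally show ?case .
qed

lemma bond_degree: "interval_degree (bond (\<lambda>n. tent_map (d n)) 0 (Suc n)) = D (Suc n)"
proof -
  have "lift 1 (real (D (Suc n))) (\<lambda>y. real (D (Suc n)) * y)" using lift_scale[OF D_real_pos, of 1 "Suc n"] by simp
  from interval_degree_zig_lift[OF this D_pos] show ?thesis
    unfolding bond_tent[abs_def, symmetric] .
qed

text \<open>The defining description of the degree is satisfied by exactly one number because all
  approximating sequences have the same eventual ratio. In particular a single folded lift within
  \<open>1/4\<close> determines the degree.\<close>

lemma knaster_degree_eq:
  assumes p: "open_onto_interval X (\<lambda>x. \<pi> (f x) 0)"
    and e: "\<And>x. x \<in> topspace X \<Longrightarrow> (\<And>n. \<pi> x n = 0) \<Longrightarrow> \<pi> (f x) 0 = 0"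
    and H: "approximates (\<lambda>x. \<pi> (f x) 0) i k H"
  shows "knaster_degree X d \<pi> f = real k / real (D i)"
  unfolding knaster_degree_def
proof (rule the_equality)
  let ?ratio = "\<lambda>fs n. real (interval_degree (fs n)) / real (interval_degree (bond (\<lambda>n. tent_map (d n)) 0 n))"
  have lim: "?ratio fs \<longlonglongrightarrow> real k / real (D i)"
    if fs: "\<And>n. pointed_open_map (fs n)" "uniform_limit (topspace X) (\<lambda>n x. fs n (\<pi> x n)) (\<lambda>x. \<pi> (f x) 0) sequentially" for fs
  proof (rule tendsto_eventually)
    have "eventually (\<lambda>n. n \<ge> 1) sequentially" by (rule eventually_ge_at_top)
    with eventually_degree[OF H fs]
    show "eventually (\<lambda>n. ?ratio fs n = real k / real (D i)) sequentially"
    proof eventually_elim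
      case (elim n)
      then obtain m where "n = Suc m" by (cases n) auto
      then show ?case using elim(1) by (simp only: bond_degree)
    qed
  qed
  obtain fs where fs: "\<And>n. pointed_open_map (fs n)"
    "uniform_limit (topspace X) (\<lambda>n x. fs n (\<pi> x n)) (\<lambda>x. \<pi> (f x) 0) sequentially"
    using approximants_exist[OF p e] by blast
  show "\<exists>fs. (\<forall>i. pointed_open_map (fs i)) \<and>
      uniform_limit (topspace X) (\<lambda>i x. fs i (\<pi> x i)) (\<lambda>x. \<pi> (f x) 0) sequentially \<and>
      ?ratio fs \<longlonglongrightarrow> real k / real (D i)"
    using fs lim[OF fs] by blast
  fix r assume "\<exists>fs. (\<forall>i. pointed_open_map (fs i)) \<and>
      uniform_limit (topspace X) (\<lambda>i x. fs i (\<pi> x i)) (\<lambda>x. \<pi> (f x) 0) sequentially \<and>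
      ?ratio fs \<longlonglongrightarrow> r"
  then obtain gs where gs: "\<And>i. pointed_open_map (gs i)"
    "uniform_limit (topspace X) (\<lambda>i x. gs i (\<pi> x i)) (\<lambda>x. \<pi> (f x) 0) sequentially" "?ratio gs \<longlonglongrightarrow> r"
    by blast
  show "r = real k / real (D i)" using LIMSEQ_unique[OF gs(3) lim[OF gs(1,2)]] .
qed

lemma homeo_coordinate:
  assumes "f \<in> homeos X"
  shows "open_onto_interval X (\<lambda>x. \<pi> (f x) n)"
proof -
  have h: "homeomorphic_map X X f" using assms by (simp add: homeos_def)
  have f: "continuous_map X X f" "open_map X X f" "f ` topspace X = topspace X"
    using h by (simp_all add: homeomorphic_imp_continuous_map homeomorphic_imp_open_map homeomorphic_imp_surjective_map)
  note c = coordinate_open_onto[of n, unfolded open_onto_interval_def]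
  have "(\<lambda>x. \<pi> (f x) n) ` topspace X = (\<lambda>x. \<pi> x n) ` (f ` topspace X)" by (simp add: image_image)
  also have "\<dots> = {0..1}" unfolding f(3) using c by blast
  finally show ?thesis unfolding open_onto_interval_def
    using continuous_map_compose[OF f(1), of unit_interval "\<lambda>x. \<pi> x n"]
      open_map_compose[OF f(2), of unit_interval "\<lambda>x. \<pi> x n"] c
    by (simp add: o_def)
qed

text \<open>A tent map of even degree sends \<open>1\<close> to \<open>0\<close>, so infinitely many even degrees leave the
  endpoint as the only point all of whose coordinates are \<open>0\<close> or \<open>1\<close>.\<close>

lemma vanishing_coordinates:
  assumes even: "\<And>N. \<exists>n\<ge>N. even (d n)" and y: "y \<in> topspace X" "\<And>n. \<pi> y n = 0 \<or> \<pi> y n = 1"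
  shows "\<pi> y n = 0"
proof -
  obtain m where m: "m \<ge> n" "even (d m)" using even by blast
  have "\<pi> y m = zig (real (d m) * \<pi> y (Suc m))" using \<pi>_Y[OF y(1)] Y_iff by blast
  also have "\<dots> = 0"
  proof (cases "\<pi> y (Suc m) = 0")
    case False
    then have "\<pi> y (Suc m) = 1" using y(2) by blast
    then show ?thesis using zig_of_int[of "int (d m)"] m(2) by simp
  qed simp
  finally have "\<pi> y m = 0" .
  then show ?thesis using \<pi>_zig[OF y(1) m(1)] by simp
qed

lemma homeo_endpoint:
  assumes even: "\<And>N. \<exists>n\<ge>N. even (d n)" and f: "f \<in> homeos X"
    and x: "x \<in> topspace X" "\<And>n. \<pi> x n = 0"
  shows "\<pi> (f x) n = 0"
proof (rule vanishing_coordinates[OF even])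
  have "homeomorphic_map X X f" using f by (simp add: homeos_def)
  then have "f ` topspace X = topspace X" by (rule homeomorphic_imp_surjective_map)
  then show "f x \<in> topspace X" using x(1) by blast
  show "\<pi> (f x) n = 0 \<or> \<pi> (f x) n = 1" for n
    using open_onto_interval_endpoint[OF homeo_coordinate[OF f] x] .
qed

end

section \<open>Parity of the degrees in a universal Knaster continuum\<close>

lemma (in tent_limit) D_odd:
  assumes "\<And>n. n \<ge> N \<Longrightarrow> odd (d n)" "N \<le> n"
  shows "\<exists>r. odd r \<and> D n = r * D N"
  using assms(2)
proof (induction n)
  case 0
  then show ?case by (intro exI[of _ 1]) simp
next
  case (Suc n)
  show ?case
  proof (cases "N = Suc n")
    case True
    then show ?thesis by (intro exI[of _ 1]) simp
  next
    case False
    then have "N \<le> n" using Suc by simp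
    then obtain r where "odd r" "D n = r * D N" using Suc by blast
    then show ?thesis using assms(1)[OF \<open>N \<le> n\<close>] by (intro exI[of _ "d n * r"]) (simp add: D_Suc)
  qed
qed

lemma tent_limit_dyadic:
  "tent_limit (inverse_limit (\<lambda>n. unit_interval) (\<lambda>n. tent_map 2)) (\<lambda>_. 2) (\<lambda>x. x)"
proof
  show "tent_presentation (inverse_limit (\<lambda>n. unit_interval) (\<lambda>n. tent_map 2)) (\<lambda>_. 2) (\<lambda>x. x)"
    unfolding tent_presentation_def
    using homeomorphic_map_id[of "inverse_limit (\<lambda>n. unit_interval) (\<lambda>n. tent_map 2)"] by (simp add: id_def)
qed

lemma knaster_continuum_dyadic:
  "knaster_continuum (inverse_limit (\<lambda>n. unit_interval) (\<lambda>n. tent_map 2))"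
  unfolding knaster_continuum_def
proof (intro exI[of _ "\<lambda>_. tent_map 2"] conjI allI homeomorphic_space_refl)
  have t: "tent_map 2 = (\<lambda>x. zig (2 * x))" by (simp add: fun_eq_iff tent_map_zig)
  have "lift 1 (real 2) (\<lambda>x. 2 * x)" using lift_scale[of 2 1] by simp
  from pointed_open_map_zig_lift[OF this] show "pointed_open_map (tent_map 2)" unfolding t .
  show "tent_map 2 ` {0..1} = {0..1}"
  proof (intro equalityI subsetI)
    show "v \<in> {0..1}" if "v \<in> tent_map 2 ` {0..1}" for v using that zig_range by (auto simp: t)
    show "v \<in> tent_map 2 ` {0..1}" if "v \<in> {0..1}" for v
      by (rule image_eqI[of _ _ "v / 2"]) (use that in \<open>auto simp: t\<close>)
  qed
qed

text \<open>Universality is used through an open map \<open>q\<close> onto the dyadic Knaster continuum. Its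
  coordinate \<open>0\<close> is the tent map of degree \<open>2 ^ j\<close> applied to its coordinate \<open>j\<close>, so the degree of
  the former, a fixed ratio \<open>k0 / D i0\<close>, is also of the form \<open>2 ^ j * k / D i\<close>, for every \<open>j\<close>. If
  all \<open>d n\<close> were odd from \<open>N\<close> on, the denominators would contain only the powers of two of \<open>D N\<close>,
  and \<open>2 ^ j\<close> would divide \<open>k0 * D N\<close>.\<close>

theorem (in tent_limit) universal_imp_infinitely_many_even:
  assumes "universal_knaster_continuum X"
  shows "\<exists>n\<ge>N. even (d n)"
proof (rule ccontr)
  assume "\<not> ?thesis"
  then have odd: "\<And>n. n \<ge> N \<Longrightarrow> odd (d n)" by blast
  define B where "B = inverse_limit (\<lambda>n. unit_interval) (\<lambda>n :: nat. tent_map 2)"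
  interpret B: tent_limit B "\<lambda>_. 2" "\<lambda>x. x" unfolding B_def by (rule tent_limit_dyadic)
  have B_D: "B.D n = 2 ^ n" for n unfolding B.D_def by simp
  obtain q where q: "continuous_map X B q" "open_map X B q" "q ` topspace X = topspace B"
    using assms knaster_continuum_dyadic unfolding universal_knaster_continuum_def B_def by blast
  have qB: "q x \<in> topspace B" if "x \<in> topspace X" for x using q(3) that by blast
  have p: "open_onto_interval X (\<lambda>x. q x j)" for j
  proof -
    note c = B.coordinate_open_onto[of j, unfolded open_onto_interval_def]
    have "(\<lambda>x. q x j) ` topspace X = (\<lambda>x. x j) ` (q ` topspace X)" by (simp add: image_image)
    also have "\<dots> = {0..1}" unfolding q(3) using c by blast
    finally show ?thesis unfolding open_onto_interval_def
      using continuous_map_compose[OF q(1), of unit_interval "\<lambda>x. x j"]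
        open_map_compose[OF q(2), of unit_interval "\<lambda>x. x j"] c
      by (simp add: o_def)
  qed
  have e: "q x j = 0" if x: "x \<in> topspace X" "\<And>n. \<pi> x n = 0" for x j
  proof (rule B.vanishing_coordinates[OF _ qB[OF x(1)]])
    show "\<exists>n\<ge>N. even (2 :: nat)" for N :: nat by (intro exI[of _ N]) simp
    show "q x n = 0 \<or> q x n = 1" for n by (rule open_onto_interval_endpoint[OF p x])
  qed
  have approx: "\<exists>i k H. i \<ge> N \<and> k \<ge> 1 \<and> approximates (\<lambda>x. q x 0) i (2 ^ j * k) H" for j
  proof -
    have "1 / (4 * 2 ^ j) > (0 :: real)" by simp
    from open_map_approximation[OF p e this] obtain n0 where n0: "\<And>n. n \<ge> n0 \<Longrightarrow>
        \<exists>k H. k \<ge> 1 \<and> lift (real (D n)) (real k) H \<and>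
          (\<forall>x\<in>topspace X. \<bar>zig (H (real (D n) * \<pi> x n)) - q x j\<bar> < 1 / (4 * 2 ^ j))" by blast
    define i where "i = max n0 N"
    obtain k H where k: "k \<ge> 1" and H: "lift (real (D i)) (real k) H"
      "\<And>x. x \<in> topspace X \<Longrightarrow> \<bar>zig (H (real (D i) * \<pi> x i)) - q x j\<bar> < 1 / (4 * 2 ^ j)"
      using n0[of i] unfolding i_def by (metis max.cobounded1)
    have "approximates (\<lambda>x. q x 0) i (2 ^ j * k) (\<lambda>t. 2 ^ j * H t)"
      unfolding approximates_def
    proof (intro conjI ballI)
      show "2 ^ j * k \<ge> 1" using k by (simp add: Suc_le_eq)
      have "lift (real k) (2 ^ j * real k) (\<lambda>x. 2 ^ j * x)" by (rule lift_scale) simp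
      from lift_compose[OF this H(1)] show "lift (real (D i)) (real (2 ^ j * k)) (\<lambda>t. 2 ^ j * H t)" by simp
      fix x assume x: "x \<in> topspace X"
      define h where "h = H (real (D i) * \<pi> x i)"
      have two: "zig (2 ^ j * zig y) = zig (2 ^ j * y)" for y using zig_mult[of "2 ^ j" y] by simp
      have "q x 0 = zig (2 ^ j * q x j)" using B.\<pi>_zig[OF qB[OF x], of 0 j] by (simp add: B_D)
      moreover have "zig (2 ^ j * h) = zig (2 ^ j * zig h)" using two by simp
      moreover have "\<bar>zig (2 ^ j * zig h) - zig (2 ^ j * q x j)\<bar> \<le> \<bar>2 ^ j * zig h - 2 ^ j * q x j\<bar>"
        by (rule zig_lipschitz)
      moreover have "\<bar>2 ^ j * zig h - 2 ^ j * q x j\<bar> = 2 ^ j * \<bar>zig h - q x j\<bar>"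
        by (simp add: abs_mult right_diff_distrib[symmetric])
      moreover have "2 ^ j * \<bar>zig h - q x j\<bar> < 2 ^ j * (1 / (4 * 2 ^ j))"
        using H(2)[OF x] unfolding h_def by (intro mult_strict_left_mono) simp_all
      ultimately have "\<bar>zig (2 ^ j * h) - q x 0\<bar> < 1/4" by simp
      then show "\<bar>zig (2 ^ j * H (real (D i) * \<pi> x i)) - q x 0\<bar> < 1/4" unfolding h_def .
    qed
    then show ?thesis using k by (intro exI[of _ i] exI[of _ k]) (auto simp: i_def)
  qed
  obtain i0 k0 H0 where z: "i0 \<ge> N" "k0 \<ge> 1" "approximates (\<lambda>x. q x 0) i0 (2 ^ 0 * k0) H0"
    using approx[of 0] by blast
  \<comment> \<open>any \<open>j\<close> with \<open>2 ^ j > k0 * D N\<close> would do\<close>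
  define j where "j = k0 * D N"
  obtain i k H where s: "i \<ge> N" "k \<ge> 1" "approximates (\<lambda>x. q x 0) i (2 ^ j * k) H"
    using approx[of j] by blast
  have eq: "2 ^ 0 * k0 * D i = 2 ^ j * k * D i0"
    by (rule approximates_unique[OF p e z(3) s(3)])
  obtain r where r: "odd r" "D i = r * D N" using D_odd[OF odd s(1)] by blast
  have "2 ^ j dvd k0 * D N * r"
    by (rule dvdI[of _ _ "k * D i0"]) (use eq in \<open>simp add: r(2) ac_simps\<close>)
  moreover have "coprime (2 ^ j) r" using r(1) by (simp add: coprime_left_2_iff_odd)
  ultimately have "2 ^ j dvd k0 * D N" by (simp add: coprime_dvd_mult_left_iff)
  moreover have "k0 * D N > 0" using z(2) D_pos[of N] by simp
  ultimately have "2 ^ j \<le> j" unfolding j_def by (intro dvd_imp_le)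
  moreover have "j < 2 ^ j" by (rule less_exp)
  ultimately show False by simp
qed

section \<open>The Ramsey property of lifts\<close>

lemma finite_real_enumeration:
  fixes A :: "real set"
  assumes "finite A" "A \<subseteq> {0<..<a}" "a > 0"
  obtains u where "u 0 = 0" "u (Suc (card A)) = a" "\<And>i. i < Suc (card A) \<Longrightarrow> u i < u (Suc i)"
    "A = u ` {1..card A}"
proof -
  define xs where "xs = sorted_list_of_set A"
  have xs: "set xs = A" "sorted_wrt (<) xs" "length xs = card A"
    using assms(1) by (simp_all add: xs_def)
  define u where "u i = (if i = 0 then 0 else if i \<le> card A then xs ! (i - 1) else a)" for i
  have inA: "u i \<in> A" if "1 \<le> i" "i \<le> card A" for i
  proof -
    have "xs ! (i - 1) \<in> set xs" using that xs(3) by (intro nth_mem) simp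
    then show ?thesis using that xs(1) by (simp add: u_def)
  qed
  show ?thesis
  proof (rule that[of u])
    show "u 0 = 0" "u (Suc (card A)) = a" by (simp_all add: u_def)
    show "u i < u (Suc i)" if i: "i < Suc (card A)" for i
    proof (cases "i = 0")
      case True
      show ?thesis
      proof (cases "card A = 0")
        case False
        then have "u 1 \<in> A" by (intro inA) simp_all
        then show ?thesis using True assms(2) by (auto simp: u_def)
      qed (use True assms(3) in \<open>simp add: u_def\<close>)
    next
      case False
      show ?thesis
      proof (cases "i = card A")
        case True
        have "u i \<in> A" using False True by (intro inA) simp_all
        then have "u i < a" using assms(2) by auto
        moreover have "u (Suc i) = a" using True by (simp add: u_def)
        ultimately show ?thesis by simp
      next
        case False2: False
        then have "Suc i \<le> card A" using i by simp
        then have "xs ! (i - 1) < xs ! i"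
          using sorted_wrt_nth_less[OF xs(2), of "i - 1" i] False xs(3) by simp
        then show ?thesis using False \<open>Suc i \<le> card A\<close> by (simp add: u_def)
      qed
    qed
    show "A = u ` {1..card A}"
    proof (intro equalityI subsetI)
      fix x assume "x \<in> A"
      then have "x \<in> set xs" using xs(1) by simp
      then obtain i where i: "i < length xs" "xs ! i = x" by (auto simp: in_set_conv_nth)
      then show "x \<in> u ` {1..card A}" using xs(3) by (intro image_eqI[of _ _ "Suc i"]) (auto simp: u_def)
    qed (use inA in auto)
  qed
qed

lemma lift_matching:
  fixes A B :: "real set"
  assumes "a > 0" "finite A" "A \<subseteq> {0<..<a}" "finite B" "B \<subseteq> {0<..<a}" "card A = card B"
  obtains H where "lift a a H" "H ` A = B"
proof -
  obtain u where u: "u 0 = 0" "u (Suc (card A)) = a" "\<And>i. i < Suc (card A) \<Longrightarrow> u i < u (Suc i)"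
    "A = u ` {1..card A}" using finite_real_enumeration[OF assms(2,3,1)] by blast
  obtain v where v: "v 0 = 0" "v (Suc (card B)) = a" "\<And>i. i < Suc (card B) \<Longrightarrow> v i < v (Suc i)"
    "B = v ` {1..card B}" using finite_real_enumeration[OF assms(4,5,1)] by blast
  note v' = v[folded assms(6)]
  obtain H where H: "lift a a H" "\<And>i. i \<le> Suc (card A) \<Longrightarrow> H (u i) = v i"
    using piecewise_linear_lift[of "Suc (card A)" u a v a, OF _ u(1,2,3) v'(1,2,3)] by blast
  have "H ` A = (\<lambda>i. H (u i)) ` {1..card A}" by (subst u(4)) (rule image_image)
  also have "\<dots> = v ` {1..card A}" by (rule image_cong) (use H(2) in auto)
  also have "\<dots> = B" using v'(4) by simp
  finally show ?thesis using H(1) that by blast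
qed

text \<open>The interior division points only; the ends are fixed by every lift.\<close>

definition grid :: "real \<Rightarrow> nat \<Rightarrow> real set" where
  "grid a q = (\<lambda>j. a * real j / real q) ` {1..<q}"

lemma grid_finite [simp]: "finite (grid a q)"
  by (simp add: grid_def)

lemma grid_card:
  assumes "a > 0" shows "card (grid a q) = q - 1"
proof -
  have "inj_on (\<lambda>j. a * real j / real q) {1..<q}"
    using assms by (auto simp: inj_on_def)
  then show ?thesis by (simp add: grid_def card_image)
qed

lemma grid_subset:
  assumes "a > 0" shows "grid a q \<subseteq> {0<..<a}"
  using assms by (auto simp: grid_def field_simps)

lemma lift_in_range:
  assumes "lift a a H" "0 \<le> x" "x \<le> a"
  shows "0 \<le> H x" "H x \<le> a"
  using lift_le[OF assms(1), of 0 x] lift_le[OF assms(1), of x a] lift_0[OF assms(1)] lift_end[OF assms(1)] assms(2,3)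
  by simp_all

text \<open>Both lifts are increasing, so below \<open>H x\<close> and below \<open>G x\<close> there are equally many grid
  points, namely as many as points of \<open>A\<close> below \<open>x\<close>. Hence \<open>H x\<close> and \<open>G x\<close> lie in the same cell of
  the grid.\<close>

lemma lifts_agreeing_on_grid_le:
  assumes a: "a > 0" and q: "q \<ge> 1" and H: "lift a a H" and G: "lift a a G"
    and A: "finite A" "H ` A = grid a q" "G ` A = grid a q" and x: "0 \<le> x" "x \<le> a"
  shows "H x \<le> G x + a / real q"
proof (rule ccontr)
  assume "\<not> ?thesis"
  then have less: "G x + a / real q < H x" by simp
  have count: "card {y \<in> grid a q. y \<le> L x} = card {z \<in> A. z \<le> x}" if L: "lift a a L" "L ` A = grid a q" for L
  proof -
    have "{y \<in> grid a q. y \<le> L x} = L ` {z \<in> A. z \<le> x}"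
      unfolding L(2)[symmetric] using lift_le[OF L(1)] by auto
    moreover have "inj_on L {z \<in> A. z \<le> x}"
      using lift_bij[OF L(1)] by (meson bij_is_inj inj_on_subset subset_UNIV)
    ultimately show ?thesis by (simp add: card_image)
  qed
  have pos: "a / real q > 0" using a q by simp
  have "{y \<in> grid a q. y \<le> G x} \<subseteq> {y \<in> grid a q. y \<le> H x}" using less pos by auto
  moreover have "card {y \<in> grid a q. y \<le> G x} = card {y \<in> grid a q. y \<le> H x}"
    using count[OF H A(2)] count[OF G A(3)] by simp
  ultimately have eq: "{y \<in> grid a q. y \<le> G x} = {y \<in> grid a q. y \<le> H x}"
    by (intro card_subset_eq) simp_all
  have G0: "0 \<le> G x" by (rule lift_in_range(1)[OF G x])
  have Ha: "H x \<le> a" by (rule lift_in_range(2)[OF H x])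
  define s where "s = H x * real q / a"
  have s: "H x = a * s / real q" using a q by (simp add: s_def)
  have s0: "0 \<le> s" using lift_in_range(1)[OF H x] a by (simp add: s_def)
  \<comment> \<open>the last grid index up to \<open>H x\<close>, or \<open>0\<close>; the minimum covers \<open>H x = a\<close>\<close>
  define j where "j = min (nat \<lfloor>s\<rfloor>) (q - 1)"
  have fl: "real (nat \<lfloor>s\<rfloor>) \<le> s" "s < real (nat \<lfloor>s\<rfloor>) + 1" using s0 by simp_all
  have jle: "a * real j / real q \<le> H x"
  proof -
    have "real j \<le> s" using fl(1) by (simp add: j_def min_def)
    then have "a * real j / real q \<le> a * s / real q" using a by (intro divide_right_mono mult_left_mono) simp_all
    then show ?thesis unfolding s .
  qed
  have jgt: "G x < a * real j / real q"
  proof (cases "nat \<lfloor>s\<rfloor> \<le> q - 1")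
    case True
    then have "s < real j + 1" using fl(2) by (simp add: j_def)
    then have "a * s / real q < a * (real j + 1) / real q"
      using a q by (intro divide_strict_right_mono mult_strict_left_mono) simp_all
    then have "H x < a * real j / real q + a / real q"
      unfolding s by (simp add: distrib_left add_divide_distrib)
    then show ?thesis using less by simp
  next
    case False
    then have "j = q - 1" by (simp add: j_def)
    then have "real j = real q - 1" using q by simp
    then have "a * real j / real q = a - a / real q" using q by (simp add: right_diff_distrib diff_divide_distrib)
    then show ?thesis using less Ha by simp
  qed
  have "j \<noteq> 0"
  proof
    assume "j = 0"
    then show False using jgt G0 by simp
  qed
  moreover have "j \<le> q - 1" unfolding j_def by (rule min.cobounded2)
  then have "j < q" using q by simp
  ultimately have "a * real j / real q \<in> grid a q"
    unfolding grid_def by (intro imageI) simp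
  then have "a * real j / real q \<in> {y \<in> grid a q. y \<le> H x}" using jle by simp
  then have "a * real j / real q \<le> G x" unfolding eq[symmetric] by simp
  then show False using jgt by simp
qed

text \<open>Up to \<open>a / q\<close>, a lift is given by the preimage of the grid, a set of \<open>q - 1\<close> points; and of
  any two finite sets of equal size inside the interval one is taken to the other by a lift. So
  colour the \<open>(q - 1)\<close>-subsets \<open>T\<close> of a large set of reference points by the colour of a lift
  \<open>h T\<close> that takes \<open>T\<close> to the grid. Ramsey's theorem gives a monochromatic \<open>B\<close> of the size of \<open>P\<close>,
  the union of all preimages of the grid under the members of \<open>F\<close>. If \<open>K\<close> takes \<open>B\<close> to \<open>P\<close>, then
  each \<open>G \<circ> K\<close> takes a subset of \<open>B\<close> to the grid.\<close>

theorem lift_ramsey: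
  fixes c :: "(real \<Rightarrow> real) \<Rightarrow> nat"
  assumes a: "a > 0" and \<delta>: "\<delta> > 0" and F: "finite F" "\<And>G. G \<in> F \<Longrightarrow> lift a a G"
    and c: "\<And>H. lift a a H \<Longrightarrow> c H < t"
  obtains K col where "lift a a K"
    "\<And>G. G \<in> F \<Longrightarrow> \<exists>H. lift a a H \<and> c H = col \<and> (\<forall>x. 0 \<le> x \<longrightarrow> x \<le> a \<longrightarrow> \<bar>G (K x) - H x\<bar> \<le> \<delta>)"
proof -
  obtain q0 where q0: "1 / real (Suc q0) < \<delta> / a" using nat_approx_posE[of "\<delta> / a"] a \<delta> by auto
  define q where "q = Suc q0"
  have q: "q \<ge> 1" "a / real q \<le> \<delta>"
  proof -
    have "a * (1 / real q) \<le> a * (\<delta> / a)" using q0 a unfolding q_def by (intro mult_left_mono) simp_all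
    then show "a / real q \<le> \<delta>" using a by simp
  qed (simp add: q_def)
  define P where "P = (\<Union>G\<in>F. Hilbert_Choice.inv G ` grid a q)"
  have P: "finite P" unfolding P_def using F(1) by simp
  have P': "P \<subseteq> {0<..<a}"
  proof
    fix y assume "y \<in> P"
    then obtain G z where G: "G \<in> F" "z \<in> grid a q" "y = Hilbert_Choice.inv G z" by (auto simp: P_def)
    note I = lift_inv[OF F(2)[OF G(1)]]
    have "0 < z" "z < a" using grid_subset[OF a, of q] G(2) by auto
    then have "Hilbert_Choice.inv G 0 < y" "y < Hilbert_Choice.inv G a" unfolding G(3) lift_less[OF I] by simp_all
    then show "y \<in> {0<..<a}" using lift_0[OF I] lift_end[OF I] by simp
  qed
  obtain N :: nat where N: "\<And>c :: nat set \<Rightarrow> nat. (\<And>T. T \<in> nsets {..<N} (q - 1) \<Longrightarrow> c T < t) \<Longrightarrow>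
      \<exists>B col. B \<in> nsets {..<N} (card P) \<and> (\<forall>T\<in>nsets B (q - 1). c T = col)"
    using ramsey_sets[of "q - 1" t "card P"] by blast
  define e where "e i = a * real (Suc i) / real (Suc N)" for i
  have einj: "inj e" using a by (auto simp: inj_on_def e_def)
  have ecard: "card (e ` S) = card S" for S by (rule card_image[OF inj_on_subset[OF einj]]) simp
  have erange: "e ` S \<subseteq> {0<..<a}" if "S \<subseteq> {..<N}" for S
  proof
    fix y assume "y \<in> e ` S"
    then obtain i where "i \<in> S" and i: "y = e i" by blast
    then have "i < N" using that by blast
    have "a * real (Suc i) < a * real (Suc N)" using \<open>i < N\<close> a by (intro mult_strict_left_mono) simp_all
    then show "y \<in> {0<..<a}" using a unfolding i e_def by (simp add: divide_less_eq)
  qed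
  have "\<exists>H. lift a a H \<and> H ` (e ` S) = grid a q" if S: "S \<in> nsets {..<N} (q - 1)" for S
  proof -
    have S': "S \<subseteq> {..<N}" "finite S" "card S = q - 1" using S by (auto simp: nsets_def)
    have "card (e ` S) = card (grid a q)"
      unfolding ecard S'(3) grid_card[OF a] ..
    then obtain H where "lift a a H" "H ` (e ` S) = grid a q"
      by (rule lift_matching[OF a finite_imageI[OF S'(2)] erange[OF S'(1)] grid_finite grid_subset[OF a]])
    then show ?thesis by (intro exI conjI)
  qed
  then have "\<forall>S\<in>nsets {..<N} (q - 1). \<exists>H. lift a a H \<and> H ` (e ` S) = grid a q" by (intro ballI)
  from bchoice[OF this] obtain h where hh: "\<forall>S\<in>nsets {..<N} (q - 1). lift a a (h S) \<and> h S ` (e ` S) = grid a q" ..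
  have h: "lift a a (h S)" "h S ` (e ` S) = grid a q" if "S \<in> nsets {..<N} (q - 1)" for S
    by (rule conjunct1[OF bspec[OF hh that]], rule conjunct2[OF bspec[OF hh that]])
  have "\<exists>B col. B \<in> nsets {..<N} (card P) \<and> (\<forall>T\<in>nsets B (q - 1). c (h T) = col)"
    by (rule N) (rule c[OF h(1)])
  then obtain B col where B: "B \<in> nsets {..<N} (card P)" "\<And>T. T \<in> nsets B (q - 1) \<Longrightarrow> c (h T) = col" by blast
  have B': "B \<subseteq> {..<N}" "finite B" "card B = card P" using B(1) by (auto simp: nsets_def)
  have "card (e ` B) = card P" using B'(3) by (simp add: ecard)
  then obtain K where K: "lift a a K" "K ` (e ` B) = P"
    by (rule lift_matching[OF a finite_imageI[OF B'(2)] erange[OF B'(1)] P P'])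
  have "\<exists>H. lift a a H \<and> c H = col \<and> (\<forall>x. 0 \<le> x \<longrightarrow> x \<le> a \<longrightarrow> \<bar>G (K x) - H x\<bar> \<le> \<delta>)" if G: "G \<in> F" for G
  proof -
    define GK where "GK x = G (K x)" for x
    have GK: "lift a a GK" using lift_compose[OF F(2)[OF G] K(1)] by (simp add: GK_def[abs_def])
    define T where "T = {i \<in> B. GK (e i) \<in> grid a q}"
    have img: "GK ` (e ` T) = grid a q"
    proof (intro equalityI subsetI)
      show "y \<in> grid a q" if "y \<in> GK ` (e ` T)" for y using that by (auto simp: T_def)
    next
      fix y assume y: "y \<in> grid a q"
      then have "Hilbert_Choice.inv G y \<in> P" using G by (auto simp: P_def)
      then have "Hilbert_Choice.inv G y \<in> K ` (e ` B)" unfolding K(2) .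
      then obtain i where i: "i \<in> B" "Hilbert_Choice.inv G y = K (e i)" by blast
      have "GK (e i) = y" unfolding GK_def i(2)[symmetric] by (rule lift_inv_simps(1)[OF F(2)[OF G]])
      then show "y \<in> GK ` (e ` T)" using i(1) y by (auto simp: T_def)
    qed
    have "inj GK" using lift_bij[OF GK] by (rule bij_is_inj)
    then have "inj_on GK (e ` T)" by (rule inj_on_subset) simp
    then have "card (GK ` (e ` T)) = card (e ` T)" by (rule card_image)
    then have cT: "card T = q - 1" unfolding img ecard grid_card[OF a] by simp
    have "T \<subseteq> B" by (auto simp: T_def)
    then have TB: "T \<in> nsets B (q - 1)" using B'(2) cT by (auto simp: nsets_def intro: finite_subset)
    then have TN: "T \<in> nsets {..<N} (q - 1)" using nsets_mono[OF B'(1)] by blast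
    have fin: "finite (e ` T)" using TB by (auto simp: nsets_def)
    have "\<bar>G (K x) - h T x\<bar> \<le> \<delta>" if "0 \<le> x" "x \<le> a" for x
    proof -
      have "GK x \<le> h T x + a / real q"
        by (rule lifts_agreeing_on_grid_le[OF a q(1) GK h(1)[OF TN] fin img h(2)[OF TN] that])
      moreover have "h T x \<le> GK x + a / real q"
        by (rule lifts_agreeing_on_grid_le[OF a q(1) h(1)[OF TN] GK fin h(2)[OF TN] img that])
      ultimately show ?thesis using q(2) unfolding GK_def by linarith
    qed
    then show ?thesis using h(1)[OF TN] B(2)[OF TB] by blast
  qed
  then show ?thesis using K(1) that by blast
qed

section \<open>Homeomorphisms of degree one\<close>

context tent_limit
begin

text \<open>\<open>g\<close> acts as \<open>H\<close> on the time lines of all levels from \<open>i\<close> on.\<close>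

definition lifts :: "nat \<Rightarrow> (real \<Rightarrow> real) \<Rightarrow> ('k \<Rightarrow> 'k) \<Rightarrow> bool" where
  "lifts i H g \<longleftrightarrow> lift (real (D i)) (real (D i)) H \<and>
     (\<forall>x\<in>topspace X. \<forall>n\<ge>i. \<forall>m\<le>n. \<pi> (g x) m = zig (H (real (D n) * \<pi> x n) / real (D m)))"

lemma liftsD:
  assumes "lifts i H g"
  shows "lift (real (D i)) (real (D i)) H"
    "\<And>x n m. x \<in> topspace X \<Longrightarrow> n \<ge> i \<Longrightarrow> m \<le> n \<Longrightarrow> \<pi> (g x) m = zig (H (real (D n) * \<pi> x n) / real (D m))"
  using assms unfolding lifts_def by blast+

lemma lift_D_mono:
  assumes "lift (real (D i)) (real (D i)) H" "i \<le> n"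
  shows "lift (real (D n)) (real (D n)) H"
proof -
  obtain r where r: "D n = r * D i" using D_ratio[OF assms(2)] by blast
  show ?thesis using lift_multiple[OF assms(1), of r] unfolding r by simp
qed

lemma lifts_mono: "lifts i H g \<Longrightarrow> i \<le> n \<Longrightarrow> lifts n H g"
  unfolding lifts_def using lift_D_mono by (meson order_trans)

lemma lifts_time:
  assumes g: "lifts i H g" and x: "x \<in> topspace X" and n: "n \<ge> i"
  shows "real (D n) * \<pi> (g x) n = H (real (D n) * \<pi> x n)"
proof -
  let ?t = "real (D n) * \<pi> x n"
  have t: "0 \<le> ?t" "?t \<le> real (D n)"
    using \<pi>_range[OF x, of n] mult_left_mono[of "\<pi> x n" 1 "real (D n)"] by simp_all
  have L: "lift (real (D n)) (real (D n)) H" by (rule lift_D_mono[OF liftsD(1)[OF g] n])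
  have "0 \<le> H ?t / real (D n)" "H ?t / real (D n) \<le> 1"
    using lift_in_range[OF L t] D_pos[of n] by simp_all
  then have "\<pi> (g x) n = H ?t / real (D n)" using liftsD(2)[OF g x n order_refl] by simp
  then show ?thesis using D_pos[of n] by simp
qed

text \<open>The time line of level \<open>n\<close> is folded onto that of level \<open>i\<close>, so equivariance makes the
  prescriptions of different levels compatible. The homeomorphism belonging to the inverse lift is
  the inverse.\<close>

lemma lifts_exists:
  assumes H: "lift (real (D i)) (real (D i)) H"
  shows "\<exists>g\<in>homeos X. lifts i H g"
proof -
  have point: "\<exists>y\<in>topspace X. \<forall>n\<ge>i. \<forall>m\<le>n. \<pi> y m = zig (G (real (D n) * \<pi> x n) / real (D m))"
    if G: "lift (real (D i)) (real (D i)) G" and x: "x \<in> topspace X" for G x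
  proof -
    define y where "y m = zig (G (real (D (max i m)) * \<pi> x (max i m)) / real (D m))" for m
    have y: "y m = zig (G (real (D n) * \<pi> x n) / real (D m))" if n: "n \<ge> i" "m \<le> n" for n m
    proof -
      let ?k = "max i m"
      obtain r where r: "D ?k = r * D m" using D_ratio[of m ?k] by auto
      have "equivariant (real (D ?k)) (real (D ?k)) G"
        using lift_D_mono[OF G, of ?k] by (simp add: lift_def)
      then have "equivariant (real (D ?k)) (real r * real (D m)) G" unfolding r by simp
      from time_change[OF x _ this, of n] show ?thesis
        unfolding y_def using n D_pos[of m] by simp
    qed
    have "y \<in> topspace Y" unfolding Y_iff
    proof (intro conjI allI)
      fix m show "0 \<le> y m" "y m \<le> 1" unfolding y_def by (rule zig_range)+
      let ?n = "max i (Suc m)" and ?w = "G (real (D (max i (Suc m))) * \<pi> x (max i (Suc m)))"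
      have "real (d m) * (?w / real (D (Suc m))) = ?w / real (D m)"
        unfolding D_Suc using d_pos[of m] by simp
      then have "zig (real (d m) * zig (?w / real (D (Suc m)))) = zig (?w / real (D m))"
        by (simp only: zig_mult)
      then show "y m = zig (real (d m) * y (Suc m))"
        using y[of ?n m] y[of ?n "Suc m"] by simp
    qed
    from \<pi>_onto[OF this] show ?thesis using y by blast
  qed
  \<comment> \<open>the induced self-map of \<open>X\<close>, for \<open>G\<close> equal to \<open>H\<close> or to its inverse\<close>
  define ext where "ext G x = (SOME y. y \<in> topspace X \<and>
      (\<forall>n\<ge>i. \<forall>m\<le>n. \<pi> y m = zig (G (real (D n) * \<pi> x n) / real (D m))))" for G x
  have ext: "ext G x \<in> topspace X"
      "\<forall>n\<ge>i. \<forall>m\<le>n. \<pi> (ext G x) m = zig (G (real (D n) * \<pi> x n) / real (D m))"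
    if G: "lift (real (D i)) (real (D i)) G" and x: "x \<in> topspace X" for G x
  proof -
    have "\<exists>y. y \<in> topspace X \<and> (\<forall>n\<ge>i. \<forall>m\<le>n. \<pi> y m = zig (G (real (D n) * \<pi> x n) / real (D m)))"
      using point[OF G x] by blast
    from someI_ex[OF this] show "ext G x \<in> topspace X"
      "\<forall>n\<ge>i. \<forall>m\<le>n. \<pi> (ext G x) m = zig (G (real (D n) * \<pi> x n) / real (D m))"
      unfolding ext_def by blast+
  qed
  have lifts_ext: "lifts i G (ext G)" if "lift (real (D i)) (real (D i)) G" for G
    unfolding lifts_def using that ext(2)[OF that] by blast
  let ?I = "Hilbert_Choice.inv H"
  note I = lift_inv[OF H]
  have cancel: "ext G' (ext G x) = x"
    if G: "lift (real (D i)) (real (D i)) G" and G': "lift (real (D i)) (real (D i)) G'"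
      and inv: "\<And>t. G' (G t) = t" and x: "x \<in> topspace X" for G G' x
  proof (rule \<pi>_eqI)
    show X: "ext G' (ext G x) \<in> topspace X" by (rule ext(1)[OF G' ext(1)[OF G x]])
    fix m
    let ?n = "max i m"
    have "\<pi> (ext G' (ext G x)) m = zig (G' (real (D ?n) * \<pi> (ext G x) ?n) / real (D m))"
      by (rule liftsD(2)[OF lifts_ext[OF G'] ext(1)[OF G x]]) simp_all
    also have "real (D ?n) * \<pi> (ext G x) ?n = G (real (D ?n) * \<pi> x ?n)"
      by (rule lifts_time[OF lifts_ext[OF G] x]) simp
    also have "zig (G' (G (real (D ?n) * \<pi> x ?n)) / real (D m)) = \<pi> x m"
      unfolding inv by (rule \<pi>_zig[OF x, symmetric]) simp
    finally show "\<pi> (ext G' (ext G x)) m = \<pi> x m" .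
  qed (rule x)
  have cont: "continuous_map X X (ext G)" if G: "lift (real (D i)) (real (D i)) G" for G
  proof -
    obtain \<rho> where \<rho>: "homeomorphic_maps X Y \<pi> \<rho>" using homeo homeomorphic_map_maps by blast
    have "continuous_map X unit_interval (\<lambda>x. \<pi> (ext G x) m)" for m
    proof -
      let ?n = "max i m"
      have "continuous_on UNIV (\<lambda>v. zig (G (real (D ?n) * v) / real (D m)))"
      proof (rule continuous_on_zig)
        have "continuous_on UNIV (\<lambda>v. G (real (D ?n) * v))"
          by (rule continuous_on_compose2[OF lift_continuous[OF G, of UNIV]]) (auto intro: continuous_intros)
        then show "continuous_on UNIV (\<lambda>v. G (real (D ?n) * v) / real (D m))"
          using D_pos[of m] by (intro continuous_intros) simp_all
      qed
      then have "continuous_map euclideanreal euclideanreal (\<lambda>v. zig (G (real (D ?n) * v) / real (D m)))"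
        by simp
      from continuous_map_compose[OF \<pi>_continuous_real[of ?n] this]
      have "continuous_map X euclideanreal (\<lambda>x. zig (G (real (D ?n) * \<pi> x ?n) / real (D m)))"
        by (simp add: o_def)
      then have "continuous_map X unit_interval (\<lambda>x. zig (G (real (D ?n) * \<pi> x ?n) / real (D m)))"
        using zig_range by (auto simp: continuous_map_in_subtopology)
      then show ?thesis
        by (rule continuous_map_eq) (rule liftsD(2)[OF lifts_ext[OF G], symmetric], simp_all)
    qed
    then have "continuous_map X (product_topology (\<lambda>n. unit_interval) UNIV) (\<lambda>x. \<pi> (ext G x))"
      by (simp add: continuous_map_componentwise_UNIV)
    then have "continuous_map X Y (\<lambda>x. \<pi> (ext G x))"
      unfolding inverse_limit_def
    proof (rule continuous_map_into_subtopology, intro Pi_I)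
      fix x assume "x \<in> topspace X"
      from \<pi>_Y[OF ext(1)[OF G this]]
      show "\<pi> (ext G x) \<in> {x. \<forall>n. x n = tent_map (d n) (x (Suc n))}"
        unfolding inverse_limit_def topspace_subtopology by (rule IntD2)
    qed
    moreover have "continuous_map Y X \<rho>" using \<rho> by (simp add: homeomorphic_maps_def)
    ultimately have "continuous_map X X (\<rho> \<circ> (\<lambda>x. \<pi> (ext G x)))" by (rule continuous_map_compose)
    then show ?thesis
      by (rule continuous_map_eq) (use \<rho> ext(1)[OF G] in \<open>simp add: homeomorphic_maps_def\<close>)
  qed
  have c1: "ext ?I (ext H x) = x" if "x \<in> topspace X" for x
    by (rule cancel[OF H I lift_inv_simps(2)[OF H] that])
  have c2: "ext H (ext ?I x) = x" if "x \<in> topspace X" for x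
    by (rule cancel[OF I H lift_inv_simps(1)[OF H] that])
  have "homeomorphic_maps X X (ext H) (ext ?I)"
    unfolding homeomorphic_maps_def using cont[OF H] cont[OF I] c1 c2 by blast
  then have "homeomorphic_map X X (ext H)" using homeomorphic_map_maps by blast
  then have hm: "homeomorphic_map X X (restrict (ext H) (topspace X))"
    by (rule homeomorphic_map_eq) simp
  then have "bij_betw (restrict (ext H) (topspace X)) (topspace X) (topspace X)"
    using homeomorphic_imp_injective_map homeomorphic_imp_surjective_map unfolding bij_betw_def by blast
  then have "restrict (ext H) (topspace X) \<in> homeos X"
    using hm by (simp add: homeos_def Bij_def)
  moreover have "lifts i H (restrict (ext H) (topspace X))"
    using lifts_ext[OF H] unfolding lifts_def by simp
  ultimately show ?thesis by blast
qed

text \<open>A directed union of copies of the groups of increasing homeomorphisms of \<open>[0, D i]\<close>.\<close>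

definition lifted_homeos :: "('k \<Rightarrow> 'k) set" where
  "lifted_homeos = {g \<in> homeos X. \<exists>i H. lifts i H g}"

lemma lifted_homeos_group: "permutation_group (topspace X) lifted_homeos"
  unfolding permutation_group_def
proof (intro conjI ballI)
  let ?S = "topspace X"
  note Ho = permutation_group_homeos[of X, unfolded permutation_group_def]
  have into: "g x \<in> ?S" if "g \<in> lifted_homeos" "x \<in> ?S" for g x
  proof -
    have "g \<in> Bij ?S" using that(1) by (simp add: lifted_homeos_def homeos_def)
    then show ?thesis using that(2) by (auto simp: Bij_def bij_betw_def)
  qed
  show "lifted_homeos \<subseteq> Bij ?S" by (auto simp: lifted_homeos_def homeos_def)
  have "lifts 0 (\<lambda>t. t) (\<lambda>x\<in>?S. x)"
    unfolding lifts_def using lift_id \<pi>_zig by simp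
  then show "(\<lambda>x\<in>?S. x) \<in> lifted_homeos" using Ho by (auto simp: lifted_homeos_def)
  show "compose ?S g h \<in> lifted_homeos" if gh: "g \<in> lifted_homeos" "h \<in> lifted_homeos" for g h
  proof -
    obtain i G where i: "lifts i G g" using gh(1) by (auto simp: lifted_homeos_def)
    obtain j H where j: "lifts j H h" using gh(2) by (auto simp: lifted_homeos_def)
    define k where "k = max i j"
    have G: "lifts k G g" and H: "lifts k H h" using lifts_mono[OF i] lifts_mono[OF j] by (simp_all add: k_def)
    have "lifts k (\<lambda>t. G (H t)) (compose ?S g h)"
      unfolding lifts_def
    proof (intro conjI ballI allI impI)
      show "lift (real (D k)) (real (D k)) (\<lambda>t. G (H t))"
        by (rule lift_compose[OF liftsD(1)[OF G] liftsD(1)[OF H]])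
      fix x n m assume x: "x \<in> ?S" and n: "n \<ge> k" "m \<le> n"
      show "\<pi> (compose ?S g h x) m = zig (G (H (real (D n) * \<pi> x n)) / real (D m))"
        using liftsD(2)[OF G into[OF gh(2) x] n] lifts_time[OF H x n(1)] x by (simp add: compose_def)
    qed
    moreover have "compose ?S g h \<in> homeos X" using Ho gh by (auto simp: lifted_homeos_def)
    ultimately show ?thesis by (auto simp: lifted_homeos_def)
  qed
  show "restrict (inv_into ?S g) ?S \<in> lifted_homeos" if g: "g \<in> lifted_homeos" for g
  proof -
    obtain i G where G: "lifts i G g" using g by (auto simp: lifted_homeos_def)
    note L = liftsD(1)[OF G]
    have b: "bij_betw g ?S ?S" using g by (simp add: lifted_homeos_def homeos_def Bij_def)
    have "lifts i (Hilbert_Choice.inv G) (restrict (inv_into ?S g) ?S)"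
      unfolding lifts_def
    proof (intro conjI ballI allI impI)
      show "lift (real (D i)) (real (D i)) (Hilbert_Choice.inv G)" by (rule lift_inv[OF L])
      fix y n m assume y: "y \<in> ?S" and n: "n \<ge> i" "m \<le> n"
      define x where "x = inv_into ?S g y"
      have x: "x \<in> ?S" "g x = y"
        using b y unfolding x_def by (auto simp: bij_betw_inv_into_right bij_betw_imp_surj_on inv_into_into)
      have "real (D n) * \<pi> y n = G (real (D n) * \<pi> x n)" using lifts_time[OF G x(1) n(1)] unfolding x(2) .
      then have "Hilbert_Choice.inv G (real (D n) * \<pi> y n) = real (D n) * \<pi> x n"
        using lift_inv_simps(2)[OF L] by simp
      then show "\<pi> (restrict (inv_into ?S g) ?S y) m = zig (Hilbert_Choice.inv G (real (D n) * \<pi> y n) / real (D m))"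
        using \<pi>_zig[OF x(1) n(2)] y by (simp add: x_def)
    qed
    moreover have "restrict (inv_into ?S g) ?S \<in> homeos X" using Ho g by (auto simp: lifted_homeos_def)
    ultimately show ?thesis by (auto simp: lifted_homeos_def)
  qed
qed

lemma coordinate_controls_metric:
  assumes m: "mtopology_of m = X" and \<epsilon>: "\<epsilon> > 0"
  shows "\<exists>\<delta> N. 0 < \<delta> \<and> (\<forall>x y. x \<in> topspace X \<longrightarrow> y \<in> topspace X \<longrightarrow>
    \<bar>\<pi> x N - \<pi> y N\<bar> \<le> \<delta> \<longrightarrow> mdist m x y < \<epsilon>)"
proof -
  have S: "mspace m = topspace X" using m by (metis topspace_mtopology_of)
  define Q where "Q = {z \<in> topspace X \<times> topspace X. \<epsilon> \<le> mdist m (fst z) (snd z)}"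
  have "closedin (prod_topology X X) Q" using closedin_far_pairs[of m \<epsilon>] unfolding m S Q_def .
  moreover have "(x, x) \<notin> Q" for x
  proof
    assume "(x, x) \<in> Q"
    then have "x \<in> mspace m" "\<epsilon> \<le> mdist m x x" using S by (auto simp: Q_def)
    moreover from this(1) have "mdist m x x = 0" by simp
    ultimately show False using \<epsilon> by simp
  qed
  ultimately obtain N where N: "near N \<inter> Q = {}" using near_separates[of Q] by blast
  show ?thesis
  proof (intro exI[of _ "1 / (real (Suc N) * real (D N))"] exI[of _ N] conjI allI impI)
    show "1 / (real (Suc N) * real (D N)) > 0" using D_pos[of N] by simp
    fix x y assume xy: "x \<in> topspace X" "y \<in> topspace X" "\<bar>\<pi> x N - \<pi> y N\<bar> \<le> 1 / (real (Suc N) * real (D N))"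
    show "mdist m x y < \<epsilon>"
    proof (rule ccontr)
      assume "\<not> ?thesis"
      then have "(x, y) \<in> near N \<inter> Q" using nearI[OF xy] xy(1,2) by (simp add: Q_def)
      then show False using N by blast
    qed
  qed
qed

text \<open>All elements of \<open>F\<close> come from one level \<open>i\<close>, and \<open>i\<close> can be taken so large that closeness
  there bounds the distance. This reduces the claim to the Ramsey theorem for lifts.\<close>

theorem lifted_homeos_oscillation_stable:
  assumes m: "mtopology_of m = X"
  shows "oscillation_stable m lifted_homeos"
  unfolding oscillation_stable_def
proof (intro allI impI, elim conjE)
  have S: "mspace m = topspace X" using m by (metis topspace_mtopology_of)
  fix \<epsilon> :: real and F and c :: "('k \<Rightarrow> 'k) \<Rightarrow> nat"
  assume e: "\<epsilon> > 0" and F: "finite F" "F \<subseteq> lifted_homeos" and c: "finite (c ` lifted_homeos)"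
  from coordinate_controls_metric[OF m e] obtain \<delta> where
    "\<exists>N. 0 < \<delta> \<and> (\<forall>x y. x \<in> topspace X \<longrightarrow> y \<in> topspace X \<longrightarrow>
        \<bar>\<pi> x N - \<pi> y N\<bar> \<le> \<delta> \<longrightarrow> mdist m x y < \<epsilon>)" ..
  then obtain N where \<delta>': "0 < \<delta> \<and> (\<forall>x y. x \<in> topspace X \<longrightarrow> y \<in> topspace X \<longrightarrow>
        \<bar>\<pi> x N - \<pi> y N\<bar> \<le> \<delta> \<longrightarrow> mdist m x y < \<epsilon>)" ..
  note \<delta> = conjunct1[OF \<delta>'] conjunct2[OF \<delta>', rule_format]
  have "\<exists>i H. lifts i H g" if "g \<in> F" for g using F(2) that by (auto simp: lifted_homeos_def)
  then obtain ig Hg where ig: "\<And>g. g \<in> F \<Longrightarrow> lifts (ig g) (Hg g) g" by metis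
  define i where "i = Max (insert N (ig ` F))"
  have iN: "N \<le> i" and iF: "\<And>g. g \<in> F \<Longrightarrow> ig g \<le> i" using F(1) by (simp_all add: i_def)
  have Hg: "lifts i (Hg g) g" if "g \<in> F" for g by (rule lifts_mono[OF ig[OF that] iF[OF that]])
  have "\<exists>g. g \<in> lifted_homeos \<and> lifts i H g" if "lift (real (D i)) (real (D i)) H" for H
    using lifts_exists[OF that] by (auto simp: lifted_homeos_def)
  then obtain \<gamma> where \<gamma>: "\<And>H. lift (real (D i)) (real (D i)) H \<Longrightarrow> \<gamma> H \<in> lifted_homeos"
    "\<And>H. lift (real (D i)) (real (D i)) H \<Longrightarrow> lifts i H (\<gamma> H)" by metis
  obtain t where t: "\<And>h. h \<in> lifted_homeos \<Longrightarrow> c h < t"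
    using c unfolding finite_nat_set_iff_bounded by blast
  have into: "g x \<in> topspace X" if "g \<in> lifted_homeos" "x \<in> topspace X" for g x
  proof -
    have "g \<in> Bij (topspace X)" using that(1) by (simp add: lifted_homeos_def homeos_def)
    then show ?thesis using that(2) by (auto simp: Bij_def bij_betw_def)
  qed
  have fin: "finite (Hg ` F)" using F(1) by simp
  have lF: "lift (real (D i)) (real (D i)) G" if "G \<in> Hg ` F" for G using that liftsD(1)[OF Hg] by blast
  have col: "c (\<gamma> H) < t" if "lift (real (D i)) (real (D i)) H" for H using t[OF \<gamma>(1)[OF that]] .
  obtain K cl where K: "lift (real (D i)) (real (D i)) K"
    "\<And>G. G \<in> Hg ` F \<Longrightarrow> \<exists>H. lift (real (D i)) (real (D i)) H \<and> c (\<gamma> H) = cl \<and>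
       (\<forall>x. 0 \<le> x \<longrightarrow> x \<le> real (D i) \<longrightarrow> \<bar>G (K x) - H x\<bar> \<le> \<delta>)"
    using lift_ramsey[of "real (D i)" \<delta> "Hg ` F" "\<lambda>H. c (\<gamma> H)" t, OF D_real_pos \<delta>(1) fin lF col] by blast
  have "\<exists>h\<in>lifted_homeos. c h = cl \<and> (\<forall>x\<in>mspace m. mdist m (g (\<gamma> K x)) (h x) \<le> \<epsilon>)" if g: "g \<in> F" for g
  proof -
    obtain H where H: "lift (real (D i)) (real (D i)) H" "c (\<gamma> H) = cl"
      "\<And>x. 0 \<le> x \<Longrightarrow> x \<le> real (D i) \<Longrightarrow> \<bar>Hg g (K x) - H x\<bar> \<le> \<delta>" using K(2)[of "Hg g"] g by blast
    have "mdist m (g (\<gamma> K x)) (\<gamma> H x) \<le> \<epsilon>" if x: "x \<in> topspace X" for x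
    proof -
      let ?t = "real (D i) * \<pi> x i"
      have t: "0 \<le> ?t" "?t \<le> real (D i)"
        using \<pi>_range[OF x, of i] mult_left_mono[of "\<pi> x i" 1 "real (D i)"] by simp_all
      have Kx: "\<gamma> K x \<in> topspace X" by (rule into[OF \<gamma>(1)[OF K(1)] x])
      have gK: "g (\<gamma> K x) \<in> topspace X" using into[OF _ Kx] g F(2) by blast
      have Hx: "\<gamma> H x \<in> topspace X" by (rule into[OF \<gamma>(1)[OF H(1)] x])
      have "\<pi> (g (\<gamma> K x)) N = zig (Hg g (K ?t) / real (D N))"
        using liftsD(2)[OF Hg[OF g] Kx order_refl iN] lifts_time[OF \<gamma>(2)[OF K(1)] x order_refl] by simp
      moreover have "\<pi> (\<gamma> H x) N = zig (H ?t / real (D N))"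
        by (rule liftsD(2)[OF \<gamma>(2)[OF H(1)] x order_refl iN])
      ultimately have "\<bar>\<pi> (g (\<gamma> K x)) N - \<pi> (\<gamma> H x) N\<bar> \<le> \<bar>Hg g (K ?t) / real (D N) - H ?t / real (D N)\<bar>"
        using zig_lipschitz by simp
      also have "\<dots> = \<bar>Hg g (K ?t) - H ?t\<bar> / real (D N)"
        by (simp add: diff_divide_distrib[symmetric])
      also have "\<dots> \<le> \<delta> / real (D N)" by (rule divide_right_mono[OF H(3)[OF t]]) simp
      also have "\<dots> \<le> \<delta> / 1" using \<delta>(1) D_pos[of N] by (intro divide_left_mono) simp_all
      finally have "\<bar>\<pi> (g (\<gamma> K x)) N - \<pi> (\<gamma> H x) N\<bar> \<le> \<delta>" by simp
      from \<delta>(2)[OF gK Hx this] show ?thesis by simp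
    qed
    then show ?thesis using \<gamma>(1)[OF H(1)] H(2) unfolding S by blast
  qed
  then show "\<exists>k\<in>lifted_homeos. \<exists>i. \<forall>g\<in>F. \<exists>h\<in>lifted_homeos. c h = i \<and>
      (\<forall>x\<in>mspace m. mdist m (g (k x)) (h x) \<le> \<epsilon>)"
    using \<gamma>(1)[OF K(1)] by blast
qed

lemma compact_metric_lifted_homeos:
  assumes m: "mtopology_of m = X"
  shows "compact_metric_homeos m lifted_homeos"
proof
  have S: "mspace m = topspace X" using m by (metis topspace_mtopology_of)
  show "compact_space (mtopology_of m)" unfolding m by (rule compact_Hausdorff(1))
  show "lifted_homeos \<subseteq> homeos (mtopology_of m)" unfolding m by (auto simp: lifted_homeos_def)
  show "permutation_group (mspace m) lifted_homeos" unfolding S by (rule lifted_homeos_group)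
qed

text \<open>A homeomorphism \<open>f\<close> is determined up to \<open>\<epsilon>\<close> by \<open>\<pi> (f x) N\<close> for one \<open>N\<close>, an open
  map onto the interval, which is approximated by folding a lift \<open>B\<close> with \<open>k\<close> laps at some level
  \<open>i\<close>. Then \<open>H = D N * B\<close>, folded, approximates \<open>\<pi> (f x) 0\<close>, so the degree of \<open>f\<close> is
  \<open>D N * k / D i\<close>. If the degree is \<open>1\<close>, then \<open>H\<close> maps \<open>[0, D i]\<close> onto itself and induces a
  homeomorphism close to \<open>f\<close>. Conversely, if \<open>f\<close> is close to the homeomorphism induced by a lift
  \<open>H\<close> of \<open>[0, D i]\<close>, then \<open>H\<close> reveals that \<open>f\<close> has degree \<open>D i / D i\<close>.\<close>

theorem homeos_degree_1_eq_closure: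
  assumes m: "mtopology_of m = X" and even: "\<And>N. \<exists>n\<ge>N. even (d n)"
  shows "homeos_degree_1 X d \<pi> = compact_metric_homeos.uniform_closure m lifted_homeos"
proof -
  have S: "mspace m = topspace X" using m by (metis topspace_mtopology_of)
  interpret G: compact_metric_homeos m lifted_homeos by (rule compact_metric_lifted_homeos[OF m])
  have into: "g x \<in> topspace X" if "g \<in> homeos X" "x \<in> topspace X" for g x
  proof -
    have "g \<in> Bij (topspace X)" using that(1) by (simp add: homeos_def)
    then show ?thesis using that(2) by (auto simp: Bij_def bij_betw_def)
  qed
  have endpoint: "\<pi> (f x) n = 0" if "f \<in> homeos X" "x \<in> topspace X" "\<And>n. \<pi> x n = 0" for f x n
    by (rule homeo_endpoint[OF even that])
  have degree: "knaster_degree X d \<pi> f = real k / real (D i)"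
    if "f \<in> homeos X" "approximates (\<lambda>x. \<pi> (f x) 0) i k H" for f i k H
    by (rule knaster_degree_eq[OF homeo_coordinate[OF that(1)] endpoint[OF that(1)] that(2)])
  show ?thesis
  proof (intro equalityI subsetI)
    fix f assume "f \<in> homeos_degree_1 X d \<pi>"
    then have f: "f \<in> homeos X" "knaster_degree X d \<pi> f = 1" by (simp_all add: homeos_degree_1_def)
    have "\<exists>g\<in>lifted_homeos. \<forall>x\<in>mspace m. mdist m (f x) (g x) \<le> \<epsilon>" if e: "\<epsilon> > 0" for \<epsilon>
    proof -
      from coordinate_controls_metric[OF m e] obtain \<delta> where
        "\<exists>N. 0 < \<delta> \<and> (\<forall>x y. x \<in> topspace X \<longrightarrow> y \<in> topspace X \<longrightarrow>
            \<bar>\<pi> x N - \<pi> y N\<bar> \<le> \<delta> \<longrightarrow> mdist m x y < \<epsilon>)" ..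
      then obtain N where \<delta>': "0 < \<delta> \<and> (\<forall>x y. x \<in> topspace X \<longrightarrow> y \<in> topspace X \<longrightarrow>
            \<bar>\<pi> x N - \<pi> y N\<bar> \<le> \<delta> \<longrightarrow> mdist m x y < \<epsilon>)" ..
      note \<delta> = conjunct1[OF \<delta>'] conjunct2[OF \<delta>', rule_format]
      \<comment> \<open>passing from coordinate \<open>N\<close> to coordinate \<open>0\<close> multiplies errors by \<open>D N\<close>\<close>
      define \<eta> where "\<eta> = min \<delta> (1 / (4 * real (D N)))"
      have \<eta>: "\<eta> > 0" "\<eta> \<le> \<delta>" "real (D N) * \<eta> \<le> 1/4"
      proof -
        show "\<eta> > 0" "\<eta> \<le> \<delta>" using \<delta>(1) D_pos[of N] by (simp_all add: \<eta>_def)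
        have "real (D N) * \<eta> \<le> real (D N) * (1 / (4 * real (D N)))" by (intro mult_left_mono) (simp_all add: \<eta>_def)
        also have "\<dots> = 1/4" using D_pos[of N] by simp
        finally show "real (D N) * \<eta> \<le> 1/4" .
      qed
      obtain n0 where n0: "\<And>n. n \<ge> n0 \<Longrightarrow> \<exists>k H. k \<ge> 1 \<and> lift (real (D n)) (real k) H \<and>
          (\<forall>x\<in>topspace X. \<bar>zig (H (real (D n) * \<pi> x n)) - \<pi> (f x) N\<bar> < \<eta>)"
        using open_map_approximation[OF homeo_coordinate[OF f(1)] endpoint[OF f(1)] \<eta>(1)] by blast
      define i where "i = max n0 N"
      have iN: "N \<le> i" and "n0 \<le> i" by (simp_all add: i_def)
      obtain k B where k: "k \<ge> 1" and B: "lift (real (D i)) (real k) B"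
        "\<And>x. x \<in> topspace X \<Longrightarrow> \<bar>zig (B (real (D i) * \<pi> x i)) - \<pi> (f x) N\<bar> < \<eta>"
        using n0[OF \<open>n0 \<le> i\<close>] by blast
      define H where "H t = real (D N) * B t" for t
      have H: "lift (real (D i)) (real (D N * k)) H"
      proof -
        have "lift (real k) (real (D N) * real k) (\<lambda>x. real (D N) * x)" by (rule lift_scale[OF D_real_pos])
        from lift_compose[OF this B(1)] show ?thesis by (simp add: H_def[abs_def])
      qed
      have "approximates (\<lambda>x. \<pi> (f x) 0) i (D N * k) H"
        unfolding approximates_def
      proof (intro conjI ballI H)
        show "D N * k \<ge> 1" using k D_pos[of N] by (simp add: Suc_le_eq)
        fix x assume x: "x \<in> topspace X"
        let ?b = "B (real (D i) * \<pi> x i)"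
        have "\<pi> (f x) 0 = zig (real (D N) * \<pi> (f x) N)" using \<pi>_zig[OF into[OF f(1) x], of 0 N] by simp
        moreover have "zig (H (real (D i) * \<pi> x i)) = zig (real (D N) * zig ?b)"
          unfolding H_def by (rule zig_mult[symmetric])
        ultimately have "\<bar>zig (H (real (D i) * \<pi> x i)) - \<pi> (f x) 0\<bar> \<le> \<bar>real (D N) * zig ?b - real (D N) * \<pi> (f x) N\<bar>"
          using zig_lipschitz by simp
        also have "\<dots> = real (D N) * \<bar>zig ?b - \<pi> (f x) N\<bar>" by (simp add: abs_mult right_diff_distrib[symmetric])
        also have "\<dots> < real (D N) * \<eta>" by (rule mult_strict_left_mono[OF B(2)[OF x] D_real_pos])
        finally show "\<bar>zig (H (real (D i) * \<pi> x i)) - \<pi> (f x) 0\<bar> < 1/4" using \<eta>(3) by simp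
      qed
      from degree[OF f(1) this] have "real (D N * k) = real (D i)" using f(2) D_pos[of i] by simp
      then have HD: "lift (real (D i)) (real (D i)) H" using H by simp
      obtain g where g: "g \<in> homeos X" "lifts i H g" using lifts_exists[OF HD] by blast
      have "mdist m (f x) (g x) \<le> \<epsilon>" if x: "x \<in> topspace X" for x
      proof -
        have "\<pi> (g x) N = zig (B (real (D i) * \<pi> x i))"
          using liftsD(2)[OF g(2) x order_refl iN] D_pos[of N] by (simp add: H_def)
        then have "\<bar>\<pi> (f x) N - \<pi> (g x) N\<bar> \<le> \<delta>" using B(2)[OF x] \<eta>(2) by simp
        from \<delta>(2)[OF into[OF f(1) x] into[OF g(1) x] this] show ?thesis by simp
      qed
      then show ?thesis using g unfolding S lifted_homeos_def by blast
    qed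
    then show "f \<in> G.uniform_closure" using f(1) unfolding G.uniform_closure_def m by blast
  next
    fix f assume fc: "f \<in> G.uniform_closure"
    then have f: "f \<in> homeos X" unfolding G.uniform_closure_def m by blast
    have "continuous_map (mtopology_of m) (mtopology_of euclidean_metric) (\<lambda>x. \<pi> x 0)"
      unfolding m mtopology_of_euclidean by (rule \<pi>_continuous_real)
    then have "uniformly_continuous_map m euclidean_metric (\<lambda>x. \<pi> x 0)"
      using continuous_imp_uniformly_continuous_map compact_Hausdorff(1) m by blast
    then obtain \<delta> where \<delta>: "\<delta> > 0"
      "\<And>x y. x \<in> mspace m \<Longrightarrow> y \<in> mspace m \<Longrightarrow> mdist m y x < \<delta> \<Longrightarrow> \<bar>\<pi> y 0 - \<pi> x 0\<bar> < 1/4"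
      unfolding uniformly_continuous_map_def
      by (metis mdist_euclidean_metric dist_real_def zero_less_divide_1_iff zero_less_numeral)
    have "\<delta> / 2 > 0" using \<delta>(1) by simp
    from G.uniform_closureD[OF fc this] obtain g where g: "g \<in> lifted_homeos"
      "\<And>x. x \<in> mspace m \<Longrightarrow> mdist m (f x) (g x) \<le> \<delta> / 2" by blast
    obtain i H where H: "lifts i H g" using g(1) by (auto simp: lifted_homeos_def)
    have "approximates (\<lambda>x. \<pi> (f x) 0) i (D i) H"
      unfolding approximates_def
    proof (intro conjI ballI liftsD(1)[OF H])
      show "D i \<ge> 1" using D_pos[of i] by simp
      fix x assume x: "x \<in> topspace X"
      have fx: "f x \<in> mspace m" "g x \<in> mspace m"
        using into[OF f x] into[OF _ x, of g] g(1) S by (auto simp: lifted_homeos_def)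
      have "mdist m (g x) (f x) < \<delta>"
        using g(2)[of x] x \<delta>(1) unfolding S by (simp add: mdist_commute[of m "g x"])
      from \<delta>(2)[OF fx this] show "\<bar>zig (H (real (D i) * \<pi> x i)) - \<pi> (f x) 0\<bar> < 1/4"
        using liftsD(2)[OF H x order_refl, of 0] by simp
    qed
    from degree[OF f this] have "knaster_degree X d \<pi> f = 1" using D_pos[of i] by simp
    then show "f \<in> homeos_degree_1 X d \<pi>" using f by (simp add: homeos_degree_1_def)
  qed
qed

theorem homeos_degree_1_extremely_amenable:
  assumes m: "mtopology_of m = X" and even: "\<And>N. \<exists>n\<ge>N. even (d n)"
  shows "extremely_amenable TYPE('x) (perm_group (mspace m) (homeos_degree_1 X d \<pi>))
           (uniform_topology m (homeos_degree_1 X d \<pi>))"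
proof -
  interpret G: compact_metric_homeos m lifted_homeos by (rule compact_metric_lifted_homeos[OF m])
  interpret C: compact_metric_homeos m G.uniform_closure by (rule G.compact_metric_homeos_closure)
  have "oscillation_stable m G.uniform_closure"
    by (rule G.oscillation_stable_closure[OF lifted_homeos_oscillation_stable[OF m]])
  from C.extremely_amenable_if_oscillation_stable[OF this]
  show ?thesis unfolding homeos_degree_1_eq_closure[OF m even] .
qed

end

section \<open>Extreme amenability of both groups\<close>

theorem theorem7p4:
  shows "(\<forall>A F m. generic_sequence A F \<and> mtopology_of m = Kstar_limit A F \<longrightarrow>
            extremely_amenable TYPE('x)
              (perm_group (mspace m) (Kstar_Aut A F))
              (uniform_topology m (Kstar_Aut A F))) \<and>
         (\<forall>(m :: 'k metric) d \<pi>.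
            universal_knaster_continuum (mtopology_of m) \<and>
            tent_presentation (mtopology_of m) d \<pi> \<longrightarrow>
            extremely_amenable TYPE('x)
              (perm_group (mspace m) (homeos_degree_1 (mtopology_of m) d \<pi>))
              (uniform_topology m (homeos_degree_1 (mtopology_of m) d \<pi>)))"
proof (intro conjI allI impI; elim conjE)
  fix A F and m :: "(nat \<Rightarrow> nat) metric"
  assume "generic_sequence A F" and m: "mtopology_of m = Kstar_limit A F"
  then interpret generic A F by unfold_locales
  show "extremely_amenable TYPE('x) (perm_group (mspace m) (Kstar_Aut A F))
      (uniform_topology m (Kstar_Aut A F))"
    by (rule Aut_extremely_amenable[OF m])
next
  fix m :: "'k metric" and d \<pi>
  assume U: "universal_knaster_continuum (mtopology_of m)"
    and "tent_presentation (mtopology_of m) d \<pi>"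
  then interpret tent_limit "mtopology_of m" d \<pi> by unfold_locales
  show "extremely_amenable TYPE('x) (perm_group (mspace m) (homeos_degree_1 (mtopology_of m) d \<pi>))
      (uniform_topology m (homeos_degree_1 (mtopology_of m) d \<pi>))"
    by (rule homeos_degree_1_extremely_amenable[OF refl universal_imp_infinitely_many_even[OF U]])
qed

end
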